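(* Let $\alpha\in(1/2,1)$ and let $f$ be a function on $\Omega_+$ with $\tilde f=f\circ\mathcal F^{-1}\in\mathcal C^\alpha(T^1)$ and $\langle f\rangle_\wp=0$. Then, provided $\bar\mu$ is sufficiently small (depending on $\alpha$ and $M$), the series $$\sigma_f^2=\langle f^2\rangle_\wp+2\sum_{t=1}^\infty\langle f\cdot f\circ S^t\rangle_\wp$$ converges absolutely, $\sigma_f^2\ge0$, and the variance of $S_n(\cdot\mid f)/\sqrt n$ under $\wp$, where $S_n(\widehat\zeta\mid f)=\sum_{t=0}^{n-1}f(S^t\widehat\zeta)$, converges to $\sigma_f^2$ as $n\to\infty$. Moreover, if $\sigma_f^2>0$, the distribution of $S_n(\cdot\mid f)/\sqrt n$ under $\wp$ converges weakly to the centered Gaussian distribution with variance $\sigma_f^2$.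
   Context: Model. Fix $d\ge1$. $(X_t,\xi_t)_{t\in\mathbb{Z}_+}$ is a Markov chain with $X_t\in\mathbb{Z}^d$, $X_0=0$, $\xi_t\in\Omega:=\{-1,+1\}^{\mathbb{Z}^d}$. Given $X_t=x,\xi_t=\bar\xi$, the next position and the next environment are conditionally independent; $P(X_{t+1}=x+u\mid X_t=x,\xi_t=\bar\xi)=P_0(u)+\epsilon c(u)\bar\xi(x)$, where $\epsilon>0$, $P_0$ is an even, finite-range probability distribution on $\mathbb{Z}^d$ with $|\sum_u P_0(u)e^{i(\lambda,u)}|=1$ iff $\lambda=0$ and such that $1/\tilde p_0(\lambda)$ (with $\tilde p_0(\lambda)=\sum_u P_0(u)e^{i(\lambda,u)}$) has absolutely summable Fourier coefficients, and $c$ is an odd finite-range real function with $P_0(u)\pm\epsilon c(u)\in[0,1)$. Given $X_t=x,\xi_t=\bar\xi$, the values $\xi_{t+1}(y)$, $y\in\mathbb{Z}^d$, are independent with $P(\xi_{t+1}(y)=s)=Q_0(\bar\xi(y),s)$ if $y\ne x$ and $Q_1(\bar\xi(y),s)$ if $y=x$, where $Q_0,Q_1$ are symmetric $2\times2$ stochastic matrices, $Q_0$ has eigenvalues $1,\mu$ with $0<|\mu|<1$, and $Q_1-Q_0=O(\epsilon)$. The environment seen from the walk, $\eta_t(x)=\xi_t(X_t+x)$, is a Markov chain on $\Omega$ with stochastic operator $(\mathcal T f)(\bar\eta)=\mathcal E[f(\eta_{t+1})\mid\eta_t=\bar\eta]$. $\Pi_0$ is the product of uniform measures on $\{\pm1\}$.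 For finite $\Gamma\subset\mathbb{Z}^d$ let $\Phi_\Gamma(\eta)=\prod_{x\in\Gamma}\eta(x)$, $\Phi_\emptyset=1$; each $f\in L^2(\Omega,\Pi_0)$ is written $f=\sum_\Gamma f_\Gamma\Phi_\Gamma$. For a fixed $M>1$, $\mathcal H_M=\{f:\|f\|_M:=\sum_\Gamma|f_\Gamma|M^{|\Gamma|}<\infty\}$. Standing assumptions (valid for $\epsilon,|\mu|$ small): $\mathcal T$ maps $\mathcal H_M$ into itself; the chain $(\eta_t)$ has an invariant probability measure $\Pi$, absolutely continuous w.r.t. $\Pi_0$ with bounded density; there is $\bar\mu\in(0,1)$ with $\|\mathcal T f\|_M\le\bar\mu\|f\|_M$ for all $f\in\widehat{\mathcal H}_M:=\{f\in\mathcal H_M:\int f\,d\Pi=0\}$. The dynamics and $\Pi$ are invariant under the global spin flip $\eta\mapsto-\eta$. Path space notation: $\mathcal P_\Pi$ is the law of $(\eta_t)_{t\ge0}$ with $\eta_0\sim\Pi$. $\zeta_t:=\eta_t(0)$, $\widehat\zeta=(\zeta_t)_{t\ge0}\in\Omega_+:=\{\pm1\}^{\mathbb{Z}_+}$; $\wp$ is the law of $\widehat\zeta$ under $\mathcal P_\Pi$, $\langle\cdot\rangle_\wp$ its expectation; $S$ is the time shift $S\widehat\zeta=(\zeta_1,\zeta_2,\dots)$. $\mu_*:=M\sqrt{\bar\mu(1+2\bar\mu)}$. Torus map: $T^1=[0,1)$ mod 1; $\mathcal F:\Omega_+\to T^1$ sends $\widehat\zeta$ to $\sum_{t\ge0}a_t2^{-t-1}$,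 $a_t=(1-\zeta_t)/2$, invertible off the countable set of sequences with $\zeta_t=-1$ for all large $t$; $\tilde f:=f\circ\mathcal F^{-1}$. $\mathcal C^\alpha(T^1)$ is the space of $\alpha$-Hölder functions with seminorm $\|g\|_\alpha=\sup_{x\ne y}|g(x)-g(y)|/|x-y|^\alpha$ and norm $\|g\|_{\mathcal C^\alpha}=\|g\|_\infty+\|g\|_\alpha$. *)

theory Defs
  imports "HOL-Probability.Probability"
begin

text \<open>Sites of Z^d are integer lists of length d (so that d can be an ordinary parameter).
 Spins are encoded as booleans: True = +1, False = -1.\<close>

definition sites :: "nat \<Rightarrow> int list set" where
  "sites d = {x. length x = d}"

definition zerov :: "nat \<Rightarrow> int list" where
  "zerov d = replicate d 0"

definition vadd :: "int list \<Rightarrow> int list \<Rightarrow> int list" where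
  "vadd u x = map2 (+) u x"

definition vneg :: "int list \<Rightarrow> int list" where
  "vneg u = map uminus u"

definition spin :: "bool \<Rightarrow> real" where
  "spin b = (if b then 1 else -1)"

definition OmegaM :: "nat \<Rightarrow> (int list \<Rightarrow> bool) measure" where
  "OmegaM d = PiM (sites d) (\<lambda>_. count_space UNIV)"

definition Pi0 :: "nat \<Rightarrow> (int list \<Rightarrow> bool) measure" where
  "Pi0 d = PiM (sites d) (\<lambda>_. measure_pmf (pmf_of_set UNIV))"

definition shift :: "nat \<Rightarrow> int list \<Rightarrow> (int list \<Rightarrow> bool) \<Rightarrow> (int list \<Rightarrow> bool)" where
  "shift d u xi = (\<lambda>x. if x \<in> sites d then xi (vadd u x) else undefined)"

definition sym_stoch :: "(bool \<Rightarrow> bool \<Rightarrow> real) \<Rightarrow> bool" where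
  "sym_stoch Q \<longleftrightarrow> (\<forall>a b. Q a b = Q b a \<and> 0 \<le> Q a b) \<and> (\<forall>a. Q a True + Q a False = 1)"

definition is_eigenvalue2 :: "(bool \<Rightarrow> bool \<Rightarrow> real) \<Rightarrow> real \<Rightarrow> bool" where
  "is_eigenvalue2 Q mu \<longleftrightarrow> (\<exists>v::bool \<Rightarrow> real. v \<noteq> (\<lambda>_. 0) \<and>
      (\<forall>a. (\<Sum>b\<in>UNIV. Q a b * v b) = mu * v a))"

definition qpmf :: "(bool \<Rightarrow> bool \<Rightarrow> real) \<Rightarrow> bool \<Rightarrow> bool pmf" where
  "qpmf Q a = embed_pmf (Q a)"

text \<open>Law of the new environment, in coordinates relative to the old walker position:
 independent spins, site 0 updated with Q1, other sites with Q0.\<close>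
definition ENV :: "nat \<Rightarrow> (bool \<Rightarrow> bool \<Rightarrow> real) \<Rightarrow> (bool \<Rightarrow> bool \<Rightarrow> real)
                   \<Rightarrow> (int list \<Rightarrow> bool) \<Rightarrow> (int list \<Rightarrow> bool) measure" where
  "ENV d Q0 Q1 eta = PiM (sites d)
      (\<lambda>z. measure_pmf (qpmf (if z = zerov d then Q1 else Q0) (eta z)))"

text \<open>Transition probability of a jump u of the walker, when the environment seen from
 the walker is eta: P_0(u) + eps c(u) eta(0).\<close>
definition jump :: "nat \<Rightarrow> (int list \<Rightarrow> real) \<Rightarrow> (int list \<Rightarrow> real) \<Rightarrow> real
                    \<Rightarrow> (int list \<Rightarrow> bool) \<Rightarrow> int list \<Rightarrow> real" where
  "jump d P0 c eps eta u = P0 u + eps * c u * spin (eta (zerov d))"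

text \<open>Stochastic operator of the environment seen from the walker:
 (T f)(eta) = E[f(eta_(t+1)) | eta_t = eta], where eta_(t+1) = shift u xi', u the jump,
 xi' the new environment (relative coordinates); u and xi' are conditionally independent.\<close>
definition Top :: "nat \<Rightarrow> (int list \<Rightarrow> real) \<Rightarrow> (int list \<Rightarrow> real) \<Rightarrow> real
      \<Rightarrow> (bool \<Rightarrow> bool \<Rightarrow> real) \<Rightarrow> (bool \<Rightarrow> bool \<Rightarrow> real)
      \<Rightarrow> ((int list \<Rightarrow> bool) \<Rightarrow> real) \<Rightarrow> (int list \<Rightarrow> bool) \<Rightarrow> real" where
  "Top d P0 c eps Q0 Q1 f eta =
     (\<Sum>\<^sub>\<infinity>u\<in>sites d. jump d P0 c eps eta u * (\<integral>xi. f (shift d u xi) \<partial>ENV d Q0 Q1 eta))"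

definition ipr :: "real list \<Rightarrow> int list \<Rightarrow> real" where
  "ipr lam u = sum_list (map2 (\<lambda>a b. a * of_int b) lam u)"

definition torus_d :: "nat \<Rightarrow> real list set" where
  "torus_d d = {lam. length lam = d \<and> (\<forall>i<d. - pi \<le> lam ! i \<and> lam ! i < pi)}"

definition ptilde :: "nat \<Rightarrow> (int list \<Rightarrow> real) \<Rightarrow> real list \<Rightarrow> complex" where
  "ptilde d P0 lam = (\<Sum>\<^sub>\<infinity>u\<in>sites d. complex_of_real (P0 u) * cis (ipr lam u))"

definition Phi :: "int list set \<Rightarrow> (int list \<Rightarrow> bool) \<Rightarrow> real" where
  "Phi G eta = (\<Prod>x\<in>G. spin (eta x))"

definition fin_subsets :: "nat \<Rightarrow> int list set set" where
  "fin_subsets d = {G. finite G \<and> G \<subseteq> sites d}"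

definition HMc :: "nat \<Rightarrow> real \<Rightarrow> (int list set \<Rightarrow> real) set" where
  "HMc d M = {a. (\<lambda>G. \<bar>a G\<bar> * M ^ card G) summable_on fin_subsets d}"

definition Mnorm :: "nat \<Rightarrow> real \<Rightarrow> (int list set \<Rightarrow> real) \<Rightarrow> real" where
  "Mnorm d M a = (\<Sum>\<^sub>\<infinity>G\<in>fin_subsets d. \<bar>a G\<bar> * M ^ card G)"

definition fun_of :: "nat \<Rightarrow> (int list set \<Rightarrow> real) \<Rightarrow> (int list \<Rightarrow> bool) \<Rightarrow> real" where
  "fun_of d a eta = (\<Sum>\<^sub>\<infinity>G\<in>fin_subsets d. a G * Phi G eta)"

definition OmegaPlus :: "(nat \<Rightarrow> bool) measure" where
  "OmegaPlus = PiM UNIV (\<lambda>_. count_space UNIV)"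

text \<open>Finite dimensional distributions of the Markov chain (eta_t) observed at the origin:
 W [g_0,...,g_(n-1)] eta = E[ prod_t g_t(eta_t(0)) | eta_0 = eta ].\<close>
fun W :: "(((int list \<Rightarrow> bool) \<Rightarrow> real) \<Rightarrow> (int list \<Rightarrow> bool) \<Rightarrow> real) \<Rightarrow> int list
          \<Rightarrow> (bool \<Rightarrow> real) list \<Rightarrow> (int list \<Rightarrow> bool) \<Rightarrow> real" where
  "W T z [] eta = 1"
| "W T z (g # gs) eta = g (eta z) * T (W T z gs) eta"

definition Sshift :: "(nat \<Rightarrow> bool) \<Rightarrow> (nat \<Rightarrow> bool)" where
  "Sshift w = (\<lambda>t. w (Suc t))"

definition Ssum :: "((nat \<Rightarrow> bool) \<Rightarrow> real) \<Rightarrow> nat \<Rightarrow> (nat \<Rightarrow> bool) \<Rightarrow> real" where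
  "Ssum f n w = (\<Sum>t<n. f ((Sshift ^^ t) w))"

definition pvar :: "'a measure \<Rightarrow> ('a \<Rightarrow> real) \<Rightarrow> real" where
  "pvar P X = (\<integral>w. (X w - (\<integral>v. X v \<partial>P))\<^sup>2 \<partial>P)"

text \<open>F(zeta) = sum_t a_t 2^(-t-1) with a_t = (1 - zeta_t)/2, i.e. a_t = 0 iff zeta_t = +1.\<close>
definition Fmap :: "(nat \<Rightarrow> bool) \<Rightarrow> real" where
  "Fmap w = (\<Sum>t. (if w t then 0 else 1) / 2 ^ (t + 1))"

text \<open>Sequences NOT eventually equal to -1; F is invertible on this set.\<close>
definition Oreg :: "(nat \<Rightarrow> bool) set" where
  "Oreg = {w. \<not> (\<exists>N. \<forall>t\<ge>N. \<not> w t)}"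

definition tilde :: "((nat \<Rightarrow> bool) \<Rightarrow> real) \<Rightarrow> real \<Rightarrow> real" where
  "tilde f = f \<circ> inv_into Oreg Fmap"

definition tdist :: "real \<Rightarrow> real \<Rightarrow> real" where
  "tdist x y = min \<bar>x - y\<bar> (1 - \<bar>x - y\<bar>)"

definition holder_T1 :: "real \<Rightarrow> (real \<Rightarrow> real) \<Rightarrow> bool" where
  "holder_T1 alpha g \<longleftrightarrow> bounded (g ` {0..<1}) \<and>
     (\<exists>L. \<forall>x\<in>{0..<1}. \<forall>y\<in>{0..<1}. \<bar>g x - g y\<bar> \<le> L * tdist x y powr alpha)"

end

theory Submission
  imports Defs "HOL-Real_Asymp.Real_Asymp"
begin

text \<open>
  If \<open>G\<close> is a function of finitely many observed spins with
  \<open>\<bar>G\<bar> \<le> 1\<close>, its conditional expectation given \<open>\<eta>\<^sub>0\<close> is obtained by alternately multiplying by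
  the indicator of a spin value at the origin, which costs a factor \<open>(1 + M) / 2\<close>, and applying the
  transition operator, which multiplies the centered part by at most \<open>mubar\<close>. As the means are
  bounded by 1, \<open>mubar (1 + M) \<le> 1/2\<close> keeps all these conditional expectations below \<open>2 M + 3\<close> in
  \<open>M\<close>-norm, uniformly in the number of coordinates. Hence the correlation of the first \<open>n\<close> spins with
  the spins after time \<open>n + k\<close> is \<open>O(mubar\<^sup>k)\<close>, uniformly over bounded functions of either.

  A Hoelder function on the torus is uniformly approximated by functions of the first \<open>r\<close> digits
  with error \<open>O(2 powr (- alpha r))\<close> on sequences that are not eventually \<open>-1\<close>, and these have full
  measure. So the covariances decay exponentially, which gives the variance statements, and the
  central limit theorem follows from characteristic functions and Bernstein's method of blocks
  separated by gaps.
\<close>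

section \<open>Cylinder functions on sequence space\<close>

text \<open>A function of \<open>n\<close> spins is a combination of up to 2^n words, and adding
  norm bounds word by word would lose a factor per coordinate. The recursion therefore runs over
  whole functions \<open>G\<close>: fixing the first letter leaves two functions of the remaining
  spins; their centered images under the operator are small, and their means, bounded by 1 because
  they are expectations, restart the bound at each step instead of accumulating. For the past only
  the supremum norm is used: the operator, being an average, does not increase it, so multiplying by
  functions of past spins is free. Two inputs lie outside this estimate. Invariance is given for
  indicators of events and has to reach all absolutely convergent expansions; the two-valued spin
  monomials are the bridge. Full measure of the regular sequences rests on a positive chance of a +
  spin at the origin: no jump has probability 1, so the walker may step to another site, whose spin
  was refreshed by \<open>Q0\<close>, and \<open>Q0\<close> has positive entries because it has an
  eigenvalue of modulus below 1.\<close>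

definition wprefix :: "nat \<Rightarrow> (nat \<Rightarrow> bool) \<Rightarrow> bool list" where
  "wprefix n w = map w [0..<n]"

text \<open>The filler \<open>True\<close> makes every \<open>wextend v\<close> a sequence that is
  not eventually -1, so an observable evaluated there is controlled through its torus
  version.\<close>

definition wextend :: "bool list \<Rightarrow> nat \<Rightarrow> bool" where
  "wextend v i = (if i < length v then v ! i else True)"

definition cylindrical :: "nat \<Rightarrow> ((nat \<Rightarrow> bool) \<Rightarrow> 'a) \<Rightarrow> bool" where
  "cylindrical n F \<longleftrightarrow> (\<forall>w w'. (\<forall>i<n. w i = w' i) \<longrightarrow> F w = F w')"

lemma length_wprefix [simp]: "length (wprefix n w) = n"
  by (simp add: wprefix_def)

lemma Sshift_pow: "(Sshift ^^ t) w = (\<lambda>i. w (t + i))"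
  by (induction t arbitrary: w) (auto simp: Sshift_def funpow_Suc_right simp del: funpow.simps)

lemma Sshift_pow_add: "(Sshift ^^ t) ((Sshift ^^ s) w) = (Sshift ^^ (s + t)) w"
  by (simp add: Sshift_pow add.assoc)

lemma cylindricalD: "cylindrical n F \<Longrightarrow> (\<And>i. i < n \<Longrightarrow> w i = w' i) \<Longrightarrow> F w = F w'"
  by (auto simp: cylindrical_def)

lemma cylindrical_wextend:
  assumes "cylindrical n F" shows "F w = F (wextend (wprefix n w))"
  by (rule cylindricalD[OF assms]) (auto simp: wextend_def wprefix_def)

lemma cylindrical_mono: "cylindrical n F \<Longrightarrow> n \<le> m \<Longrightarrow> cylindrical m F"
  by (auto simp: cylindrical_def)

lemma cylindrical_compose: "cylindrical n F \<Longrightarrow> cylindrical n (\<lambda>w. h (F w))"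
proof -
  assume F: "cylindrical n F"
  have "h (F w) = h (F w')" if "\<forall>i<n. w i = w' i" for w w'
    using cylindricalD[OF F, of w w'] that by simp
  then show ?thesis by (simp add: cylindrical_def)
qed

lemma cylindrical_Sshift_pow:
  assumes "cylindrical n F" shows "cylindrical (t + n) (\<lambda>w. F ((Sshift ^^ t) w))"
  unfolding cylindrical_def Sshift_pow
  by (auto intro!: cylindricalD[OF assms])

lemma cylindrical_sum:
  assumes "\<And>i. i \<in> I \<Longrightarrow> cylindrical n (F i)"
  shows "cylindrical n (\<lambda>w. \<Sum>i\<in>I. F i w)"
  unfolding cylindrical_def
proof (intro allI impI sum.cong refl)
  fix w w' :: "nat \<Rightarrow> bool" and i assume "\<forall>j<n. w j = w' j" "i \<in> I"
  then show "F i w = F i w'" using cylindricalD[OF assms, of i w w'] by simp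
qed

lemma wprefix_eq_iff: "wprefix n w = v \<longleftrightarrow> length v = n \<and> (\<forall>i<n. w i = v ! i)"
  by (auto simp: wprefix_def list_eq_iff_nth_eq)

lemma measurable_wprefix [measurable]: "wprefix n \<in> measurable OmegaPlus (count_space UNIV)"
proof (rule measurableI)
  fix A :: "bool list set"
  have eq: "{w \<in> space OmegaPlus. wprefix n w = v} =
      (if length v = n then {w \<in> space OmegaPlus. \<forall>i<n. w i = v ! i} else {})" for v
    by (auto simp: wprefix_eq_iff)
  have "wprefix n -` A \<inter> space OmegaPlus =
      (\<Union>v\<in>{v. length v = n \<and> v \<in> A}. {w \<in> space OmegaPlus. wprefix n w = v})"
    by auto
  also have "\<dots> \<in> sets OmegaPlus"
  proof (rule sets.finite_UN)
    show "finite {v. length v = n \<and> v \<in> A}"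
      by (rule finite_subset[OF _ finite_lists_length_eq[of "UNIV::bool set" n]]) auto
    show "{w \<in> space OmegaPlus. wprefix n w = v} \<in> sets OmegaPlus" for v
      unfolding eq by (auto simp: OmegaPlus_def)
  qed
  finally show "wprefix n -` A \<inter> space OmegaPlus \<in> sets OmegaPlus" .
qed auto

lemma measurable_cylindrical:
  assumes "cylindrical n F" shows "F \<in> measurable OmegaPlus (count_space UNIV)"
proof -
  have "(\<lambda>w. (F \<circ> wextend) (wprefix n w)) \<in> measurable OmegaPlus (count_space UNIV)"
    by (rule measurable_compose[OF measurable_wprefix]) simp
  also have "(\<lambda>w. (F \<circ> wextend) (wprefix n w)) = F"
    using cylindrical_wextend[OF assms] by auto
  finally show ?thesis .
qed

lemma borel_measurable_cylindrical:
  fixes F :: "(nat \<Rightarrow> bool) \<Rightarrow> 'a :: topological_space"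
  assumes "cylindrical n F" shows "F \<in> borel_measurable OmegaPlus"
  using measurable_compose[OF measurable_cylindrical[OF assms], of "\<lambda>x. x" borel] by simp

lemma measurable_Sshift: "Sshift \<in> measurable OmegaPlus OmegaPlus"
  unfolding OmegaPlus_def Sshift_def[abs_def]
  by (rule measurable_PiM_single') (auto simp: space_PiM)

section \<open>Elementary estimates for characteristic functions and averages\<close>

lemma (in prob_space) cmod_expectation_exp_diff_le:
  assumes [measurable]: "A \<in> borel_measurable M" "B \<in> borel_measurable M"
    and int: "integrable M (\<lambda>x. \<bar>A x - B x\<bar>)"
  shows "cmod (expectation (\<lambda>x. iexp (A x)) - expectation (\<lambda>x. iexp (B x)))
      \<le> expectation (\<lambda>x. \<bar>A x - B x\<bar>)"
proof -
  have i: "integrable M (\<lambda>x. iexp (A x))" "integrable M (\<lambda>x. iexp (B x))"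
    by (auto intro!: integrable_const_bound[where B=1])
  \<comment> \<open>The map a -> exp(i a) is 1-Lipschitz, so L1 closeness of two random variables
    bounds the distance of their characteristic functions.\<close>
  have *: "cmod (iexp a - iexp b) \<le> \<bar>a - b\<bar>" for a b :: real
  proof -
    have "iexp a - iexp b = iexp b * (iexp (a - b) - 1)"
      by (simp add: algebra_simps flip: exp_add)
    then have "cmod (iexp a - iexp b) = cmod (iexp (a - b) - 1)"
      by (simp add: norm_mult)
    also have "\<dots> \<le> \<bar>a - b\<bar>"
      using iexp_approx1[of "a - b" 0] by simp
    finally show ?thesis .
  qed
  have "cmod (expectation (\<lambda>x. iexp (A x)) - expectation (\<lambda>x. iexp (B x)))
      = cmod (expectation (\<lambda>x. iexp (A x) - iexp (B x)))"
    using i by simp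
  also have "\<dots> \<le> expectation (\<lambda>x. cmod (iexp (A x) - iexp (B x)))"
    by (rule integral_norm_bound)
  also have "\<dots> \<le> expectation (\<lambda>x. \<bar>A x - B x\<bar>)"
    using i by (intro integral_mono int * integrable_norm Bochner_Integration.integrable_diff)
  finally show ?thesis .
qed

text \<open>Used for the variance of partial sums: divided by \<open>n\<close> it is the Cesaro mean
  of the partial sums of the covariance series.\<close>

lemma cesaro_mean_tendsto:
  fixes b :: "nat \<Rightarrow> real"
  assumes "b \<longlonglongrightarrow> l"
  shows "(\<lambda>n. (\<Sum>j<n. b j) / real n) \<longlonglongrightarrow> l"
proof -
  have "convergent (\<lambda>n. b n - l)"
    by (rule convergentI[of _ "l - l"]) (intro tendsto_intros assms)
  then obtain B where B: "\<And>n. \<bar>b n - l\<bar> \<le> B"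
    using convergent_imp_Bseq[of "\<lambda>n. b n - l"] by (force simp: Bseq_def)
  have B0: "B \<ge> 0" using B[of 0] by linarith
  have "(\<lambda>n. (\<Sum>j<n. b j) / real n - l) \<longlonglongrightarrow> 0"
  proof (rule LIMSEQ_I)
    fix e :: real assume e: "e > 0"
    obtain N where N: "\<And>n. n \<ge> N \<Longrightarrow> \<bar>b n - l\<bar> < e / 2"
      using LIMSEQ_D[OF assms, of "e/2"] e by auto
    obtain N' :: nat where N': "real N' > 2 * real N * B / e"
      using reals_Archimedean2 by blast
    show "\<exists>no. \<forall>n\<ge>no. norm ((\<Sum>j<n. b j) / real n - l - 0) < e"
    proof (intro exI allI impI)
      fix n assume n: "n \<ge> max (max N N') 1"
      have "\<bar>\<Sum>j<n. (b j - l)\<bar> \<le> (\<Sum>j<n. \<bar>b j - l\<bar>)" by (rule sum_abs)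
      also have "\<dots> = (\<Sum>j<N. \<bar>b j - l\<bar>) + (\<Sum>j=N..<n. \<bar>b j - l\<bar>)"
        using n by (subst sum.atLeastLessThan_concat[of 0 N n, symmetric, unfolded atLeast0LessThan]) auto
      also have "\<dots> \<le> (\<Sum>j<N. B) + (\<Sum>j=N..<n. e / 2)"
        using B N by (intro add_mono sum_mono) (auto intro: less_imp_le)
      also have "\<dots> \<le> real N * B + real n * (e / 2)"
        using e n by (simp add: mult_right_mono)
      also have "real N * B < real n * (e / 2)"
      proof -
        have "2 * real N * B / e < real n" using N' n by linarith
        then show ?thesis using e by (simp add: field_simps)
      qed
      finally have "\<bar>\<Sum>j<n. (b j - l)\<bar> < e * real n" by (simp add: mult.commute)
      moreover have "(\<Sum>j<n. b j) / real n - l = (\<Sum>j<n. (b j - l)) / real n"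
        using n by (simp add: sum_subtractf field_simps)
      ultimately show "norm ((\<Sum>j<n. b j) / real n - l - 0) < e"
        using n by (simp add: divide_less_eq)
    qed
  qed
  then show ?thesis by (simp add: LIM_zero_iff)
qed

text \<open>Turns the second-order Taylor polynomial \<open>1 - y\<close> of a block's
  characteristic function into \<open>exp (- y)\<close>, whose powers are again
  exponentials.\<close>

lemma abs_one_minus_exp_le:
  fixes y :: real assumes "0 \<le> y" "y \<le> 1"
  shows "\<bar>(1 - y) - exp (- y)\<bar> \<le> y\<^sup>2"
proof -
  have "1 - y \<le> exp (- y)" using exp_ge_add_one_self[of "-y"] by simp
  moreover have "exp (- y) \<le> 1 - y + y\<^sup>2"
  proof -
    have "exp (- y) \<le> 1 / (1 + y)"
      using exp_ge_add_one_self[of y] assms by (simp add: exp_minus field_simps)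
    also have "\<dots> \<le> 1 - y + y\<^sup>2"
      using assms by (simp add: field_simps power2_eq_square)
    finally show ?thesis .
  qed
  ultimately show ?thesis by simp
qed

section \<open>Exponentially mixing stationary sequences\<close>

lemma (in prob_space) norm_expectation_le:
  fixes h :: "'a \<Rightarrow> 'b :: {banach, second_countable_topology}"
  assumes "h \<in> borel_measurable M" "AE x in M. norm (h x) \<le> c"
  shows "norm (expectation h) \<le> c"
proof -
  have "norm (expectation h) \<le> expectation (\<lambda>x. norm (h x))"
    by (rule integral_norm_bound)
  also have "\<dots> \<le> c"
    using assms by (intro integral_le_const integrable_norm integrable_const_bound[of _ c]) auto
  finally show ?thesis .
qed

lemma (in prob_space) expectation_abs_le_sqrt:
  assumes [measurable]: "Y \<in> borel_measurable M" and b: "AE x in M. \<bar>Y x\<bar> \<le> c"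
  shows "expectation (\<lambda>x. \<bar>Y x\<bar>) \<le> sqrt (expectation (\<lambda>x. (Y x)\<^sup>2))"
proof -
  have c2: "AE x in M. (Y x)\<^sup>2 \<le> c\<^sup>2"
    using b by eventually_elim (metis abs_ge_zero power2_abs power_mono)
  have i: "integrable M (\<lambda>x. \<bar>Y x\<bar>)" "integrable M (\<lambda>x. \<bar>Y x\<bar>\<^sup>2)"
    using b c2 integrable_const_bound[of "\<lambda>x. \<bar>Y x\<bar>" c] integrable_const_bound[of "\<lambda>x. \<bar>Y x\<bar>\<^sup>2" "c\<^sup>2"]
    by auto
  have "0 \<le> variance (\<lambda>x. \<bar>Y x\<bar>)" by (rule variance_positive)
  also have "\<dots> = expectation (\<lambda>x. \<bar>Y x\<bar>\<^sup>2) - (expectation (\<lambda>x. \<bar>Y x\<bar>))\<^sup>2"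
    by (rule variance_eq[OF i])
  finally show ?thesis by (intro real_le_rsqrt) simp
qed

text \<open>\<open>C\<close> and \<open>\<theta>\<close> do not depend on the lengths
  \<open>n\<close> and \<open>m\<close>; this uniformity is what admits blocks whose length and
  number grow. Functions of words keep the condition to finitely many coordinates, where
  measurability is automatic.\<close>

locale mixing_sequence = prob_space P for P :: "(nat \<Rightarrow> bool) measure" +
  fixes C \<theta> :: real
  assumes sets_P [measurable_cong]: "sets P = sets OmegaPlus"
    and stationary: "distr P P Sshift = P"
    and theta: "0 < \<theta>" "\<theta> < 1"
    and mixing: "\<And>n k m (F :: bool list \<Rightarrow> real) G. (\<And>v. \<bar>F v\<bar> \<le> 1) \<Longrightarrow> (\<And>v. \<bar>G v\<bar> \<le> 1) \<Longrightarrow>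
       \<bar>expectation (\<lambda>w. F (wprefix n w) * G (wprefix m ((Sshift ^^ (n + k)) w)))
          - expectation (\<lambda>w. F (wprefix n w)) * expectation (\<lambda>w. G (wprefix m w))\<bar> \<le> C * \<theta> ^ k"
begin

lemma C_nonneg: "0 \<le> C"
  using mixing[of "\<lambda>_. 0" "\<lambda>_. 0" 0 0 0] by simp

lemma space_P [simp]: "space P = UNIV"
  using sets_eq_imp_space_eq[OF sets_P] by (simp add: OmegaPlus_def space_PiM)

lemma measurable_Sshift_pow [measurable]: "(Sshift ^^ t) \<in> measurable P P"
proof (induction t)
  case (Suc t)
  have "Sshift \<in> measurable P P"
    using measurable_Sshift by (simp cong: measurable_cong_sets add: sets_P)
  with Suc show ?case by (simp add: measurable_comp)
qed (simp add: measurable_ident)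

lemma distr_Sshift_pow: "distr P P (Sshift ^^ t) = P"
proof (induction t)
  case (Suc t)
  have "distr P P (Sshift ^^ Suc t) = distr (distr P P (Sshift ^^ t)) P Sshift"
    using measurable_Sshift_pow[of 1] by (subst distr_distr) (auto simp: o_def)
  also have "\<dots> = P" by (simp only: Suc stationary)
  finally show ?case .
qed (simp add: distr_id2)

lemma expectation_shift:
  fixes h :: "(nat \<Rightarrow> bool) \<Rightarrow> 'b :: {banach, second_countable_topology}"
  assumes "h \<in> borel_measurable P"
  shows "expectation (\<lambda>w. h ((Sshift ^^ t) w)) = expectation h"
  using integral_distr[OF measurable_Sshift_pow[of t] assms] by (simp add: distr_Sshift_pow)

lemma AE_shift:
  assumes "AE w in P. Q w" shows "AE w in P. Q ((Sshift ^^ t) w)"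
  by (rule AE_distrD[OF measurable_Sshift_pow[of t]]) (simp only: distr_Sshift_pow assms)

lemma cylindrical_measurable:
  fixes F :: "(nat \<Rightarrow> bool) \<Rightarrow> 'a :: topological_space"
  assumes "cylindrical n F" shows "F \<in> borel_measurable P"
  using borel_measurable_cylindrical[OF assms] by (simp cong: measurable_cong_sets add: sets_P)

lemma mixing_cylindrical:
  fixes F G :: "(nat \<Rightarrow> bool) \<Rightarrow> real"
  assumes F: "cylindrical n F" "\<And>w. \<bar>F w\<bar> \<le> 1" and G: "cylindrical m G" "\<And>w. \<bar>G w\<bar> \<le> 1"
  shows "\<bar>expectation (\<lambda>w. F w * G ((Sshift ^^ (n + k)) w)) - expectation F * expectation G\<bar> \<le> C * \<theta> ^ k"
  using mixing[of "\<lambda>v. F (wextend v)" "\<lambda>v. G (wextend v)" n m k] F(2) G(2)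
  by (simp flip: cylindrical_wextend[OF F(1)] cylindrical_wextend[OF G(1)])

text \<open>The covariance of complex functions splits into four real ones, from the real and
  imaginary parts of either factor; this is the factor 4.\<close>

lemma mixing_complex:
  fixes F G :: "(nat \<Rightarrow> bool) \<Rightarrow> complex"
  assumes F: "cylindrical n F" "\<And>w. cmod (F w) \<le> 1" and G: "cylindrical m G" "\<And>w. cmod (G w) \<le> 1"
  shows "cmod (expectation (\<lambda>w. F w * G ((Sshift ^^ (n + k)) w)) - expectation F * expectation G)
     \<le> 4 * C * \<theta> ^ k"
proof -
  let ?G = "\<lambda>w. G ((Sshift ^^ (n + k)) w)"
  note [measurable] = cylindrical_measurable[OF F(1)] cylindrical_measurable[OF G(1)]
  define D where "D f g = expectation (\<lambda>w. f (F w) * g (?G w)) - expectation (\<lambda>w. f (F w)) * expectation (\<lambda>w. g (G w))"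
    for f g :: "complex \<Rightarrow> real"
  have D: "\<bar>D f g\<bar> \<le> C * \<theta> ^ k" if "f \<in> {Re, Im}" "g \<in> {Re, Im}" for f g
    unfolding D_def
  proof (rule mixing_cylindrical)
    have le: "\<bar>h z\<bar> \<le> cmod z" if "h \<in> {Re, Im}" for h z
      using that by (auto simp: abs_Re_le_cmod abs_Im_le_cmod)
    show "\<bar>f (F w)\<bar> \<le> 1" for w using le[OF that(1), of "F w"] F(2)[of w] by linarith
    show "\<bar>g (G w)\<bar> \<le> 1" for w using le[OF that(2), of "G w"] G(2)[of w] by linarith
  qed (rule cylindrical_compose[OF F(1)] cylindrical_compose[OF G(1)])+
  have i: "integrable P F" "integrable P G" "integrable P ?G" "integrable P (\<lambda>w. F w * ?G w)"
    using F(2) G(2) by (auto intro!: integrable_const_bound[where B=1] simp: norm_mult mult_le_one)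
  have ii: "integrable P (\<lambda>w. f (F w) * g (?G w))" if "f \<in> {Re, Im}" "g \<in> {Re, Im}" for f g
  proof (rule integrable_const_bound[where B=1])
    have le: "\<bar>h z\<bar> \<le> cmod z" if "h \<in> {Re, Im}" for h z
      using that by (auto simp: abs_Re_le_cmod abs_Im_le_cmod)
    show "AE w in P. norm (f (F w) * g (?G w)) \<le> 1"
      using order_trans[OF le[OF that(1)] F(2)] order_trans[OF le[OF that(2)] G(2)]
      by (auto simp: abs_mult intro!: mult_le_one)
    show "(\<lambda>w. f (F w) * g (?G w)) \<in> borel_measurable P" using that by auto
  qed
  let ?Z = "expectation (\<lambda>w. F w * ?G w) - expectation F * expectation G"
  have "Re ?Z = D Re Re - D Im Im"
    using i ii by (simp add: D_def flip: integral_Re integral_Im)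
  moreover have "Im ?Z = D Re Im + D Im Re"
    using i ii by (simp add: D_def flip: integral_Re integral_Im)
  ultimately have "cmod ?Z \<le> \<bar>D Re Re\<bar> + \<bar>D Im Im\<bar> + \<bar>D Re Im\<bar> + \<bar>D Im Re\<bar>"
    using cmod_le[of ?Z] by linarith
  also have "\<dots> \<le> 4 * (C * \<theta> ^ k)"
    using D[of Re Re] D[of Im Im] D[of Re Im] D[of Im Re] by simp
  finally show ?thesis by simp
qed

end

text \<open>The approximants \<open>g\<close> obey the bound \<open>K\<close> at every sequence, not
  just almost surely, because mixing is applied to \<open>g / K\<close>, which must be bounded by 1
  everywhere; the approximation itself may fail on a null set.\<close>

locale mixing_observable = mixing_sequence +
  fixes f :: "(nat \<Rightarrow> bool) \<Rightarrow> real" and K L \<rho> :: real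
  assumes f_measurable [measurable]: "f \<in> borel_measurable P"
    and K_pos: "0 < K"
    and f_bound: "AE w in P. \<bar>f w\<bar> \<le> K"
    and f_mean: "expectation f = 0"
    and rho: "0 < \<rho>" "\<rho> < 1"
    and approx: "\<And>r. \<exists>g. cylindrical r g \<and> (\<forall>w. \<bar>g w\<bar> \<le> K) \<and> (AE w in P. \<bar>f w - g w\<bar> \<le> L * \<rho> ^ r)"
begin

lemma L_nonneg: "0 \<le> L"
proof -
  obtain g where "AE w in P. \<bar>f w - g w\<bar> \<le> L * \<rho> ^ 0" using approx by blast
  then have "AE w in P. 0 \<le> L" by eventually_elim simp
  then show ?thesis by simp
qed

section \<open>Covariances and second moments of partial sums\<close>

abbreviation X :: "nat \<Rightarrow> (nat \<Rightarrow> bool) \<Rightarrow> real" where "X t w \<equiv> f ((Sshift ^^ t) w)"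

definition cov :: "nat \<Rightarrow> real" where "cov t = expectation (\<lambda>w. f w * X t w)"

lemma X_bound: "AE w in P. \<bar>X t w\<bar> \<le> K"
  using AE_shift[OF f_bound] .

lemma sum_X_bound: "finite I \<Longrightarrow> AE w in P. \<bar>\<Sum>t\<in>I. X t w\<bar> \<le> real (card I) * K"
proof -
  assume I: "finite I"
  have "AE w in P. \<forall>t\<in>I. \<bar>X t w\<bar> \<le> K"
    using I X_bound by (simp add: AE_ball_countable countable_finite)
  then show ?thesis
  proof eventually_elim
    case (elim w)
    have "\<bar>\<Sum>t\<in>I. X t w\<bar> \<le> (\<Sum>t\<in>I. \<bar>X t w\<bar>)" by (rule sum_abs)
    also have "\<dots> \<le> (\<Sum>t\<in>I. K)" using elim by (intro sum_mono) auto
    finally show ?case by simp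
  qed
qed

lemma integrable_XX: "integrable P (\<lambda>w. X s w * X t w)"
proof (rule integrable_const_bound[where B="K * K"])
  show "AE w in P. norm (X s w * X t w) \<le> K * K"
    using X_bound[of s] X_bound[of t]
    by eventually_elim (auto simp: abs_mult intro!: mult_mono)
qed measurable

lemma integrable_X: "integrable P (X t)"
  by (rule integrable_const_bound[where B=K]) (use X_bound in auto)

lemma expectation_X: "expectation (X t) = 0"
  using expectation_shift[OF f_measurable, of t] f_mean by simp

lemma expectation_XX: "s \<le> t \<Longrightarrow> expectation (\<lambda>w. X s w * X t w) = cov (t - s)"
  using expectation_shift[of "\<lambda>w. f w * X (t - s) w" s] unfolding cov_def
  by (simp add: Sshift_pow_add)

text \<open>Half of the lag pays for the approximation and half for the mixing: \<open>g\<close>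
  depends on \<open>t div 2\<close> coordinates, which leaves a gap of at least
  \<open>t div 2\<close>. The three constants come from mixing of \<open>g\<close>, from replacing
  \<open>f\<close> by \<open>g\<close> in the product, and from the mean of \<open>g\<close>, which
  is small because that of \<open>f\<close> vanishes.\<close>

lemma abs_cov_le:
  "\<bar>cov t\<bar> \<le> (C * K\<^sup>2 + 2 * K * L + L\<^sup>2) * (max \<theta> \<rho>) ^ (t div 2)"
proof -
  define r where "r = t div 2"
  define k where "k = t - r"
  have t: "t = r + k" "r \<le> k" by (auto simp: r_def k_def)
  obtain g where g: "cylindrical r g" "\<And>w. \<bar>g w\<bar> \<le> K" "AE w in P. \<bar>f w - g w\<bar> \<le> L * \<rho> ^ r"
    using approx by blast
  note [measurable] = cylindrical_measurable[OF g(1)]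
  let ?g' = "\<lambda>w. g ((Sshift ^^ t) w)"
  let ?e = "max \<theta> \<rho> ^ r"
  have ig: "integrable P g" using g(2) by (intro integrable_const_bound[where B=K]) auto
  have igg: "integrable P (\<lambda>w. g w * ?g' w)"
    using g(2) K_pos by (intro integrable_const_bound[where B="K*K"]) (auto simp: abs_mult intro!: mult_mono)
  have "\<bar>expectation (\<lambda>w. f w * X t w - g w * ?g' w)\<bar> \<le> 2 * K * (L * \<rho> ^ r)"
  proof (rule norm_expectation_le[where 'b=real, unfolded real_norm_def])
    show "AE w in P. \<bar>f w * X t w - g w * ?g' w\<bar> \<le> 2 * K * (L * \<rho> ^ r)"
      using g(3) AE_shift[OF g(3), of t] X_bound[of t]
    proof eventually_elim
      case (elim w)
      have "f w * X t w - g w * ?g' w = (f w - g w) * X t w + g w * (X t w - ?g' w)"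
        by (simp add: algebra_simps)
      then have "\<bar>f w * X t w - g w * ?g' w\<bar> \<le> \<bar>f w - g w\<bar> * \<bar>X t w\<bar> + \<bar>g w\<bar> * \<bar>X t w - ?g' w\<bar>"
        by (simp only: abs_mult[symmetric] abs_triangle_ineq)
      also have "\<dots> \<le> (L * \<rho> ^ r) * K + K * (L * \<rho> ^ r)"
        using elim g(2) K_pos by (intro add_mono mult_mono) (auto intro: order_trans[OF abs_ge_zero])
      finally show ?case by simp
    qed
  qed measurable
  then have 1: "\<bar>cov t - expectation (\<lambda>w. g w * ?g' w)\<bar> \<le> 2 * K * L * \<rho> ^ r"
    using integrable_XX[of 0 t] igg by (simp add: cov_def)
  have "\<bar>expectation (\<lambda>w. (g w / K) * (?g' w / K)) - expectation (\<lambda>w. g w / K) * expectation (\<lambda>w. g w / K)\<bar> \<le> C * \<theta> ^ k"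
    unfolding t(1)
    using g(2) K_pos cylindrical_compose[OF g(1), of "\<lambda>x. x / K"]
    by (intro mixing_cylindrical[where m = r]) auto
  then have "\<bar>expectation (\<lambda>w. g w * ?g' w) / K\<^sup>2 - (expectation g)\<^sup>2 / K\<^sup>2\<bar> \<le> C * \<theta> ^ k"
    by (simp add: power2_eq_square)
  then have 2: "\<bar>expectation (\<lambda>w. g w * ?g' w) - (expectation g)\<^sup>2\<bar> \<le> C * K\<^sup>2 * \<theta> ^ k"
    using K_pos by (simp add: divide_le_eq mult_ac flip: diff_divide_distrib)
  have "\<bar>expectation (\<lambda>w. f w - g w)\<bar> \<le> L * \<rho> ^ r"
    using g(3) by (intro norm_expectation_le[where 'b=real, unfolded real_norm_def]) auto
  then have "\<bar>expectation g\<bar> \<le> L * \<rho> ^ r"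
    using ig integrable_X[of 0] f_mean by simp
  then have "(expectation g)\<^sup>2 \<le> (L * \<rho> ^ r)\<^sup>2"
    by (metis abs_ge_zero power2_abs power_mono)
  \<comment> \<open>One of the two factors \<open>\<rho> ^ r\<close> is given away, so that all
    three errors are linear in a geometric term.\<close>
  also have "\<dots> \<le> L\<^sup>2 * \<rho> ^ r"
    unfolding power_mult_distrib
    using rho by (intro mult_left_mono) (auto simp: power2_eq_square intro!: mult_left_le power_le_one)
  finally have 3: "(expectation g)\<^sup>2 \<le> L\<^sup>2 * \<rho> ^ r" .
  have r1: "\<rho> ^ r \<le> ?e" using rho by (intro power_mono) auto
  have "\<theta> ^ k \<le> \<theta> ^ r" using theta t by (intro power_decreasing) auto
  also have "\<dots> \<le> ?e" using theta by (intro power_mono) auto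
  finally have k1: "\<theta> ^ k \<le> ?e" .
  have "\<bar>cov t\<bar> \<le> 2 * K * L * \<rho> ^ r + C * K\<^sup>2 * \<theta> ^ k + L\<^sup>2 * \<rho> ^ r"
    using 1 2 3 zero_le_power2[of "expectation g"] by linarith
  also have "\<dots> \<le> 2 * K * L * ?e + C * K\<^sup>2 * ?e + L\<^sup>2 * ?e"
    using r1 k1 K_pos L_nonneg C_nonneg by (intro add_mono mult_left_mono) auto
  finally show ?thesis by (simp add: algebra_simps r_def)
qed

lemma summable_abs_cov: "summable (\<lambda>t. \<bar>cov t\<bar>)"
proof (rule summable_comparison_test')
  define \<eta> where "\<eta> = max \<theta> \<rho>"
  define A where "A = C * K\<^sup>2 + 2 * K * L + L\<^sup>2"
  have eta: "0 < \<eta>" "\<eta> < 1" using theta rho by (auto simp: \<eta>_def)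
  have A: "0 \<le> A" using K_pos L_nonneg C_nonneg by (simp add: A_def)
  \<comment> \<open>Majorant with ratio \<open>sqrt \<eta>\<close>; the factor
    \<open>1 / sqrt \<eta>\<close> makes up for the rounding in \<open>t div 2\<close>.\<close>
  show "summable (\<lambda>t. A / sqrt \<eta> * sqrt \<eta> ^ t)"
    using eta by (intro summable_mult summable_geometric) auto
  fix t :: nat
  have "\<eta> ^ (t div 2) = sqrt \<eta> ^ (2 * (t div 2))"
    using eta by (simp add: power_mult)
  also have "\<dots> \<le> sqrt \<eta> ^ t / sqrt \<eta>"
  proof -
    have "sqrt \<eta> ^ (2 * (t div 2)) * sqrt \<eta> = sqrt \<eta> ^ Suc (2 * (t div 2))" by simp
    also have "\<dots> \<le> sqrt \<eta> ^ t"
      using eta by (intro power_decreasing) auto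
    finally show ?thesis using eta by (simp add: pos_le_divide_eq)
  qed
  finally have "A * \<eta> ^ (t div 2) \<le> A * (sqrt \<eta> ^ t / sqrt \<eta>)"
    using A by (rule mult_left_mono)
  then show "norm \<bar>cov t\<bar> \<le> A / sqrt \<eta> * sqrt \<eta> ^ t"
    using abs_cov_le[of t] by (simp add: A_def \<eta>_def)
qed

text \<open>Twice the series, since the times compared with a fixed one lie on both sides of it and
  each side runs through distinct lags.\<close>

definition V :: real where "V = 2 * (\<Sum>t. \<bar>cov t\<bar>)"

lemma V_nonneg: "0 \<le> V"
  unfolding V_def using summable_abs_cov by (simp add: suminf_nonneg)

text \<open>Stated for any finite set of times, as it must also bound the scattered times not
  covered by blocks. In each row the lags on one side of \<open>s\<close> are pairwise distinct, so
  they form a subsum of the convergent series.\<close>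

lemma second_moment_le:
  assumes I: "finite I"
  shows "expectation (\<lambda>w. (\<Sum>t\<in>I. X t w)\<^sup>2) \<le> V * real (card I)"
proof -
  let ?c = "\<lambda>s t. expectation (\<lambda>w. X s w * X t w)"
  have part: "(\<Sum>t\<in>J. \<bar>cov (h t)\<bar>) \<le> (\<Sum>t. \<bar>cov t\<bar>)" if "finite J" "inj_on h J" for J h
  proof -
    have "(\<Sum>t\<in>J. \<bar>cov (h t)\<bar>) = (\<Sum>t\<in>h ` J. \<bar>cov t\<bar>)"
      using that by (simp add: sum.reindex)
    also have "\<dots> \<le> (\<Sum>t. \<bar>cov t\<bar>)"
      using that summable_abs_cov by (intro sum_le_suminf) auto
    finally show ?thesis .
  qed
  have row: "(\<Sum>t\<in>I. ?c s t) \<le> V" for s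
  proof -
    have "(\<Sum>t\<in>I. ?c s t) = (\<Sum>t\<in>{t\<in>I. s \<le> t}. ?c s t) + (\<Sum>t\<in>{t\<in>I. \<not> s \<le> t}. ?c s t)"
      using I by (subst sum.union_disjoint[symmetric]) (auto intro!: sum.cong)
    also have "(\<Sum>t\<in>{t\<in>I. s \<le> t}. ?c s t) = (\<Sum>t\<in>{t\<in>I. s \<le> t}. cov (t - s))"
      by (intro sum.cong) (auto simp: expectation_XX)
    also have "(\<Sum>t\<in>{t\<in>I. \<not> s \<le> t}. ?c s t) = (\<Sum>t\<in>{t\<in>I. \<not> s \<le> t}. cov (s - t))"
      by (intro sum.cong) (auto simp: mult.commute[of "X s _"] expectation_XX)
    also have "(\<Sum>t\<in>{t\<in>I. s \<le> t}. cov (t - s)) \<le> (\<Sum>t\<in>{t\<in>I. s \<le> t}. \<bar>cov (t - s)\<bar>)"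
      by (intro sum_mono) auto
    also have "\<dots> \<le> (\<Sum>t. \<bar>cov t\<bar>)" using I by (intro part) (auto simp: inj_on_def)
    also have "(\<Sum>t\<in>{t\<in>I. \<not> s \<le> t}. cov (s - t)) \<le> (\<Sum>t\<in>{t\<in>I. \<not> s \<le> t}. \<bar>cov (s - t)\<bar>)"
      by (intro sum_mono) auto
    also have "\<dots> \<le> (\<Sum>t. \<bar>cov t\<bar>)" using I by (intro part) (auto simp: inj_on_def)
    finally show ?thesis by (simp add: V_def)
  qed
  have "expectation (\<lambda>w. (\<Sum>t\<in>I. X t w)\<^sup>2) = (\<Sum>s\<in>I. \<Sum>t\<in>I. ?c s t)"
    using integrable_XX by (simp add: power2_eq_square sum_product)
  also have "\<dots> \<le> (\<Sum>s\<in>I. V)" by (intro sum_mono row)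
  finally show ?thesis by (simp add: mult.commute)
qed

definition sigma2 :: real where "sigma2 = cov 0 + 2 * (\<Sum>t. cov (Suc t))"

text \<open>Adding the time \<open>n\<close> to the sum adds the covariances with lags 0 to
  \<open>n\<close>, the positive lags twice. The second moment is thus a sum of partial sums of the
  covariance series, ready for a Cesaro argument.\<close>

lemma variance_Suc:
  "expectation (\<lambda>w. (\<Sum>t<n. X t w)\<^sup>2) = (\<Sum>j<n. cov 0 + 2 * (\<Sum>t<j. cov (Suc t)))"
proof (induction n)
  case (Suc n)
  have i: "integrable P (\<lambda>w. (\<Sum>t<n. X t w)\<^sup>2)" "integrable P (\<lambda>w. (\<Sum>t<n. X t w) * X n w)"
    unfolding power2_eq_square sum_product
    by (simp_all only: sum_distrib_right Bochner_Integration.integrable_sum integrable_XX)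
  have "expectation (\<lambda>w. (\<Sum>t<Suc n. X t w)\<^sup>2)
      = expectation (\<lambda>w. (\<Sum>t<n. X t w)\<^sup>2 + (2 * ((\<Sum>t<n. X t w) * X n w) + X n w * X n w))"
    by (simp add: power2_eq_square algebra_simps)
  also have "\<dots> = expectation (\<lambda>w. (\<Sum>t<n. X t w)\<^sup>2)
      + (2 * expectation (\<lambda>w. (\<Sum>t<n. X t w) * X n w) + expectation (\<lambda>w. X n w * X n w))"
    using i integrable_XX[of n n] by simp
  also have "expectation (\<lambda>w. X n w * X n w) = cov 0" by (simp add: expectation_XX)
  also have "expectation (\<lambda>w. (\<Sum>t<n. X t w) * X n w) = (\<Sum>t<n. cov (n - t))"
    using integrable_XX by (simp add: sum_distrib_right expectation_XX)
  also have "\<dots> = (\<Sum>t<n. cov (Suc (n - Suc t)))"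
    by (intro sum.cong) (auto simp: Suc_diff_Suc)
  also have "\<dots> = (\<Sum>t<n. cov (Suc t))"
    by (rule sum.nat_diff_reindex)
  finally show ?case by (simp add: Suc.IH)
qed simp

lemma variance_tendsto: "(\<lambda>n. expectation (\<lambda>w. (\<Sum>t<n. X t w)\<^sup>2) / real n) \<longlonglongrightarrow> sigma2"
  unfolding variance_Suc sigma2_def
proof (rule cesaro_mean_tendsto)
  have "summable (\<lambda>t. cov (Suc t))"
    using summable_abs_cov by (subst summable_Suc_iff) (rule summable_rabs_cancel)
  then show "(\<lambda>j. cov 0 + 2 * (\<Sum>t<j. cov (Suc t))) \<longlonglongrightarrow> cov 0 + 2 * (\<Sum>t. cov (Suc t))"
    by (intro tendsto_intros summable_LIMSEQ)
qed

lemma sigma2_nonneg: "0 \<le> sigma2"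
  by (rule LIMSEQ_le_const[OF variance_tendsto]) (auto intro!: exI[of _ 0] divide_nonneg_nonneg)

end

section \<open>Bernstein blocks: decoupling and Taylor expansion\<close>

lemma norm_power_diff_le:
  fixes z w :: complex
  assumes "cmod z \<le> 1" "cmod w \<le> 1" "cmod (z - w) \<le> e"
  shows "cmod (z ^ m - w ^ m) \<le> real m * e"
  using norm_power_diff[OF assms(1,2), of m] mult_left_mono[OF assms(3), of "real m"] by simp

context mixing_observable
begin

text \<open>Blocks of length \<open>p\<close> start at the multiples of \<open>p + q\<close>.
  Evaluating \<open>g\<close> at the end of a block looks up to \<open>r\<close> coordinates into
  the gap, so the gap effective for mixing is \<open>q - r\<close>, and each further block is split
  off at the price of one mixing error.\<close>

lemma block_product_bound:
  fixes \<tau> :: real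
  assumes g: "cylindrical r g" and rq: "r \<le> q"
  shows "cmod (expectation (\<lambda>w. iexp (\<tau> * (\<Sum>l<k. \<Sum>i<p. g ((Sshift ^^ (l * (p + q) + i)) w))))
       - expectation (\<lambda>w. iexp (\<tau> * (\<Sum>i<p. g ((Sshift ^^ i) w)))) ^ k)
     \<le> real k * (4 * C * \<theta> ^ (q - r))"
proof (induction k)
  case (Suc k)
  let ?B = "p + q"
  define A where "A k w = iexp (\<tau> * (\<Sum>l<k. \<Sum>i<p. g ((Sshift ^^ (l * ?B + i)) w)))" for k w
  define E where "E w = iexp (\<tau> * (\<Sum>i<p. g ((Sshift ^^ i) w)))" for w
  have cA: "cylindrical (k * ?B - (q - r)) (A k)"
    unfolding A_def
  proof (intro cylindrical_compose[where h = "\<lambda>x. iexp (\<tau> * x)"] cylindrical_sum)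
    fix l i assume li: "l \<in> {..<k}" "i \<in> {..<p}"
    then have "Suc l * ?B \<le> k * ?B" by (intro mult_le_mono1) auto
    then have "l * ?B + i + r \<le> k * ?B - (q - r)" using li rq by simp
    with cylindrical_Sshift_pow[OF g]
    show "cylindrical (k * ?B - (q - r)) (\<lambda>w. g ((Sshift ^^ (l * ?B + i)) w))"
      by (rule cylindrical_mono)
  qed
  have cE: "cylindrical (p + r) E"
    unfolding E_def
  proof (intro cylindrical_compose[where h = "\<lambda>x. iexp (\<tau> * x)"] cylindrical_sum)
    fix i assume "i \<in> {..<p}"
    then have "i + r \<le> p + r" by simp
    with cylindrical_Sshift_pow[OF g] show "cylindrical (p + r) (\<lambda>w. g ((Sshift ^^ i) w))"
      by (rule cylindrical_mono)
  qed
  have nA: "cmod (A j w) \<le> 1" and nE: "cmod (E w) \<le> 1" for j w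
    by (simp_all add: A_def E_def)
  have split: "A (Suc k) w = A k w * E ((Sshift ^^ (k * ?B)) w)" for w
    by (simp add: A_def E_def Sshift_pow_add distrib_left exp_add)
  have nonneg: "0 \<le> 4 * C * \<theta> ^ (q - r)" using C_nonneg theta by simp
  have 1: "cmod (expectation (A (Suc k)) - expectation (A k) * expectation E) \<le> 4 * C * \<theta> ^ (q - r)"
  \<comment> \<open>For \<open>k = 0\<close> the truncated subtraction in
    \<open>k * ?B - (q - r)\<close> is not undone by adding \<open>q - r\<close>, so the empty
    product is handled directly.\<close>
  proof (cases "k = 0")
    case True
    have "A 0 = (\<lambda>_. 1)" "A (Suc 0) = E" by (simp_all add: A_def E_def fun_eq_iff)
    then have "expectation (A 0) = 1" "expectation (A (Suc 0)) = expectation E"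
      using prob_space by simp_all
    then show ?thesis using nonneg True by simp
  next
    case False
    then have "k * ?B - (q - r) + (q - r) = k * ?B"
      by (cases k) auto
    then show ?thesis
      using mixing_complex[OF cA nA cE nE, of "q - r"] by (simp add: split[abs_def])
  qed
  have E1: "cmod (expectation E) \<le> 1"
    using nE cylindrical_measurable[OF cE] by (intro norm_expectation_le) auto
  have 2: "cmod (expectation (A k) * expectation E - expectation E ^ k * expectation E)
      \<le> real k * (4 * C * \<theta> ^ (q - r))"
  proof -
    have "cmod (expectation (A k) * expectation E - expectation E ^ k * expectation E)
      = cmod (expectation (A k) - expectation E ^ k) * cmod (expectation E)"
      by (simp flip: left_diff_distrib norm_mult)
    also have "\<dots> \<le> cmod (expectation (A k) - expectation E ^ k)"
      using E1 by (simp add: mult_left_le)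
    also have "\<dots> \<le> real k * (4 * C * \<theta> ^ (q - r))"
      using Suc.IH by (simp add: A_def[abs_def] E_def[abs_def])
    finally show ?thesis .
  qed
  have "cmod (expectation (A (Suc k)) - expectation E ^ Suc k)
     \<le> cmod (expectation (A (Suc k)) - expectation (A k) * expectation E)
       + cmod (expectation (A k) * expectation E - expectation E ^ k * expectation E)"
    using norm_triangle_ineq[of "expectation (A (Suc k)) - expectation (A k) * expectation E"
        "expectation (A k) * expectation E - expectation E ^ k * expectation E"]
    by (simp add: mult.commute)
  also have "\<dots> \<le> real (Suc k) * (4 * C * \<theta> ^ (q - r))"
    using 1 2 by (simp add: algebra_simps)
  finally show ?case by (simp add: A_def[abs_def] E_def[abs_def])
qed (use prob_space in simp)

text \<open>Third-order Taylor estimate for the centered block sum. Bounding one factor of the cube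
  by \<open>p K\<close> and the mean of the remaining square by \<open>V p\<close> makes the error
  quadratic in \<open>p\<close>, where the crude bound would be cubic; the second error is the step
  from \<open>1 - y\<close> to \<open>exp (- y)\<close>.\<close>

lemma block_char_bound:
  fixes \<tau> :: real
  assumes y: "y = \<tau>\<^sup>2 * expectation (\<lambda>w. (\<Sum>t<p. X t w)\<^sup>2) / 2" "y \<le> 1"
  shows "cmod (expectation (\<lambda>w. iexp (\<tau> * (\<Sum>t<p. X t w))) - exp (- y))
     \<le> \<bar>\<tau>\<bar> ^ 3 * K * V * (real p)\<^sup>2 + \<tau> ^ 4 * V\<^sup>2 * (real p)\<^sup>2"
proof -
  let ?Y = "\<lambda>w. \<Sum>t<p. X t w"
  let ?v = "expectation (\<lambda>w. (?Y w)\<^sup>2)"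
  have b: "AE w in P. \<bar>?Y w\<bar> \<le> real p * K" using sum_X_bound[of "{..<p}"] by simp
  have sq: "integrable P (\<lambda>w. (?Y w)\<^sup>2)"
    unfolding power2_eq_square sum_product
    by (intro Bochner_Integration.integrable_sum integrable_XX)
  have v: "0 \<le> ?v" "?v \<le> V * real p" using second_moment_le[of "{..<p}"] by auto
  have pK: "0 \<le> real p * K" using K_pos by simp
  have mean: "expectation ?Y = 0" using integrable_X expectation_X by simp
  have "cmod (char (distr P borel ?Y) \<tau> - (1 - \<tau>\<^sup>2 * ?v / 2))
      \<le> \<tau>\<^sup>2 / 6 * expectation (\<lambda>w. min (6 * (?Y w)\<^sup>2) (\<bar>\<tau>\<bar> * \<bar>?Y w\<bar> ^ 3))"
    using sq integrable_X mean by (intro char_approx3') auto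
  also have "expectation (\<lambda>w. min (6 * (?Y w)\<^sup>2) (\<bar>\<tau>\<bar> * \<bar>?Y w\<bar> ^ 3))
      \<le> expectation (\<lambda>w. \<bar>\<tau>\<bar> * (real p * K) * (?Y w)\<^sup>2)"
  proof (rule integral_mono_AE)
    show "integrable P (\<lambda>w. min (6 * (?Y w)\<^sup>2) (\<bar>\<tau>\<bar> * \<bar>?Y w\<bar> ^ 3))"
      by (rule Bochner_Integration.integrable_bound[OF integrable_mult_right[OF sq, of 6]]) auto
    show "integrable P (\<lambda>w. \<bar>\<tau>\<bar> * (real p * K) * (?Y w)\<^sup>2)" using sq by simp
    show "AE w in P. min (6 * (?Y w)\<^sup>2) (\<bar>\<tau>\<bar> * \<bar>?Y w\<bar> ^ 3) \<le> \<bar>\<tau>\<bar> * (real p * K) * (?Y w)\<^sup>2"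
      using b
    proof eventually_elim
      case (elim w)
      have "\<bar>\<tau>\<bar> * \<bar>?Y w\<bar> ^ 3 = \<bar>\<tau>\<bar> * \<bar>?Y w\<bar> * (?Y w)\<^sup>2"
        by (simp add: power3_eq_cube power2_eq_square)
      also have "\<dots> \<le> \<bar>\<tau>\<bar> * (real p * K) * (?Y w)\<^sup>2"
        using elim by (intro mult_right_mono mult_left_mono) auto
      finally show ?case by simp
    qed
  qed
  also have "\<dots> = \<bar>\<tau>\<bar> * (real p * K) * ?v" by simp
  also have "\<tau>\<^sup>2 / 6 * (\<bar>\<tau>\<bar> * (real p * K) * ?v) \<le> \<tau>\<^sup>2 * (\<bar>\<tau>\<bar> * (real p * K) * (V * real p))"
    using v pK by (intro mult_mono mult_left_mono) auto
  also have "\<dots> = \<bar>\<tau>\<bar> ^ 3 * K * V * (real p)\<^sup>2"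
    by (simp add: power3_eq_cube power2_eq_square)
  also have "char (distr P borel ?Y) \<tau> = expectation (\<lambda>w. iexp (\<tau> * ?Y w))"
    by (simp add: char_def integral_distr)
  finally have 1: "cmod (expectation (\<lambda>w. iexp (\<tau> * ?Y w)) - (1 - complex_of_real y)) \<le> \<bar>\<tau>\<bar> ^ 3 * K * V * (real p)\<^sup>2"
    using v by (simp add: y(1) mult_left_mono)
  have y0: "0 \<le> y" unfolding y(1) using v by simp
  have "cmod ((1 - complex_of_real y) - exp (- complex_of_real y)) = \<bar>(1 - y) - exp (- y)\<bar>"
  proof -
    have "(1 - complex_of_real y) - exp (- complex_of_real y) = complex_of_real ((1 - y) - exp (- y))"
      by (simp flip: exp_of_real)
    then show ?thesis by (simp only: norm_of_real)
  qed
  also have "\<dots> \<le> y\<^sup>2" using y0 y(2) by (rule abs_one_minus_exp_le)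
  also have "\<dots> \<le> (\<tau>\<^sup>2 * (V * real p))\<^sup>2"
  proof (rule power_mono[OF _ y0])
    show "y \<le> \<tau>\<^sup>2 * (V * real p)"
      using mult_left_mono[OF v(2), of "\<tau>\<^sup>2"] mult_nonneg_nonneg[OF _ v(1), of "\<tau>\<^sup>2"]
        zero_le_power2[of \<tau>] unfolding y(1) by linarith
  qed
  also have "\<dots> = \<tau> ^ 4 * V\<^sup>2 * (real p)\<^sup>2"
    by (simp add: power_mult_distrib)
  finally have 2: "cmod ((1 - complex_of_real y) - exp (- complex_of_real y)) \<le> \<tau> ^ 4 * V\<^sup>2 * (real p)\<^sup>2" .
  show ?thesis
    using norm_triangle_ineq[of "expectation (\<lambda>w. iexp (\<tau> * ?Y w)) - (1 - complex_of_real y)"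
        "(1 - complex_of_real y) - exp (- complex_of_real y)"] 1 2
    by (simp add: exp_of_real[symmetric])
qed

text \<open>Five replacements in turn: the times outside the blocks are dropped, \<open>f\<close>
  becomes \<open>g\<close> on the blocks, the blocks become independent, \<open>g\<close> becomes
  \<open>f\<close> again within a single block, and that block's characteristic function becomes
  \<open>exp (- y)\<close>. The second and the fourth have the same bound, hence the factor
  2.\<close>

lemma char_bound:
  fixes \<tau> :: real
  assumes kn: "k * (p + q) \<le> n" and rq: "r \<le> q"
    and y: "y = \<tau>\<^sup>2 * expectation (\<lambda>w. (\<Sum>t<p. X t w)\<^sup>2) / 2" "y \<le> 1"
  shows "cmod (expectation (\<lambda>w. iexp (\<tau> * (\<Sum>t<n. X t w))) - exp (- (real k * y)))
    \<le> \<bar>\<tau>\<bar> * sqrt (V * real (n - k * p)) + 2 * (\<bar>\<tau>\<bar> * real n * (L * \<rho> ^ r)) + real k * (4 * C * \<theta> ^ (q - r))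
      + real k * (\<bar>\<tau>\<bar> ^ 3 * K * V * (real p)\<^sup>2 + \<tau> ^ 4 * V\<^sup>2 * (real p)\<^sup>2)"
proof -
  obtain g where g: "cylindrical r g" "\<And>w. \<bar>g w\<bar> \<le> K" "AE w in P. \<bar>f w - g w\<bar> \<le> L * \<rho> ^ r"
    using approx by blast
  note [measurable] = cylindrical_measurable[OF g(1)]
  let ?B = "p + q"
  \<comment> \<open>All times inside blocks; division with remainder by \<open>p + q\<close>
    recovers the block and the offset.\<close>
  define J where "J = (\<lambda>(l, i). l * ?B + i) ` ({..<k} \<times> {..<p})"
  have inj: "inj_on (\<lambda>(l, i). l * ?B + i) ({..<k} \<times> {..<p})"
  proof (rule inj_onI)
    fix x y assume x: "x \<in> {..<k} \<times> {..<p}" and y: "y \<in> {..<k} \<times> {..<p}"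
      and "(\<lambda>(l, i). l * ?B + i) x = (\<lambda>(l, i). l * ?B + i) y"
    then have eq: "fst x * ?B + snd x = fst y * ?B + snd y" by (simp add: case_prod_unfold)
    have md: "(a * b + j) mod b = j" if "j < b" for a b j :: nat using that by simp
    have lt: "snd x < ?B" "snd y < ?B" using x y by auto
    have "snd x = snd y" using md[OF lt(1), of "fst x"] md[OF lt(2), of "fst y"] eq by argo
    moreover from this have "fst x * ?B = fst y * ?B" using eq by linarith
    then have "fst x = fst y" using lt by (simp only: mult_cancel2) linarith
    ultimately show "x = y" by (simp add: prod_eq_iff)
  qed
  have J: "finite J" "card J = k * p"
    using inj by (auto simp: J_def card_image)
  have Jn: "J \<subseteq> {..<n}"
  proof (clarsimp simp: J_def)
    fix l i assume "l < k" "i < p"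
    then have "Suc l * ?B \<le> k * ?B" by (intro mult_le_mono1) auto
    then show "l * ?B + i < n" using kn \<open>i < p\<close> by simp
  qed
  have sumJ: "(\<Sum>l<k. \<Sum>i<p. h (l * ?B + i)) = (\<Sum>t\<in>J. h t)" for h :: "nat \<Rightarrow> real"
    using inj by (simp add: J_def sum.reindex sum.cartesian_product case_prod_unfold)
  have kp: "k * p \<le> n" using kn by (simp add: algebra_simps)
  have kpr: "real k * real p \<le> real n" using of_nat_mono[OF kp, where 'a = real] by simp
  have Lr: "0 \<le> L * \<rho> ^ r" using L_nonneg rho by simp
  let ?g = "\<lambda>t w. g ((Sshift ^^ t) w)"
  define \<psi> where "\<psi> = expectation (\<lambda>w. iexp (\<tau> * (\<Sum>t<p. X t w)))"
  define \<psi>g where "\<psi>g = expectation (\<lambda>w. iexp (\<tau> * (\<Sum>t<p. ?g t w)))"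

  have approx_sum: "cmod (expectation (\<lambda>w. iexp (\<tau> * (\<Sum>t\<in>I. X t w))) - expectation (\<lambda>w. iexp (\<tau> * (\<Sum>t\<in>I. ?g t w))))
       \<le> \<bar>\<tau>\<bar> * (real (card I) * (L * \<rho> ^ r))" if I: "finite I" for I
  proof -
    have ae: "AE w in P. \<bar>\<tau> * (\<Sum>t\<in>I. X t w) - \<tau> * (\<Sum>t\<in>I. ?g t w)\<bar> \<le> \<bar>\<tau>\<bar> * (real (card I) * (L * \<rho> ^ r))"
    proof -
      have "AE w in P. \<forall>t\<in>I. \<bar>X t w - ?g t w\<bar> \<le> L * \<rho> ^ r"
        using I AE_shift[OF g(3)] by (simp add: AE_ball_countable countable_finite)
      then show ?thesis
      proof eventually_elim
        case (elim w)
        have "\<bar>\<Sum>t\<in>I. X t w - ?g t w\<bar> \<le> (\<Sum>t\<in>I. \<bar>X t w - ?g t w\<bar>)" by (rule sum_abs)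
        also have "\<dots> \<le> (\<Sum>t\<in>I. L * \<rho> ^ r)" using elim by (intro sum_mono) auto
        finally have "\<bar>\<tau>\<bar> * \<bar>\<Sum>t\<in>I. X t w - ?g t w\<bar> \<le> \<bar>\<tau>\<bar> * (real (card I) * (L * \<rho> ^ r))"
          by (intro mult_left_mono) auto
        then show ?case by (simp add: sum_subtractf abs_mult right_diff_distrib[symmetric])
      qed
    qed
    have m: "(\<lambda>w. \<tau> * (\<Sum>t\<in>I. X t w)) \<in> borel_measurable P" "(\<lambda>w. \<tau> * (\<Sum>t\<in>I. ?g t w)) \<in> borel_measurable P"
      by measurable
    have int: "integrable P (\<lambda>w. \<bar>\<tau> * (\<Sum>t\<in>I. X t w) - \<tau> * (\<Sum>t\<in>I. ?g t w)\<bar>)"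
      by (rule integrable_const_bound[where B="\<bar>\<tau>\<bar> * (real (card I) * (L * \<rho> ^ r))"]) (use ae m in auto)
    have "cmod (expectation (\<lambda>w. iexp (\<tau> * (\<Sum>t\<in>I. X t w))) - expectation (\<lambda>w. iexp (\<tau> * (\<Sum>t\<in>I. ?g t w))))
       \<le> expectation (\<lambda>w. \<bar>\<tau> * (\<Sum>t\<in>I. X t w) - \<tau> * (\<Sum>t\<in>I. ?g t w)\<bar>)"
      using cmod_expectation_exp_diff_le[OF m int] .
    also have "\<dots> \<le> \<bar>\<tau>\<bar> * (real (card I) * (L * \<rho> ^ r))"
      using int ae by (rule integral_le_const)
    finally show ?thesis .
  qed

  \<comment> \<open>The discarded part is estimated in L2, through linear growth of the second
    moment; a uniform bound would be of the order of the number of discarded times rather than its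
    root.\<close>
  have h1: "cmod (expectation (\<lambda>w. iexp (\<tau> * (\<Sum>t<n. X t w))) - expectation (\<lambda>w. iexp (\<tau> * (\<Sum>t\<in>J. X t w))))
      \<le> \<bar>\<tau>\<bar> * sqrt (V * real (n - k * p))"
  proof -
    let ?I = "{..<n} - J"
    let ?Y = "\<lambda>w. \<Sum>t\<in>?I. X t w"
    have b: "AE w in P. \<bar>?Y w\<bar> \<le> real (card ?I) * K" by (rule sum_X_bound) simp
    have eq: "\<bar>\<tau> * (\<Sum>t<n. X t w) - \<tau> * (\<Sum>t\<in>J. X t w)\<bar> = \<bar>\<tau>\<bar> * \<bar>?Y w\<bar>" for w
      using Jn by (simp add: sum_diff abs_mult flip: right_diff_distrib)
    have m: "(\<lambda>w. \<tau> * (\<Sum>t<n. X t w)) \<in> borel_measurable P" "(\<lambda>w. \<tau> * (\<Sum>t\<in>J. X t w)) \<in> borel_measurable P"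
      by measurable
    have int: "integrable P (\<lambda>w. \<bar>\<tau> * (\<Sum>t<n. X t w) - \<tau> * (\<Sum>t\<in>J. X t w)\<bar>)"
      unfolding eq by (intro integrable_mult_right integrable_abs Bochner_Integration.integrable_sum integrable_X)
    have "cmod (expectation (\<lambda>w. iexp (\<tau> * (\<Sum>t<n. X t w))) - expectation (\<lambda>w. iexp (\<tau> * (\<Sum>t\<in>J. X t w))))
       \<le> \<bar>\<tau>\<bar> * expectation (\<lambda>w. \<bar>?Y w\<bar>)"
      using cmod_expectation_exp_diff_le[OF m int] by (simp add: eq)
    also have "\<dots> \<le> \<bar>\<tau>\<bar> * sqrt (expectation (\<lambda>w. (?Y w)\<^sup>2))"
      using b by (intro mult_left_mono expectation_abs_le_sqrt) auto
    also have "\<dots> \<le> \<bar>\<tau>\<bar> * sqrt (V * real (card ?I))"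
      by (intro mult_left_mono real_sqrt_le_mono second_moment_le) auto
    also have "card ?I = n - k * p" using Jn J by (simp add: card_Diff_subset)
    finally show ?thesis .
  qed
  have "\<bar>\<tau>\<bar> * (real (card J) * (L * \<rho> ^ r)) \<le> \<bar>\<tau>\<bar> * (real n * (L * \<rho> ^ r))"
    using Lr kpr J by (intro mult_left_mono mult_right_mono) auto
  with approx_sum[OF J(1)]
  have h2: "cmod (expectation (\<lambda>w. iexp (\<tau> * (\<Sum>t\<in>J. X t w))) - expectation (\<lambda>w. iexp (\<tau> * (\<Sum>t\<in>J. ?g t w))))
       \<le> \<bar>\<tau>\<bar> * real n * (L * \<rho> ^ r)" by simp
  have h3: "cmod (expectation (\<lambda>w. iexp (\<tau> * (\<Sum>t\<in>J. ?g t w))) - \<psi>g ^ k) \<le> real k * (4 * C * \<theta> ^ (q - r))"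
    using block_product_bound[OF g(1) rq, where \<tau> = \<tau> and k = k and p = p]
    by (simp only: sumJ[of "\<lambda>t. ?g t _"] \<psi>g_def)
  have y0: "0 \<le> y" unfolding y(1) by simp
  have le1: "cmod \<psi> \<le> 1" "cmod \<psi>g \<le> 1" "cmod (exp (- y)) \<le> 1"
    using y0 unfolding \<psi>_def \<psi>g_def by (auto intro!: norm_expectation_le)
  have "cmod (\<psi>g - \<psi>) \<le> \<bar>\<tau>\<bar> * (real p * (L * \<rho> ^ r))"
    using approx_sum[of "{..<p}"] by (simp add: \<psi>_def \<psi>g_def norm_minus_commute)
  from norm_power_diff_le[OF le1(2,1) this, of k]
  have "cmod (\<psi>g ^ k - \<psi> ^ k) \<le> \<bar>\<tau>\<bar> * (real (k * p) * (L * \<rho> ^ r))" by (simp add: mult_ac)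
  also have "\<dots> \<le> \<bar>\<tau>\<bar> * (real n * (L * \<rho> ^ r))"
    using Lr kpr by (intro mult_left_mono mult_right_mono) auto
  finally have h4: "cmod (\<psi>g ^ k - \<psi> ^ k) \<le> \<bar>\<tau>\<bar> * real n * (L * \<rho> ^ r)" by simp
  have h5: "cmod (\<psi> ^ k - exp (- (real k * y)))
      \<le> real k * (\<bar>\<tau>\<bar> ^ 3 * K * V * (real p)\<^sup>2 + \<tau> ^ 4 * V\<^sup>2 * (real p)\<^sup>2)"
    using norm_power_diff_le[OF le1(1,3) block_char_bound[OF y, folded \<psi>_def], of k]
    by (simp add: exp_of_nat_mult[symmetric] flip: of_real_power)
  have tri: "cmod (a - e) \<le> cmod (a - b) + cmod (b - c) + cmod (c - d) + cmod (d - d') + cmod (d' - e)"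
    for a b c d d' e
    using norm_triangle_ineq[of "a - b" "b - e"] norm_triangle_ineq[of "b - c" "c - e"]
      norm_triangle_ineq[of "c - d" "d - e"] norm_triangle_ineq[of "d - d'" "d' - e"] by simp
  show ?thesis
    using tri[of "expectation (\<lambda>w. iexp (\<tau> * (\<Sum>t<n. X t w)))" "exp (- (real k * y))"
        "expectation (\<lambda>w. iexp (\<tau> * (\<Sum>t\<in>J. X t w)))" "expectation (\<lambda>w. iexp (\<tau> * (\<Sum>t\<in>J. ?g t w)))"
        "\<psi>g ^ k" "\<psi> ^ k"] h1 h2 h3 h4 h5 by linarith
qed

end

text \<open>With \<open>a = n powr (1/8)\<close>: blocks of length \<open>a\<^sup>2\<close> are short against \<open>sqrt n\<close>, so Taylor
  expansion is effective; gaps of length \<open>2 a\<close> are negligible against blocks; and \<open>a\<close> grows fast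
  enough for \<open>n\<close> errors of size \<open>\<theta> ^ a\<close> to vanish. Half of each gap absorbs the \<open>a\<close>
  coordinates by which the cylinder approximation overhangs a block.\<close>

definition block_scale :: "nat \<Rightarrow> nat" where "block_scale n = nat \<lfloor>real n powr (1/8)\<rfloor>"

lemma scale_bounds: "real n powr (1/8) - 1 \<le> real (block_scale n)" "real (block_scale n) \<le> real n powr (1/8)"
  unfolding block_scale_def by (simp_all add: of_nat_nat)

lemma filterlim_scale: "filterlim block_scale at_top sequentially"
proof -
  have "filterlim (\<lambda>n. real n powr (1/8) - 1) at_top sequentially" by real_asymp
  then have "filterlim (\<lambda>n. real (block_scale n)) at_top sequentially"
    by (rule filterlim_at_top_mono) (simp add: scale_bounds)
  then show ?thesis by (simp add: filterlim_sequentially_iff_filterlim_real)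
qed

text \<open>Replaces the rounded exponent by an explicit function of \<open>n\<close>, from which
  limits can be read off; as \<open>ln x\<close> is negative, the lower bound for
  \<open>block_scale\<close> is the relevant one.\<close>

lemma power_scale_le:
  assumes "0 < x" "x < 1"
  shows "x ^ block_scale n \<le> exp (ln x * (real n powr (1/8) - 1))"
proof -
  have "x ^ block_scale n = exp (ln x * real (block_scale n))"
    using assms by (simp add: powr_realpow[symmetric] powr_def mult.commute)
  also have "\<dots> \<le> exp (ln x * (real n powr (1/8) - 1))"
    using assms scale_bounds(1)[of n] by (simp add: mult_left_mono_neg)
  finally show ?thesis .
qed

definition blocks :: "nat \<Rightarrow> nat" where "blocks n = n div ((block_scale n)\<^sup>2 + 2 * block_scale n)"

lemma blocks_le: "blocks n * ((block_scale n)\<^sup>2 + 2 * block_scale n) \<le> n"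
  by (simp add: blocks_def)

lemma blocks_scale_le: "real (blocks n) * (real (block_scale n))\<^sup>2 \<le> real n"
proof -
  have "blocks n * (block_scale n)\<^sup>2 \<le> blocks n * ((block_scale n)\<^sup>2 + 2 * block_scale n)" by simp
  also have "\<dots> \<le> n" by (rule blocks_le)
  finally have "real (blocks n * (block_scale n)\<^sup>2) \<le> real n" by (rule of_nat_mono)
  then show ?thesis by simp
qed

text \<open>With a the value of \<open>block_scale n\<close>, the uncovered times are an incomplete
  last period of length at most a^2 + 2a and one gap of length 2a per block; the gaps make up a
  share of at most 2 / (a + 2).\<close>

lemma uncovered_tendsto: "(\<lambda>n. real (n - blocks n * (block_scale n)\<^sup>2) / real n) \<longlonglongrightarrow> 0"
proof (rule Lim_null_comparison)
  let ?x = "\<lambda>n::nat. real n powr (1/8)"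
  show "(\<lambda>n. ((?x n)\<^sup>2 + 2 * ?x n) / real n + 2 / (?x n + 1)) \<longlonglongrightarrow> 0"
    by real_asymp
  show "\<forall>\<^sub>F n in sequentially. norm (real (n - blocks n * (block_scale n)\<^sup>2) / real n) \<le>
      ((?x n)\<^sup>2 + 2 * ?x n) / real n + 2 / (?x n + 1)"
    using eventually_gt_at_top[of 0] filterlim_scale[unfolded filterlim_at_top, rule_format, of 1]
  proof eventually_elim
    case (elim n)
    define a where "a = block_scale n"
    define k where "k = blocks n"
    define m where "m = a\<^sup>2 + 2 * a"
    have a: "1 \<le> a" using elim by (simp add: a_def)
    have n: "0 < n" using elim by simp
    have k: "k = n div m" by (simp add: k_def blocks_def m_def a_def)
    have km: "k * m \<le> n" by (simp add: k)
    have "n = k * m + n mod m" by (simp add: k)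
    moreover have "n mod m \<le> m" using a by (intro less_imp_le mod_less_divisor) (simp add: m_def)
    ultimately have "n \<le> k * m + m" by linarith
    then have "n - k * a\<^sup>2 \<le> m + k * (2 * a)" by (simp add: m_def algebra_simps)
    then have "real (n - k * a\<^sup>2) \<le> real (m + k * (2 * a))" by (rule of_nat_mono)
    then have 1: "real (n - k * a\<^sup>2) \<le> real m + real k * (2 * real a)" by simp
    have rm: "real m = real a * (real a + 2)" by (simp add: m_def power2_eq_square algebra_simps)
    have "real k * real m \<le> real n" using of_nat_mono[OF km, where 'a=real] by simp
    then have "real k * real a * (real a + 2) \<le> real n" by (simp add: rm algebra_simps)
    then have "real k * real a \<le> real n / (real a + 2)" by (simp add: pos_le_divide_eq)
    then have 2: "real k * (2 * real a) / real n \<le> 2 / (real a + 2)"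
      using n by (simp add: field_simps)
    have ax: "?x n + 1 \<le> real a + 2" "real a \<le> ?x n" using scale_bounds[of n] by (auto simp: a_def)
    have "real (n - k * a\<^sup>2) / real n \<le> real m / real n + real k * (2 * real a) / real n"
      using divide_right_mono[OF 1, of "real n"] by (simp add: add_divide_distrib)
    also have "\<dots> \<le> real m / real n + 2 / (real a + 2)" using 2 by simp
    also have "\<dots> \<le> ((?x n)\<^sup>2 + 2 * ?x n) / real n + 2 / (?x n + 1)"
    proof (rule add_mono)
      have "(real a)\<^sup>2 \<le> (?x n)\<^sup>2" using ax by (intro power_mono) auto
      then have "real m \<le> (?x n)\<^sup>2 + 2 * ?x n"
        unfolding m_def of_nat_add of_nat_mult of_nat_power using ax(2) by linarith
      then show "real m / real n \<le> ((?x n)\<^sup>2 + 2 * ?x n) / real n"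
        by (rule divide_right_mono) simp
      have "0 < (real a + 2) * (?x n + 1)" by (intro mult_pos_pos add_nonneg_pos) auto
      then show "2 / (real a + 2) \<le> 2 / (?x n + 1)"
        using ax(1) by (intro divide_left_mono) auto
    qed
    finally show ?case by (simp add: a_def k_def)
  qed
qed

section \<open>Convergence of the characteristic functions\<close>

context mixing_observable
begin

lemma char_tendsto:
  fixes t :: real
  shows "(\<lambda>n. expectation (\<lambda>w. iexp (t * ((\<Sum>i<n. X i w) / sqrt (real n)))))
      \<longlonglongrightarrow> complex_of_real (exp (- (t\<^sup>2 * sigma2 / 2)))"
proof -
  let ?x = "\<lambda>n::nat. real n powr (1/8)"
  let ?a = block_scale
  let ?p = "\<lambda>n. (block_scale n)\<^sup>2"
  let ?v = "\<lambda>p. expectation (\<lambda>w. (\<Sum>i<p. X i w)\<^sup>2)"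
  let ?\<tau> = "\<lambda>n::nat. t / sqrt (real n)"
  \<comment> \<open>From here on \<open>char_bound\<close> is aimed at with p = a^2, q = 2a, r = a,
    where a is \<open>block_scale n\<close>, and with \<open>\<tau>\<close> equal to
    \<open>t / sqrt n\<close>; \<open>e1\<close> to \<open>e4\<close> are its four error
    terms.\<close>
  define y where "y n = (?\<tau> n)\<^sup>2 * ?v (?p n) / 2" for n
  define e1 where "e1 n = \<bar>?\<tau> n\<bar> * sqrt (V * real (n - blocks n * ?p n))" for n
  define e2 where "e2 n = 2 * (\<bar>?\<tau> n\<bar> * real n * (L * \<rho> ^ ?a n))" for n
  define e3 where "e3 n = real (blocks n) * (4 * C * \<theta> ^ (2 * ?a n - ?a n))" for n
  define e4 where "e4 n = real (blocks n) *
      (\<bar>?\<tau> n\<bar> ^ 3 * K * V * (real (?p n))\<^sup>2 + (?\<tau> n) ^ 4 * V\<^sup>2 * (real (?p n))\<^sup>2)" for n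
  have p_x: "real (?p n) \<le> (?x n)\<^sup>2" for n
    using scale_bounds(2)[of n] by (simp add: power_mono)
  have k_p: "real (blocks n) * real (?p n) \<le> real n" for n
    using blocks_scale_le[of n] by simp

  have y_lim: "y \<longlonglongrightarrow> 0"
  proof (rule Lim_null_comparison)
    show "(\<lambda>n. t\<^sup>2 * V * ((?x n)\<^sup>2 / real n)) \<longlonglongrightarrow> 0"
      by (rule tendsto_mult_right_zero) real_asymp
    show "\<forall>\<^sub>F n in sequentially. norm (y n) \<le> t\<^sup>2 * V * ((?x n)\<^sup>2 / real n)"
    proof (rule always_eventually, rule allI)
      fix n
      have v: "0 \<le> ?v (?p n)" "?v (?p n) \<le> V * real (?p n)"
        using second_moment_le[of "{..<?p n}"] by auto
      have "norm (y n) = t\<^sup>2 / real n * ?v (?p n) / 2"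
        using v by (simp add: y_def power_divide abs_mult)
      also have "\<dots> \<le> t\<^sup>2 / real n * ?v (?p n)"
      proof -
        have "u / 2 \<le> u" if "0 \<le> u" for u :: real using that by simp
        then show ?thesis using v(1) by (meson mult_nonneg_nonneg divide_nonneg_nonneg zero_le_power2 of_nat_0_le_iff)
      qed
      also have "\<dots> \<le> t\<^sup>2 / real n * (V * (?x n)\<^sup>2)"
        using v p_x[of n] V_nonneg by (intro mult_left_mono order_trans[OF v(2)]) auto
      finally show "norm (y n) \<le> t\<^sup>2 * V * ((?x n)\<^sup>2 / real n)" by simp
    qed
  qed

  have pos: "\<forall>\<^sub>F n in sequentially. 0 < n \<and> 0 < ?p n"
    using eventually_gt_at_top[of 0] filterlim_scale[unfolded filterlim_at_top, rule_format, of 1]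
    by eventually_elim auto
  \<comment> \<open>The blocks cover a fraction of the times tending to 1, and the normalized second
    moment of one block tends to \<open>sigma2\<close> because the block length tends to
    infinity.\<close>
  have ky_lim: "(\<lambda>n. real (blocks n) * y n) \<longlonglongrightarrow> t\<^sup>2 * sigma2 / 2"
  proof -
    have "filterlim (\<lambda>n. ?p n) at_top sequentially"
      by (rule filterlim_at_top_mono[OF filterlim_scale]) (simp add: power2_eq_square)
    from filterlim_compose[OF variance_tendsto this]
    have 1: "(\<lambda>n. ?v (?p n) / real (?p n)) \<longlonglongrightarrow> sigma2" .
    have "(\<lambda>n. (1 - real (n - blocks n * ?p n) / real n) * (?v (?p n) / real (?p n)) * (t\<^sup>2 / 2))
        \<longlonglongrightarrow> (1 - 0) * sigma2 * (t\<^sup>2 / 2)"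
      by (intro tendsto_intros uncovered_tendsto 1)
    moreover have "\<forall>\<^sub>F n in sequentially.
        (1 - real (n - blocks n * ?p n) / real n) * (?v (?p n) / real (?p n)) * (t\<^sup>2 / 2) = real (blocks n) * y n"
      using pos
    proof eventually_elim
      case (elim n)
      have "blocks n * ?p n \<le> n" using k_p[of n] by (simp flip: of_nat_mult of_nat_power)
      then have "1 - real (n - blocks n * ?p n) / real n = real (blocks n) * real (?p n) / real n"
        using elim by (simp add: of_nat_diff diff_divide_distrib)
      then have "(1 - real (n - blocks n * ?p n) / real n) * (?v (?p n) / real (?p n)) * (t\<^sup>2 / 2)
          = real (blocks n) * real (?p n) / real n * (?v (?p n) / real (?p n)) * (t\<^sup>2 / 2)" by (simp only:)
      also have "\<dots> = real (blocks n) * (t\<^sup>2 / real n * ?v (?p n) / 2)"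
        using elim by (simp add: field_simps)
      finally show ?case by (simp add: y_def power_divide)
    qed
    ultimately show ?thesis by (simp add: tendsto_cong mult.commute)
  qed

  have e1: "e1 \<longlonglongrightarrow> 0"
  proof -
    have "(\<lambda>n. \<bar>t\<bar> * sqrt (V * (real (n - blocks n * ?p n) / real n))) \<longlonglongrightarrow> \<bar>t\<bar> * sqrt (V * 0)"
      by (intro tendsto_intros uncovered_tendsto)
    moreover have "e1 = (\<lambda>n. \<bar>t\<bar> * sqrt (V * (real (n - blocks n * ?p n) / real n)))"
      by (simp add: fun_eq_iff e1_def real_sqrt_mult real_sqrt_divide)
    ultimately show ?thesis by (simp only: mult_zero_right real_sqrt_zero)
  qed
  have e2: "e2 \<longlonglongrightarrow> 0"
  proof (rule Lim_null_comparison)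
    have "ln \<rho> < 0" using rho by simp
    then have "(\<lambda>n. real n * exp (ln \<rho> * (?x n - 1))) \<longlonglongrightarrow> 0" by real_asymp
    then show "(\<lambda>n. 2 * \<bar>t\<bar> * L * (real n * exp (ln \<rho> * (?x n - 1)))) \<longlonglongrightarrow> 0"
      by (rule tendsto_mult_right_zero)
    show "\<forall>\<^sub>F n in sequentially. norm (e2 n) \<le> 2 * \<bar>t\<bar> * L * (real n * exp (ln \<rho> * (?x n - 1)))"
      using eventually_gt_at_top[of 0]
    proof eventually_elim
      case (elim n)
      have "\<bar>?\<tau> n\<bar> \<le> \<bar>t\<bar>" using elim by (simp add: abs_divide divide_le_eq mult_le_cancel_left1)
      then have "\<bar>?\<tau> n\<bar> * real n * (L * \<rho> ^ ?a n) \<le> \<bar>t\<bar> * real n * (L * exp (ln \<rho> * (?x n - 1)))"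
        using power_scale_le[OF rho, of n] L_nonneg rho by (intro mult_mono) auto
      moreover have "norm (e2 n) = 2 * (\<bar>?\<tau> n\<bar> * real n * (L * \<rho> ^ ?a n))"
        using L_nonneg rho by (simp add: e2_def abs_mult)
      ultimately have "norm (e2 n) \<le> 2 * (\<bar>t\<bar> * real n * (L * exp (ln \<rho> * (?x n - 1))))"
        by linarith
      then show ?case by (simp only: mult_ac)
    qed
  qed
  have e3: "e3 \<longlonglongrightarrow> 0"
  proof (rule Lim_null_comparison)
    have "ln \<theta> < 0" using theta by simp
    then have "(\<lambda>n. real n * exp (ln \<theta> * (?x n - 1))) \<longlonglongrightarrow> 0" by real_asymp
    then show "(\<lambda>n. 4 * C * (real n * exp (ln \<theta> * (?x n - 1)))) \<longlonglongrightarrow> 0"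
      by (rule tendsto_mult_right_zero)
    show "\<forall>\<^sub>F n in sequentially. norm (e3 n) \<le> 4 * C * (real n * exp (ln \<theta> * (?x n - 1)))"
    proof (rule always_eventually, rule allI)
      fix n
      have "blocks n \<le> n" by (simp add: blocks_def)
      then have "real (blocks n) * (4 * C * \<theta> ^ ?a n) \<le> real n * (4 * C * exp (ln \<theta> * (?x n - 1)))"
        using power_scale_le[OF theta, of n] C_nonneg theta by (intro mult_mono) auto
      moreover have "norm (e3 n) = real (blocks n) * (4 * C * \<theta> ^ ?a n)"
        using C_nonneg theta by (simp add: e3_def abs_mult)
      ultimately show "norm (e3 n) \<le> 4 * C * (real n * exp (ln \<theta> * (?x n - 1)))"
        by (simp only: mult_ac)
    qed
  qed
  \<comment> \<open>Number of blocks times block length is at most \<open>n\<close>, so only one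
    further factor of the block length stands against the powers of \<open>\<tau>\<close>; the
    leading term is of order \<open>n powr (1/4) / sqrt n\<close>.\<close>
  have e4: "e4 \<longlonglongrightarrow> 0"
  proof (rule Lim_null_comparison)
    show "(\<lambda>n. \<bar>t\<bar> ^ 3 * K * V * ((?x n)\<^sup>2 / sqrt (real n)) + t ^ 4 * V\<^sup>2 * ((?x n)\<^sup>2 / real n)) \<longlonglongrightarrow> 0"
      by (intro tendsto_add_zero tendsto_mult_right_zero; real_asymp)
    show "\<forall>\<^sub>F n in sequentially. norm (e4 n) \<le>
       \<bar>t\<bar> ^ 3 * K * V * ((?x n)\<^sup>2 / sqrt (real n)) + t ^ 4 * V\<^sup>2 * ((?x n)\<^sup>2 / real n)"
      using eventually_gt_at_top[of 0]
    proof eventually_elim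
      case (elim n)
      define s where "s = sqrt (real n)"
      have s: "0 < s" "real n = s * s" using elim by (simp_all add: s_def)
      define D where "D = \<bar>?\<tau> n\<bar> ^ 3 * K * V + (?\<tau> n) ^ 4 * V\<^sup>2"
      have D: "0 \<le> D" using K_pos V_nonneg by (simp add: D_def)
      have "e4 n = (real (blocks n) * real (?p n)) * real (?p n) * D"
        by (simp add: e4_def D_def power2_eq_square algebra_simps)
      also have "\<dots> \<le> real n * (?x n)\<^sup>2 * D"
        using k_p p_x D by (intro mult_right_mono mult_mono) auto
      also have "\<dots> = (s * s) * (?x n)\<^sup>2 * D"
        using arg_cong[OF s(2), of "\<lambda>z. z * (?x n)\<^sup>2 * D"] .
      also have "D = \<bar>t / s\<bar> ^ 3 * K * V + (t / s) ^ 4 * V\<^sup>2" by (simp add: D_def s_def)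
      also have "(s * s) * (?x n)\<^sup>2 * (\<bar>t / s\<bar> ^ 3 * K * V + (t / s) ^ 4 * V\<^sup>2)
          = \<bar>t\<bar> ^ 3 * K * V * ((?x n)\<^sup>2 / s) + t ^ 4 * V\<^sup>2 * ((?x n)\<^sup>2 / (s * s))"
      proof -
        have "(s * s) * x * (\<bar>t / s\<bar> ^ 3 * K * V + (t / s) ^ 4 * V\<^sup>2)
          = \<bar>t\<bar> ^ 3 * K * V * (x / s) + t ^ 4 * V\<^sup>2 * (x / (s * s))" for x :: real
          using s(1) by (simp add: power_divide abs_divide power3_eq_cube power4_eq_xxxx distrib_left mult_ac)
        then show ?thesis .
      qed
      finally have "e4 n \<le> \<bar>t\<bar> ^ 3 * K * V * ((?x n)\<^sup>2 / s) + t ^ 4 * V\<^sup>2 * ((?x n)\<^sup>2 / (s * s))" .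
      moreover have "0 \<le> e4 n" using K_pos V_nonneg by (simp add: e4_def)
      moreover have "s * s = real n" by (rule s(2)[symmetric])
      ultimately show ?case by (simp only: s_def real_norm_def abs_of_nonneg)
    qed
  qed

  have main: "(\<lambda>n. expectation (\<lambda>w. iexp (t * ((\<Sum>i<n. X i w) / sqrt (real n))))
      - exp (- complex_of_real (real (blocks n) * y n))) \<longlonglongrightarrow> 0"
  proof (rule Lim_null_comparison)
    show "(\<lambda>n. e1 n + e2 n + e3 n + e4 n) \<longlonglongrightarrow> 0"
      using tendsto_add[OF tendsto_add[OF tendsto_add[OF e1 e2] e3] e4] by simp
    show "\<forall>\<^sub>F n in sequentially. norm (expectation (\<lambda>w. iexp (t * ((\<Sum>i<n. X i w) / sqrt (real n))))
        - exp (- complex_of_real (real (blocks n) * y n))) \<le> e1 n + e2 n + e3 n + e4 n"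
      using order_tendstoD(2)[OF y_lim zero_less_one]
    proof eventually_elim
      case (elim n)
      show ?case
        using char_bound[OF blocks_le[of n] _ y_def, of "block_scale n"] elim
        by (simp add: e1_def e2_def e3_def e4_def flip: exp_of_real)
    qed
  qed
  have "(\<lambda>n. exp (- complex_of_real (real (blocks n) * y n))) \<longlonglongrightarrow> exp (- complex_of_real (t\<^sup>2 * sigma2 / 2))"
    by (intro tendsto_intros ky_lim)
  from tendsto_add[OF main this] show ?thesis by (simp flip: exp_of_real)
qed

end

section \<open>The Gaussian limit by Levy continuity\<close>

lemma char_normal:
  assumes "0 < \<sigma>"
  shows "char (density lborel (normal_density 0 \<sigma>)) t = complex_of_real (exp (- (t\<^sup>2 * \<sigma>\<^sup>2 / 2)))"
proof -
  interpret N: prob_space std_normal_distribution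
    by (rule prob_space_normal_density) simp
  have "distributed std_normal_distribution lborel (\<lambda>x. x) std_normal_density"
    by (simp add: distributed_def distr_id2)
  from N.normal_density_affine[OF this, of \<sigma> 0] assms
  have d: "distributed std_normal_distribution lborel (\<lambda>x. \<sigma> * x) (normal_density 0 \<sigma>)" by simp
  have "density lborel (normal_density 0 \<sigma>) = distr std_normal_distribution lborel (\<lambda>x. \<sigma> * x)"
    using d by (simp add: distributed_def)
  then have "char (density lborel (normal_density 0 \<sigma>)) t = char std_normal_distribution (t * \<sigma>)"
    by (simp add: char_def integral_distr mult.assoc)
  also have "\<dots> = complex_of_real (exp (- (t\<^sup>2 * \<sigma>\<^sup>2 / 2)))"
    by (simp add: char_std_normal_distribution power_mult_distrib)
  finally show ?thesis .
qed

theorem (in mixing_observable) central_limit: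
  assumes "0 < sigma2"
  shows "weak_conv_m (\<lambda>n. distr P borel (\<lambda>w. (\<Sum>i<n. X i w) / sqrt (real n)))
           (density lborel (normal_density 0 (sqrt sigma2)))"
proof (rule levy_continuity)
  show "real_distribution (distr P borel (\<lambda>w. (\<Sum>i<n. X i w) / sqrt (real n)))" for n
    by simp
  interpret N: prob_space "density lborel (normal_density 0 (sqrt sigma2))"
    using assms by (intro prob_space_normal_density) simp
  show "real_distribution (density lborel (normal_density 0 (sqrt sigma2)))"
    by unfold_locales auto
  show "(\<lambda>n. char (distr P borel (\<lambda>w. (\<Sum>i<n. X i w) / sqrt (real n))) t)
      \<longlonglongrightarrow> char (density lborel (normal_density 0 (sqrt sigma2))) t" for t
    using char_tendsto[of t] assms
    unfolding char_normal[OF real_sqrt_gt_zero[OF assms]] by (simp add: char_def integral_distr)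
qed

section \<open>The transition operator and absolutely convergent spin expansions\<close>

lemma abs_spin [simp]: "\<bar>spin b\<bar> = 1"
  by (simp add: spin_def)

lemma abs_Phi [simp]: "\<bar>Phi G \<eta>\<bar> = 1"
  by (simp add: Phi_def abs_prod)

lemma zerov_sites [simp]: "zerov d \<in> sites d"
  by (simp add: zerov_def sites_def)

lemma vadd_sites: "u \<in> sites d \<Longrightarrow> x \<in> sites d \<Longrightarrow> vadd u x \<in> sites d"
  by (simp add: sites_def vadd_def)

lemma vadd_zerov: "u \<in> sites d \<Longrightarrow> vadd u (zerov d) = u"
  by (auto simp: sites_def vadd_def zerov_def list_eq_iff_nth_eq)

lemma vneg_sites: "u \<in> sites d \<Longrightarrow> vneg u \<in> sites d"
  by (simp add: sites_def vneg_def)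

lemma vneg_vneg [simp]: "vneg (vneg u) = u"
  by (simp add: vneg_def o_def)

lemma measurable_shift [measurable]:
  assumes "u \<in> sites d" shows "shift d u \<in> measurable (OmegaM d) (OmegaM d)"
  unfolding OmegaM_def
proof (rule measurable_PiM_single')
  fix x assume "x \<in> sites d"
  then show "(\<lambda>w. shift d u w x) \<in> measurable (Pi\<^sub>M (sites d) (\<lambda>_. count_space UNIV)) (count_space UNIV)"
    using vadd_sites[OF assms] by (simp add: shift_def)
qed (auto simp: shift_def space_PiM)

lemma sets_ENV [measurable_cong]: "sets (ENV d Q0 Q1 \<eta>) = sets (OmegaM d)"
  unfolding ENV_def OmegaM_def by (rule sets_PiM_cong) auto

lemma space_ENV: "space (ENV d Q0 Q1 \<eta>) = space (OmegaM d)"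
  by (rule sets_eq_imp_space_eq[OF sets_ENV])

lemma prob_space_ENV: "prob_space (ENV d Q0 Q1 \<eta>)"
  unfolding ENV_def by (intro prob_space_PiM) (simp add: measure_pmf.prob_space_axioms)

lemma measurable_spin [measurable]: "spin \<in> borel_measurable (count_space UNIV)"
  by simp

lemma measurable_Phi:
  assumes "G \<in> fin_subsets d" shows "Phi G \<in> borel_measurable (OmegaM d)"
proof -
  have "(\<lambda>\<eta>. \<eta> x) \<in> measurable (OmegaM d) (count_space UNIV)" if "x \<in> G" for x
    using assms that unfolding OmegaM_def fin_subsets_def
    by (intro measurable_component_singleton) auto
  from measurable_compose[OF this measurable_spin]
  have "(\<lambda>\<eta>. spin (\<eta> x)) \<in> borel_measurable (OmegaM d)" if "x \<in> G" for x
    using that .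
  then show ?thesis unfolding Phi_def[abs_def] by (intro borel_measurable_prod)
qed

text \<open>A class stable under linear combinations whose members are integrable under every law
  \<open>ENV\<close> and under the invariant measure, so that integrals can be split.\<close>

definition bounded_measurable :: "nat \<Rightarrow> ((int list \<Rightarrow> bool) \<Rightarrow> real) \<Rightarrow> bool" where
  "bounded_measurable d f \<longleftrightarrow> f \<in> borel_measurable (OmegaM d) \<and> (\<exists>B. \<forall>\<eta>\<in>space (OmegaM d). \<bar>f \<eta>\<bar> \<le> B)"

lemma bounded_measurable_integrable:
  assumes "bounded_measurable d f" "finite_measure N" "sets N = sets (OmegaM d)"
  shows "integrable N f"
proof -
  obtain B where B: "\<And>\<eta>. \<eta> \<in> space (OmegaM d) \<Longrightarrow> \<bar>f \<eta>\<bar> \<le> B" and f: "f \<in> borel_measurable (OmegaM d)"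
    using assms(1) by (auto simp: bounded_measurable_def)
  have "f \<in> borel_measurable N" using f assms(3) by (simp cong: measurable_cong_sets)
  moreover have "AE x in N. norm (f x) \<le> B"
    using B sets_eq_imp_space_eq[OF assms(3)] by (intro AE_I2) simp
  ultimately show ?thesis
    using finite_measure.integrable_const_bound[OF assms(2)] by blast
qed

lemma bounded_measurable_const: "bounded_measurable d (\<lambda>_. k)"
  by (auto simp: bounded_measurable_def)

lemma bounded_measurable_add:
  assumes "bounded_measurable d f" "bounded_measurable d g"
  shows "bounded_measurable d (\<lambda>\<eta>. f \<eta> + g \<eta>)"
proof -
  obtain B B' where "\<And>\<eta>. \<eta> \<in> space (OmegaM d) \<Longrightarrow> \<bar>f \<eta>\<bar> \<le> B" "\<And>\<eta>. \<eta> \<in> space (OmegaM d) \<Longrightarrow> \<bar>g \<eta>\<bar> \<le> B'"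
    using assms by (auto simp: bounded_measurable_def)
  then have "\<forall>\<eta>\<in>space (OmegaM d). \<bar>f \<eta> + g \<eta>\<bar> \<le> B + B'"
    by (meson abs_triangle_ineq add_mono order_trans)
  then show ?thesis using assms by (auto simp: bounded_measurable_def)
qed

lemma bounded_measurable_cmult:
  assumes "bounded_measurable d f" shows "bounded_measurable d (\<lambda>\<eta>. k * f \<eta>)"
proof -
  obtain B where "\<And>\<eta>. \<eta> \<in> space (OmegaM d) \<Longrightarrow> \<bar>f \<eta>\<bar> \<le> B"
    using assms by (auto simp: bounded_measurable_def)
  then have "\<forall>\<eta>\<in>space (OmegaM d). \<bar>k * f \<eta>\<bar> \<le> \<bar>k\<bar> * B"
    by (simp add: abs_mult mult_left_mono)
  then show ?thesis using assms by (auto simp: bounded_measurable_def)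
qed

lemma bounded_measurable_sum:
  "finite I \<Longrightarrow> (\<And>i. i \<in> I \<Longrightarrow> bounded_measurable d (h i)) \<Longrightarrow> bounded_measurable d (\<lambda>\<eta>. \<Sum>i\<in>I. h i \<eta>)"
  by (induction I rule: finite_induct) (auto intro: bounded_measurable_const bounded_measurable_add)

section \<open>The transition operator as an average over finitely many jumps\<close>

locale env_walk =
  fixes d :: nat and P0 c :: "int list \<Rightarrow> real" and eps :: real
    and Q0 Q1 :: "bool \<Rightarrow> bool \<Rightarrow> real"
  assumes fin_P0: "finite {u\<in>sites d. P0 u \<noteq> 0}"
    and sum_P0: "(\<Sum>\<^sub>\<infinity>u\<in>sites d. P0 u) = 1"
    and c_odd: "\<And>u. u \<in> sites d \<Longrightarrow> c (vneg u) = - c u"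
    and fin_c: "finite {u\<in>sites d. c u \<noteq> 0}"
    and jump_plus: "\<And>u. u \<in> sites d \<Longrightarrow> 0 \<le> P0 u + eps * c u \<and> P0 u + eps * c u < 1"
    and jump_minus: "\<And>u. u \<in> sites d \<Longrightarrow> 0 \<le> P0 u - eps * c u \<and> P0 u - eps * c u < 1"
begin

abbreviation T :: "((int list \<Rightarrow> bool) \<Rightarrow> real) \<Rightarrow> (int list \<Rightarrow> bool) \<Rightarrow> real" where
  "T \<equiv> Top d P0 c eps Q0 Q1"

abbreviation "jmp \<equiv> jump d P0 c eps"

definition steps :: "int list set" where
  "steps = {u\<in>sites d. P0 u \<noteq> 0} \<union> {u\<in>sites d. c u \<noteq> 0}"

lemma steps: "finite steps" "steps \<subseteq> sites d"
  using fin_P0 fin_c by (auto simp: steps_def)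

lemma jump_bounds: "u \<in> sites d \<Longrightarrow> 0 \<le> jmp \<eta> u \<and> jmp \<eta> u < 1"
  using jump_plus[of u] jump_minus[of u] by (auto simp: jump_def spin_def)

lemma infsum_steps:
  fixes h :: "int list \<Rightarrow> real"
  assumes "\<And>u. u \<in> sites d - steps \<Longrightarrow> h u = 0"
  shows "(\<Sum>\<^sub>\<infinity>u\<in>sites d. h u) = (\<Sum>u\<in>steps. h u)"
proof -
  have "(\<Sum>\<^sub>\<infinity>u\<in>sites d. h u) = (\<Sum>\<^sub>\<infinity>u\<in>steps. h u)"
    using steps assms by (intro infsum_cong_neutral) auto
  then show ?thesis using steps by simp
qed

text \<open>The reflection \<open>vneg\<close> permutes the sites and reverses the sign of
  \<open>c\<close>. Consequently the spin at the origin does not affect the total jump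
  probability.\<close>

lemma sum_c: "(\<Sum>u\<in>steps. c u) = 0"
proof -
  have "(\<Sum>\<^sub>\<infinity>u\<in>sites d. c u) = (\<Sum>\<^sub>\<infinity>u\<in>sites d. c (vneg u))"
    by (rule infsum_reindex_bij_betw[symmetric])
       (auto intro!: bij_betwI[where g = vneg] simp: vneg_sites)
  also have "\<dots> = (\<Sum>\<^sub>\<infinity>u\<in>sites d. - c u)"
    by (rule infsum_cong) (rule c_odd)
  also have "\<dots> = - (\<Sum>\<^sub>\<infinity>u\<in>sites d. c u)" by (rule infsum_uminus)
  finally have "(\<Sum>\<^sub>\<infinity>u\<in>sites d. c u) = 0" by simp
  then show ?thesis by (subst infsum_steps[symmetric]) (auto simp: steps_def)
qed

lemma sum_jump: "(\<Sum>u\<in>steps. jmp \<eta> u) = 1"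
proof -
  have "(\<Sum>u\<in>steps. P0 u) = 1"
    using sum_P0 by (subst infsum_steps[symmetric]) (auto simp: steps_def)
  moreover have "(\<Sum>u\<in>steps. eps * c u * spin (\<eta> (zerov d))) = eps * (\<Sum>u\<in>steps. c u) * spin (\<eta> (zerov d))"
    by (simp add: sum_distrib_left sum_distrib_right)
  ultimately show ?thesis by (simp add: jump_def sum.distrib sum_c)
qed

lemma Top_eq_sum:
  "T f \<eta> = (\<Sum>u\<in>steps. jmp \<eta> u * (\<integral>\<xi>. f (shift d u \<xi>) \<partial>ENV d Q0 Q1 \<eta>))"
  unfolding Top_def by (rule infsum_steps) (auto simp: steps_def jump_def)

lemma shift_space: "u \<in> steps \<Longrightarrow> \<xi> \<in> space (OmegaM d) \<Longrightarrow> shift d u \<xi> \<in> space (OmegaM d)"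
  using steps measurable_space[OF measurable_shift[of u d]] by auto

text \<open>Shifted environments stay in the space of \<open>OmegaM d\<close>, so only values there
  enter; expansions represent functions only on that space.\<close>

lemma Top_cong: "(\<And>\<eta>. \<eta> \<in> space (OmegaM d) \<Longrightarrow> f \<eta> = g \<eta>) \<Longrightarrow> T f \<eta> = T g \<eta>"
  unfolding Top_eq_sum
  by (intro sum.cong arg_cong2[where f = "(*)"] Bochner_Integration.integral_cong) (auto simp: space_ENV shift_space)

lemma integrable_shift:
  assumes "bounded_measurable d f" "u \<in> steps"
  shows "integrable (ENV d Q0 Q1 \<eta>) (\<lambda>\<xi>. f (shift d u \<xi>))"
proof (rule bounded_measurable_integrable)
  have [measurable]: "shift d u \<in> measurable (OmegaM d) (OmegaM d)" "f \<in> borel_measurable (OmegaM d)"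
    using assms steps measurable_shift by (auto simp: bounded_measurable_def)
  show "bounded_measurable d (\<lambda>\<xi>. f (shift d u \<xi>))"
    using assms shift_space unfolding bounded_measurable_def by (auto; blast)
  show "finite_measure (ENV d Q0 Q1 \<eta>)"
    using prob_space_ENV by (rule prob_space.finite_measure)
qed (rule sets_ENV)

lemma Top_add:
  "bounded_measurable d f \<Longrightarrow> bounded_measurable d g \<Longrightarrow> T (\<lambda>\<eta>. f \<eta> + g \<eta>) \<eta> = T f \<eta> + T g \<eta>"
  unfolding Top_eq_sum by (simp add: integrable_shift distrib_left sum.distrib)

lemma Top_cmult: "T (\<lambda>\<eta>. k * f \<eta>) \<eta> = k * T f \<eta>"
  unfolding Top_eq_sum by (simp add: sum_distrib_left mult_ac)

lemma Top_const: "T (\<lambda>_. k) \<eta> = k"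
proof -
  interpret E: prob_space "ENV d Q0 Q1 \<eta>" by (rule prob_space_ENV)
  show ?thesis unfolding Top_eq_sum
    using sum_jump[of \<eta>] by (simp add: E.prob_space flip: sum_distrib_right)
qed

lemma Top_add_const: "bounded_measurable d f \<Longrightarrow> T (\<lambda>\<eta>. f \<eta> + k) \<eta> = T f \<eta> + k"
  by (simp add: Top_add bounded_measurable_const Top_const)

lemma Top_sum:
  "finite I \<Longrightarrow> (\<And>i. i \<in> I \<Longrightarrow> bounded_measurable d (h i)) \<Longrightarrow> T (\<lambda>\<eta>. \<Sum>i\<in>I. h i \<eta>) \<eta> = (\<Sum>i\<in>I. T (h i) \<eta>)"
proof (induction I rule: finite_induct)
  case (insert i I)
  then show ?case by (simp add: Top_add bounded_measurable_sum)
qed (simp add: Top_const)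

text \<open>The operator averages over a jump and a random environment, so it does not increase a
  supremum bound.\<close>

lemma Top_abs_le:
  assumes "f \<in> borel_measurable (OmegaM d)" and B: "\<And>\<eta>. \<eta> \<in> space (OmegaM d) \<Longrightarrow> \<bar>f \<eta>\<bar> \<le> B"
  shows "\<bar>T f \<eta>\<bar> \<le> B"
proof -
  interpret E: prob_space "ENV d Q0 Q1 \<eta>" by (rule prob_space_ENV)
  have bm: "bounded_measurable d f" using assms by (auto simp: bounded_measurable_def)
  have 1: "\<bar>\<integral>\<xi>. f (shift d u \<xi>) \<partial>ENV d Q0 Q1 \<eta>\<bar> \<le> B" if u: "u \<in> steps" for u
  proof -
    have "\<bar>\<integral>\<xi>. f (shift d u \<xi>) \<partial>ENV d Q0 Q1 \<eta>\<bar> \<le> (\<integral>\<xi>. \<bar>f (shift d u \<xi>)\<bar> \<partial>ENV d Q0 Q1 \<eta>)"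
      by (rule integral_abs_bound)
    also have "\<dots> \<le> B"
      using integrable_shift[OF bm u] B shift_space[OF u]
      by (intro E.integral_le_const integrable_abs AE_I2) (auto simp: space_ENV)
    finally show ?thesis .
  qed
  have "\<bar>T f \<eta>\<bar> \<le> (\<Sum>u\<in>steps. \<bar>jmp \<eta> u * (\<integral>\<xi>. f (shift d u \<xi>) \<partial>ENV d Q0 Q1 \<eta>)\<bar>)"
    unfolding Top_eq_sum by (rule sum_abs)
  also have "\<dots> \<le> (\<Sum>u\<in>steps. jmp \<eta> u * B)"
    using 1 steps jump_bounds by (intro sum_mono) (auto simp: abs_mult intro!: mult_mono)
  also have "\<dots> = B" by (simp add: sum_jump flip: sum_distrib_right)
  finally show ?thesis .
qed

end

section \<open>Coefficient calculus for absolutely convergent spin expansions\<close>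

context
  fixes d :: nat and M :: real
  assumes M: "1 < M"
begin

lemma fun_of_abs_summable:
  assumes "a \<in> HMc d M"
  shows "(\<lambda>G. norm (a G * Phi G \<eta>)) summable_on fin_subsets d"
proof (rule summable_on_comparison_test)
  show "(\<lambda>G. \<bar>a G\<bar> * M ^ card G) summable_on fin_subsets d"
    using assms by (simp add: HMc_def)
  show "norm (a G * Phi G \<eta>) \<le> \<bar>a G\<bar> * M ^ card G" for G
    using M by (simp add: abs_mult mult_le_cancel_left1 one_le_power)
qed simp

lemma fun_of_summable:
  assumes "a \<in> HMc d M"
  shows "(\<lambda>G. a G * Phi G \<eta>) summable_on fin_subsets d"
  by (rule abs_summable_summable[OF fun_of_abs_summable[OF assms]])

text \<open>Every \<open>Phi G\<close> has modulus 1 and every weight \<open>M ^ card G\<close> is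
  at least 1, so the M-norm dominates the supremum.\<close>

lemma abs_fun_of_le:
  assumes "a \<in> HMc d M"
  shows "\<bar>fun_of d a \<eta>\<bar> \<le> Mnorm d M a"
proof -
  have "\<bar>fun_of d a \<eta>\<bar> \<le> (\<Sum>\<^sub>\<infinity>G\<in>fin_subsets d. norm (a G * Phi G \<eta>))"
    unfolding fun_of_def real_norm_def[symmetric]
    by (rule norm_infsum_bound) (use fun_of_abs_summable[OF assms] in simp)
  also have "\<dots> \<le> Mnorm d M a"
    unfolding Mnorm_def using fun_of_abs_summable[OF assms] assms M
    by (intro infsum_mono) (auto simp: HMc_def abs_mult mult_le_cancel_left1 one_le_power)
  finally show ?thesis .
qed

lemma fun_of_add:
  assumes "a \<in> HMc d M" "b \<in> HMc d M"
  shows "(\<lambda>G. a G + b G) \<in> HMc d M" "Mnorm d M (\<lambda>G. a G + b G) \<le> Mnorm d M a + Mnorm d M b"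
    "fun_of d (\<lambda>G. a G + b G) \<eta> = fun_of d a \<eta> + fun_of d b \<eta>"
proof -
  have s: "(\<lambda>G. \<bar>a G\<bar> * M ^ card G) summable_on fin_subsets d" "(\<lambda>G. \<bar>b G\<bar> * M ^ card G) summable_on fin_subsets d"
    using assms by (auto simp: HMc_def)
  have le: "\<bar>a G + b G\<bar> * M ^ card G \<le> \<bar>a G\<bar> * M ^ card G + \<bar>b G\<bar> * M ^ card G" for G
    using M mult_right_mono[OF abs_triangle_ineq[of "a G" "b G"], of "M ^ card G"] by (simp add: distrib_right)
  show 1: "(\<lambda>G. a G + b G) \<in> HMc d M"
    unfolding HMc_def mem_Collect_eq
    by (rule summable_on_comparison_test[OF summable_on_add[OF s]]) (use le M in auto)
  show "Mnorm d M (\<lambda>G. a G + b G) \<le> Mnorm d M a + Mnorm d M b"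
    unfolding Mnorm_def infsum_add[OF s, symmetric]
    using 1 le by (intro infsum_mono summable_on_add s) (auto simp: HMc_def)
  show "fun_of d (\<lambda>G. a G + b G) \<eta> = fun_of d a \<eta> + fun_of d b \<eta>"
    unfolding fun_of_def distrib_right
    by (intro infsum_add fun_of_summable assms)
qed

lemma fun_of_cmult:
  assumes "a \<in> HMc d M"
  shows "(\<lambda>G. k * a G) \<in> HMc d M" "Mnorm d M (\<lambda>G. k * a G) = \<bar>k\<bar> * Mnorm d M a"
    "fun_of d (\<lambda>G. k * a G) \<eta> = k * fun_of d a \<eta>"
  using assms unfolding HMc_def Mnorm_def fun_of_def
  by (simp_all add: abs_mult mult.assoc summable_on_cmult_right infsum_cmult_right')

lemma fun_of_single:
  fixes k :: real
  assumes "G \<in> fin_subsets d"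
  defines "a \<equiv> (\<lambda>H. if H = G then k else 0)"
  shows "a \<in> HMc d M" "Mnorm d M a = \<bar>k\<bar> * M ^ card G" "fun_of d a \<eta> = k * Phi G \<eta>"
proof -
  have 1: "(h summable_on fin_subsets d \<longleftrightarrow> h summable_on {G}) \<and> infsum h (fin_subsets d) = infsum h {G}"
    if "\<And>H. H \<noteq> G \<Longrightarrow> h H = 0" for h :: "int list set \<Rightarrow> real"
    using assms(1) that by (intro conjI summable_on_cong_neutral infsum_cong_neutral) auto
  show "a \<in> HMc d M" using 1[of "\<lambda>H. \<bar>a H\<bar> * M ^ card H"] by (simp add: HMc_def a_def)
  show "Mnorm d M a = \<bar>k\<bar> * M ^ card G"
    using 1[of "\<lambda>H. \<bar>a H\<bar> * M ^ card H"] by (simp add: Mnorm_def a_def)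
  show "fun_of d a \<eta> = k * Phi G \<eta>"
    using 1[of "\<lambda>H. a H * Phi H \<eta>"] by (simp add: fun_of_def a_def)
qed

text \<open>As spins square to 1, multiplication by the spin at \<open>z\<close> merely permutes the
  monomials, adding \<open>z\<close> to \<open>G\<close> or removing it; a weight grows by at most
  one factor \<open>M\<close>.\<close>

lemma fun_of_spin:
  assumes a: "a \<in> HMc d M" and z: "z \<in> sites d"
  defines "tog \<equiv> (\<lambda>G. if z \<in> G then G - {z} else insert z G)"
  shows "(\<lambda>G. a (tog G)) \<in> HMc d M" "Mnorm d M (\<lambda>G. a (tog G)) \<le> M * Mnorm d M a"
    "fun_of d (\<lambda>G. a (tog G)) \<eta> = spin (\<eta> z) * fun_of d a \<eta>"
proof -
  have tt: "tog (tog G) = G" for G by (auto simp: tog_def)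
  have tf: "tog G \<in> fin_subsets d" if "G \<in> fin_subsets d" for G
    using that z by (auto simp: tog_def fin_subsets_def)
  have bij: "bij_betw tog (fin_subsets d) (fin_subsets d)"
    by (rule bij_betwI[where g = tog]) (auto simp: tt tf)
  have card: "card (tog G) \<le> Suc (card G)" if "G \<in> fin_subsets d" for G
    using that by (auto simp: tog_def fin_subsets_def intro!: le_SucI card_mono)
  have s: "(\<lambda>G. M * (\<bar>a G\<bar> * M ^ card G)) summable_on fin_subsets d"
    using a by (intro summable_on_cmult_right) (simp add: HMc_def)
  have le: "\<bar>a G\<bar> * M ^ card (tog G) \<le> M * (\<bar>a G\<bar> * M ^ card G)" if "G \<in> fin_subsets d" for G
  proof -
    have "M ^ card (tog G) \<le> M ^ Suc (card G)" using M card[OF that] by (intro power_increasing) auto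
    then have "\<bar>a G\<bar> * M ^ card (tog G) \<le> \<bar>a G\<bar> * M ^ Suc (card G)" by (intro mult_left_mono) auto
    then show ?thesis by (simp add: mult_ac)
  qed
  have s2: "(\<lambda>G. \<bar>a G\<bar> * M ^ card (tog G)) summable_on fin_subsets d"
    by (rule summable_on_comparison_test[OF s]) (use le M in auto)
  have s2': "(\<lambda>G. (\<lambda>G. \<bar>a G\<bar> * M ^ card (tog G)) (tog G)) = (\<lambda>G. \<bar>a (tog G)\<bar> * M ^ card G)"
    by (simp add: tt)
  show "(\<lambda>G. a (tog G)) \<in> HMc d M"
    using s2 summable_on_reindex_bij_betw[OF bij, of "\<lambda>G. \<bar>a G\<bar> * M ^ card (tog G)"]
    by (simp add: HMc_def tt)
  have "Mnorm d M (\<lambda>G. a (tog G)) = (\<Sum>\<^sub>\<infinity>G\<in>fin_subsets d. \<bar>a G\<bar> * M ^ card (tog G))"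
    using infsum_reindex_bij_betw[OF bij, of "\<lambda>G. \<bar>a G\<bar> * M ^ card (tog G)"]
    by (simp add: Mnorm_def tt)
  also have "\<dots> \<le> (\<Sum>\<^sub>\<infinity>G\<in>fin_subsets d. M * (\<bar>a G\<bar> * M ^ card G))"
    by (rule infsum_mono[OF s2 s le])
  also have "\<dots> = M * Mnorm d M a" by (simp add: Mnorm_def infsum_cmult_right')
  finally show "Mnorm d M (\<lambda>G. a (tog G)) \<le> M * Mnorm d M a" .
  have Phi: "Phi (tog G) \<eta> = spin (\<eta> z) * Phi G \<eta>" if "G \<in> fin_subsets d" for G
  proof -
    have fin: "finite G" using that by (simp add: fin_subsets_def)
    have sq: "spin (\<eta> z) * (spin (\<eta> z) * x) = x" for x by (simp add: spin_def)
    show ?thesis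
      using fin by (cases "z \<in> G") (simp_all add: tog_def Phi_def prod.remove[of G z] sq)
  qed
  have "fun_of d (\<lambda>G. a (tog G)) \<eta> = (\<Sum>\<^sub>\<infinity>G\<in>fin_subsets d. a G * Phi (tog G) \<eta>)"
    using infsum_reindex_bij_betw[OF bij, of "\<lambda>G. a G * Phi (tog G) \<eta>"]
    by (simp add: fun_of_def tt)
  also have "\<dots> = (\<Sum>\<^sub>\<infinity>G\<in>fin_subsets d. spin (\<eta> z) * (a G * Phi G \<eta>))"
    by (rule infsum_cong) (simp add: Phi mult_ac)
  finally show "fun_of d (\<lambda>G. a (tog G)) \<eta> = spin (\<eta> z) * fun_of d a \<eta>"
    by (simp add: fun_of_def infsum_cmult_right')
qed

text \<open>The tail of the summable weights bounds the remainder uniformly in the configuration, so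
  identities stable under uniform limits can be checked on monomials.\<close>

lemma fun_of_approx:
  assumes a: "a \<in> HMc d M" and e: "0 < e"
  obtains F where "finite F" "F \<subseteq> fin_subsets d"
    "\<And>\<eta>. \<bar>fun_of d a \<eta> - (\<Sum>G\<in>F. a G * Phi G \<eta>)\<bar> \<le> e"
proof -
  let ?h = "\<lambda>G. \<bar>a G\<bar> * M ^ card G"
  have s: "?h summable_on fin_subsets d" using a by (simp add: HMc_def)
  obtain F where F: "finite F" "F \<subseteq> fin_subsets d" "dist (sum ?h F) (infsum ?h (fin_subsets d)) \<le> e"
    using infsum_finite_approximation[OF s e] by blast
  have "\<bar>fun_of d a \<eta> - (\<Sum>G\<in>F. a G * Phi G \<eta>)\<bar> \<le> e" for \<eta>
  proof -
    define b where "b G = (if G \<in> F then 0 else a G)" for G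
    have le: "\<bar>b G\<bar> * M ^ card G \<le> ?h G" for G using M by (simp add: b_def)
    have b: "b \<in> HMc d M"
      unfolding HMc_def mem_Collect_eq
      by (rule summable_on_comparison_test[OF s]) (use le M in auto)
    have sF: "(\<lambda>G. a G * Phi G \<eta>) summable_on fin_subsets d"
      by (rule fun_of_summable[OF a])
    have "fun_of d a \<eta> - (\<Sum>G\<in>F. a G * Phi G \<eta>) = (\<Sum>\<^sub>\<infinity>G\<in>fin_subsets d - F. a G * Phi G \<eta>)"
      unfolding fun_of_def using F sF by (subst infsum_Diff) auto
    also have "\<dots> = fun_of d b \<eta>"
      unfolding fun_of_def by (rule infsum_cong_neutral) (auto simp: b_def)
    finally have "\<bar>fun_of d a \<eta> - (\<Sum>G\<in>F. a G * Phi G \<eta>)\<bar> \<le> Mnorm d M b"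
      using abs_fun_of_le[OF b] by simp
    also have "Mnorm d M b = (\<Sum>\<^sub>\<infinity>G\<in>fin_subsets d - F. ?h G)"
      unfolding Mnorm_def by (rule infsum_cong_neutral) (auto simp: b_def)
    also have "\<dots> = infsum ?h (fin_subsets d) - sum ?h F"
      using F s by (subst infsum_Diff) auto
    also have "\<dots> \<le> e" using F(3) by (simp add: dist_real_def)
    finally show ?thesis .
  qed
  with F show ?thesis using that by blast
qed

lemma measurable_fun_of:
  assumes a: "a \<in> HMc d M" shows "fun_of d a \<in> borel_measurable (OmegaM d)"
proof -
  have "\<exists>F. finite F \<and> F \<subseteq> fin_subsets d \<and> (\<forall>\<eta>. \<bar>fun_of d a \<eta> - (\<Sum>G\<in>F. a G * Phi G \<eta>)\<bar> \<le> inverse (real (Suc n)))" for n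
    using fun_of_approx[OF a, of "inverse (real (Suc n))"] by (metis inverse_positive_iff_positive of_nat_0_less_iff zero_less_Suc)
  then obtain F where F: "\<And>n. finite (F n)" "\<And>n. F n \<subseteq> fin_subsets d"
     "\<And>n \<eta>. \<bar>fun_of d a \<eta> - (\<Sum>G\<in>F n. a G * Phi G \<eta>)\<bar> \<le> inverse (real (Suc n))" by metis
  show ?thesis
  proof (rule borel_measurable_LIMSEQ_real)
    show "(\<lambda>\<eta>. \<Sum>G\<in>F n. a G * Phi G \<eta>) \<in> borel_measurable (OmegaM d)" for n
      using F(2)[of n] by (intro borel_measurable_sum borel_measurable_times measurable_Phi) auto
    fix \<eta>
    have "(\<lambda>n. (\<Sum>G\<in>F n. a G * Phi G \<eta>) - fun_of d a \<eta>) \<longlonglongrightarrow> 0"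
      by (rule Lim_null_comparison[OF _ LIMSEQ_inverse_real_of_nat])
         (use F(3)[of \<eta>] in \<open>simp add: abs_minus_commute\<close>)
    then show "(\<lambda>n. \<Sum>G\<in>F n. a G * Phi G \<eta>) \<longlonglongrightarrow> fun_of d a \<eta>"
      by (simp add: LIM_zero_iff)
  qed
qed

end

section \<open>Mixing of the observed spins\<close>

text \<open>Indicators of the letters: with these factors \<open>W\<close> is the conditional
  probability of observing the word, given the initial environment.\<close>

definition spin_word :: "bool list \<Rightarrow> (bool \<Rightarrow> real) list" where
  "spin_word = map (\<lambda>b x. if x = b then 1 else 0)"

lemma sum_lists_Suc:
  fixes h :: "bool list \<Rightarrow> real"
  shows "(\<Sum>v | length v = Suc n. h v) = (\<Sum>b\<in>UNIV. \<Sum>v | length v = n. h (b # v))"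
proof -
  have "{v :: bool list. length v = Suc n} = (\<lambda>(b, v). b # v) ` (UNIV \<times> {v. length v = n})"
    by (auto simp: length_Suc_conv image_iff)
  moreover have "inj_on (\<lambda>(b, v). b # v) (UNIV \<times> {v :: bool list. length v = n})"
    by (auto simp: inj_on_def)
  ultimately show ?thesis
    by (simp add: sum.reindex sum.cartesian_product case_prod_unfold)
qed

lemma finite_words [simp]: "finite {v :: bool list. length v = n}"
  using finite_lists_length_eq[of "UNIV :: bool set" n] by simp

text \<open>Smallness of \<open>mubar\<close> enters as \<open>mubar * (1 + M) \<le> 1 / 2\<close>:
  observing a spin multiplies norms by up to \<open>1 + M\<close>, summed over its two values, and
  the contraction must win this back.\<close>

locale rw_chain = env_walk +
  fixes M mubar :: real and Pi :: "(int list \<Rightarrow> bool) measure" and wp :: "(nat \<Rightarrow> bool) measure"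
  assumes M: "1 < M"
    and T_HM: "\<forall>a\<in>HMc d M. \<exists>b\<in>HMc d M. \<forall>\<eta>\<in>space (OmegaM d). Top d P0 c eps Q0 Q1 (fun_of d a) \<eta> = fun_of d b \<eta>"
    and prob_Pi: "prob_space Pi" and sets_Pi: "sets Pi = sets (OmegaM d)"
    and invariant: "\<forall>A\<in>sets (OmegaM d). (\<integral>\<eta>. Top d P0 c eps Q0 Q1 (indicator A) \<eta> \<partial>Pi) = measure Pi A"
    and mubar: "0 < mubar" "mubar < 1" "mubar * (1 + M) \<le> 1 / 2"
    and contraction: "\<forall>a\<in>HMc d M. \<forall>b\<in>HMc d M. (\<integral>\<eta>. fun_of d a \<eta> \<partial>Pi) = 0 \<longrightarrow>
           (\<forall>\<eta>\<in>space (OmegaM d). Top d P0 c eps Q0 Q1 (fun_of d a) \<eta> = fun_of d b \<eta>) \<longrightarrow>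
           Mnorm d M b \<le> mubar * Mnorm d M a"
    and prob_wp: "prob_space wp" and sets_wp: "sets wp = sets OmegaPlus"
    and law_wp: "\<forall>gs. (\<integral>w. (\<Prod>t<length gs. (gs ! t) (w t)) \<partial>wp)
        = (\<integral>\<eta>. W (Top d P0 c eps Q0 Q1) (zerov d) gs \<eta> \<partial>Pi)"
begin

sublocale Pi: prob_space Pi by (rule prob_Pi)
sublocale wp: prob_space wp by (rule prob_wp)

abbreviation "z0 \<equiv> zerov d"

lemma space_Pi: "space Pi = space (OmegaM d)"
  by (rule sets_eq_imp_space_eq[OF sets_Pi])

lemma integral_Pi_cong:
  "(\<And>\<eta>. \<eta> \<in> space (OmegaM d) \<Longrightarrow> f \<eta> = g \<eta>) \<Longrightarrow> (\<integral>\<eta>. f \<eta> \<partial>Pi) = (\<integral>\<eta>. g \<eta> \<partial>Pi)"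
  by (rule Bochner_Integration.integral_cong) (auto simp: space_Pi)

lemma abs_integral_Pi_le:
  fixes k :: "(int list \<Rightarrow> bool) \<Rightarrow> real"
  assumes "integrable Pi k" "\<And>\<eta>. \<eta> \<in> space (OmegaM d) \<Longrightarrow> \<bar>k \<eta>\<bar> \<le> B"
  shows "\<bar>\<integral>\<eta>. k \<eta> \<partial>Pi\<bar> \<le> B"
proof -
  have "\<bar>\<integral>\<eta>. k \<eta> \<partial>Pi\<bar> \<le> (\<integral>\<eta>. \<bar>k \<eta>\<bar> \<partial>Pi)" by (rule integral_abs_bound)
  also have "\<dots> \<le> B"
    using assms by (intro Pi.integral_le_const integrable_abs AE_I2) (auto simp: space_Pi)
  finally show ?thesis .
qed

text \<open>Ball of radius \<open>B\<close> in the M-norm as a property of functions: some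
  coefficient family of norm at most \<open>B\<close> represents \<open>f\<close> on the
  configuration space. Bounds can then be combined without carrying coefficients along.\<close>

definition HM_le :: "real \<Rightarrow> ((int list \<Rightarrow> bool) \<Rightarrow> real) \<Rightarrow> bool" where
  "HM_le B f \<longleftrightarrow> (\<exists>a\<in>HMc d M. Mnorm d M a \<le> B \<and> (\<forall>\<eta>\<in>space (OmegaM d). f \<eta> = fun_of d a \<eta>))"

lemma HM_le_mono: "HM_le B f \<Longrightarrow> B \<le> B' \<Longrightarrow> HM_le B' f"
  unfolding HM_le_def by force

lemma HM_le_cong: "HM_le B f \<Longrightarrow> (\<And>\<eta>. \<eta> \<in> space (OmegaM d) \<Longrightarrow> f \<eta> = g \<eta>) \<Longrightarrow> HM_le B g"
  unfolding HM_le_def by auto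

lemma HM_le_abs: "HM_le B f \<Longrightarrow> \<eta> \<in> space (OmegaM d) \<Longrightarrow> \<bar>f \<eta>\<bar> \<le> B"
  unfolding HM_le_def using abs_fun_of_le[OF M, of _ d \<eta>] by force

lemma HM_le_measurable:
  assumes "HM_le B f" shows "f \<in> borel_measurable (OmegaM d)"
proof -
  obtain a where a: "a \<in> HMc d M" "\<forall>\<eta>\<in>space (OmegaM d). f \<eta> = fun_of d a \<eta>"
    using assms unfolding HM_le_def by blast
  have "f \<in> borel_measurable (OmegaM d) \<longleftrightarrow> fun_of d a \<in> borel_measurable (OmegaM d)"
    using a by (intro measurable_cong) auto
  then show ?thesis using measurable_fun_of[OF M a(1)] by simp
qed

lemma HM_le_bounded: "HM_le B f \<Longrightarrow> bounded_measurable d f"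
  unfolding bounded_measurable_def using HM_le_measurable HM_le_abs by blast

lemma HM_le_integrable: "HM_le B f \<Longrightarrow> integrable Pi f"
  by (rule bounded_measurable_integrable[OF HM_le_bounded])
     (auto simp: sets_Pi Pi.finite_measure_axioms)

lemma HM_le_add:
  assumes "HM_le B f" "HM_le B' g" shows "HM_le (B + B') (\<lambda>\<eta>. f \<eta> + g \<eta>)"
proof -
  obtain a b where a: "a \<in> HMc d M" "Mnorm d M a \<le> B" "\<forall>\<eta>\<in>space (OmegaM d). f \<eta> = fun_of d a \<eta>"
    and b: "b \<in> HMc d M" "Mnorm d M b \<le> B'" "\<forall>\<eta>\<in>space (OmegaM d). g \<eta> = fun_of d b \<eta>"
    using assms unfolding HM_le_def by blast
  show ?thesis
    unfolding HM_le_def using fun_of_add[OF M a(1) b(1)] a b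
    by (intro bexI[of _ "\<lambda>G. a G + b G"]) auto
qed

lemma HM_le_cmult:
  assumes "HM_le B f" shows "HM_le (\<bar>k\<bar> * B) (\<lambda>\<eta>. k * f \<eta>)"
proof -
  obtain a where a: "a \<in> HMc d M" "Mnorm d M a \<le> B" "\<forall>\<eta>\<in>space (OmegaM d). f \<eta> = fun_of d a \<eta>"
    using assms unfolding HM_le_def by blast
  show ?thesis
    unfolding HM_le_def using fun_of_cmult[OF M a(1), of k] a
    by (intro bexI[of _ "\<lambda>G. k * a G"]) (auto simp: mult_left_mono)
qed

lemma HM_le_const: "HM_le \<bar>k\<bar> (\<lambda>_. k)"
proof -
  have "{} \<in> fin_subsets d" by (simp add: fin_subsets_def)
  from fun_of_single[OF M this, of k] show ?thesis
    unfolding HM_le_def by (intro bexI[of _ "\<lambda>H. if H = {} then k else 0"]) (simp_all add: Phi_def)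
qed

lemma HM_le_Phi: "G \<in> fin_subsets d \<Longrightarrow> HM_le (M ^ card G) (Phi G)"
  unfolding HM_le_def using fun_of_single[OF M, of G d 1]
  by (intro bexI[of _ "\<lambda>H. if H = G then 1 else 0"]) simp_all

lemma HM_le_sum:
  assumes "finite I" "\<And>i. i \<in> I \<Longrightarrow> \<exists>B. HM_le B (h i)"
  shows "\<exists>B. HM_le B (\<lambda>\<eta>. \<Sum>i\<in>I. h i \<eta>)"
  using assms
proof (induction I rule: finite_induct)
  case empty
  show ?case using HM_le_const[of 0] by auto
next
  case (insert i I)
  then obtain B B' where "HM_le B (h i)" "HM_le B' (\<lambda>\<eta>. \<Sum>i\<in>I. h i \<eta>)" by blast
  from HM_le_add[OF this] insert.hyps show ?case by auto
qed

lemma HM_le_spin: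
  assumes "HM_le B f" shows "HM_le (M * B) (\<lambda>\<eta>. spin (\<eta> z0) * f \<eta>)"
proof -
  obtain a where a: "a \<in> HMc d M" "Mnorm d M a \<le> B" "\<forall>\<eta>\<in>space (OmegaM d). f \<eta> = fun_of d a \<eta>"
    using assms unfolding HM_le_def by blast
  have "M * Mnorm d M a \<le> M * B" using M a by simp
  then show ?thesis
    unfolding HM_le_def using fun_of_spin[OF M a(1) zerov_sites] a(3)
    by (intro bexI[of _ "\<lambda>G. a (if z0 \<in> G then G - {z0} else insert z0 G)"]) auto
qed

text \<open>The indicator of the value \<open>b\<close> is one half of 1 plus \<open>spin b\<close>
  times the spin at the origin; the two terms have norm factors 1 and \<open>M\<close>.\<close>

lemma HM_le_indicator:
  assumes "HM_le B f"
  shows "HM_le ((1 + M) / 2 * B) (\<lambda>\<eta>. (if \<eta> z0 = b then 1 else 0) * f \<eta>)"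
proof -
  have "HM_le (1 / 2 * B + 1 / 2 * (M * B)) (\<lambda>\<eta>. 1 / 2 * f \<eta> + (spin b / 2) * (spin (\<eta> z0) * f \<eta>))"
    using HM_le_add[OF HM_le_cmult[OF assms, of "1/2"] HM_le_cmult[OF HM_le_spin[OF assms], of "spin b / 2"]]
    by simp
  then have "HM_le ((1 + M) / 2 * B) (\<lambda>\<eta>. 1 / 2 * f \<eta> + (spin b / 2) * (spin (\<eta> z0) * f \<eta>))"
    by (rule HM_le_mono) (simp add: algebra_simps)
  then show ?thesis
    by (rule HM_le_cong) (auto simp: spin_def)
qed

lemma HM_le_T: "HM_le B f \<Longrightarrow> \<exists>B'. HM_le B' (T f)"
proof -
  assume "HM_le B f"
  then obtain a where a: "a \<in> HMc d M" "\<forall>\<eta>\<in>space (OmegaM d). f \<eta> = fun_of d a \<eta>"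
    unfolding HM_le_def by blast
  then have Tf: "T f \<eta> = T (fun_of d a) \<eta>" for \<eta> by (intro Top_cong) auto
  obtain b where "b \<in> HMc d M" "\<forall>\<eta>\<in>space (OmegaM d). T (fun_of d a) \<eta> = fun_of d b \<eta>"
    using T_HM a(1) by blast
  then show ?thesis unfolding HM_le_def Tf by blast
qed

lemma HM_le_T_centered:
  assumes "HM_le B f" "(\<integral>\<eta>. f \<eta> \<partial>Pi) = 0" shows "HM_le (mubar * B) (T f)"
proof -
  obtain a where a: "a \<in> HMc d M" "Mnorm d M a \<le> B" "\<forall>\<eta>\<in>space (OmegaM d). f \<eta> = fun_of d a \<eta>"
    using assms unfolding HM_le_def by blast
  have Tf: "T f \<eta> = T (fun_of d a) \<eta>" for \<eta> using a by (intro Top_cong) auto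
  obtain b where b: "b \<in> HMc d M" "\<forall>\<eta>\<in>space (OmegaM d). T (fun_of d a) \<eta> = fun_of d b \<eta>"
    using T_HM a by blast
  have "(\<integral>\<eta>. fun_of d a \<eta> \<partial>Pi) = 0" using assms(2) a(3) by (simp cong: integral_Pi_cong)
  then have "Mnorm d M b \<le> mubar * Mnorm d M a" using contraction a b by blast
  also have "\<dots> \<le> mubar * B" using a mubar by simp
  finally show ?thesis using b unfolding HM_le_def Tf by blast
qed

text \<open>\<open>Phi G\<close> takes only the values 1 and -1, so it is an affine function of the
  indicator of a measurable event, and for indicators invariance is assumed.\<close>

lemma integral_T_Phi:
  assumes G: "G \<in> fin_subsets d" shows "(\<integral>\<eta>. T (Phi G) \<eta> \<partial>Pi) = (\<integral>\<eta>. Phi G \<eta> \<partial>Pi)"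
proof -
  define A where "A = {\<eta> \<in> space (OmegaM d). Phi G \<eta> = 1}"
  have [measurable]: "Phi G \<in> borel_measurable (OmegaM d)" by (rule measurable_Phi[OF G])
  have A: "A \<in> sets (OmegaM d)" unfolding A_def by measurable
  have pm: "Phi G \<eta> = 1 \<or> Phi G \<eta> = -1" for \<eta> using abs_Phi[of G \<eta>] by linarith
  have ind: "indicator A \<eta> = 1 / 2 * Phi G \<eta> + 1 / 2" if "\<eta> \<in> space (OmegaM d)" for \<eta>
    using pm[of \<eta>] that by (auto simp: A_def)
  have H: "HM_le (M ^ card G) (Phi G)" by (rule HM_le_Phi[OF G])
  obtain B where B: "HM_le B (T (Phi G))" using HM_le_T[OF H] by blast
  have "T (indicator A) = (\<lambda>\<eta>. 1 / 2 * T (Phi G) \<eta> + 1 / 2)"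
  proof
    fix \<eta>
    have "T (indicator A) \<eta> = T (\<lambda>\<eta>. 1 / 2 * Phi G \<eta> + 1 / 2) \<eta>" by (rule Top_cong) (rule ind)
    also have "\<dots> = 1 / 2 * T (Phi G) \<eta> + 1 / 2"
      by (simp only: Top_add_const[OF bounded_measurable_cmult[OF HM_le_bounded[OF H]]] Top_cmult)
    finally show "T (indicator A) \<eta> = 1 / 2 * T (Phi G) \<eta> + 1 / 2" .
  qed
  then have "measure Pi A = (\<integral>\<eta>. 1 / 2 * T (Phi G) \<eta> + 1 / 2 \<partial>Pi)"
    using bspec[OF invariant A] by simp
  also have "\<dots> = 1 / 2 * (\<integral>\<eta>. T (Phi G) \<eta> \<partial>Pi) + 1 / 2"
    using HM_le_integrable[OF B] by (simp add: Pi.prob_space)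
  finally have 1: "measure Pi A = 1 / 2 * (\<integral>\<eta>. T (Phi G) \<eta> \<partial>Pi) + 1 / 2" .
  have "measure Pi A = (\<integral>\<eta>. indicator A \<eta> \<partial>Pi)" using A by (simp add: sets_Pi space_Pi A_def Int_absorb2 Collect_subset)
  also have "\<dots> = (\<integral>\<eta>. 1 / 2 * Phi G \<eta> + 1 / 2 \<partial>Pi)" by (rule integral_Pi_cong) (rule ind)
  also have "\<dots> = 1 / 2 * (\<integral>\<eta>. Phi G \<eta> \<partial>Pi) + 1 / 2"
    using HM_le_integrable[OF H] by (simp add: Pi.prob_space)
  finally show ?thesis using 1 by simp
qed

text \<open>Invariance passes from monomials to finite combinations by linearity and to all
  expansions by uniform approximation, as the operator does not increase the supremum of the
  error.\<close>

lemma integral_T: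
  assumes "HM_le B f" shows "(\<integral>\<eta>. T f \<eta> \<partial>Pi) = (\<integral>\<eta>. f \<eta> \<partial>Pi)"
proof -
  obtain a where a: "a \<in> HMc d M" "\<forall>\<eta>\<in>space (OmegaM d). f \<eta> = fun_of d a \<eta>"
    using assms unfolding HM_le_def by blast
  have "\<bar>(\<integral>\<eta>. T f \<eta> \<partial>Pi) - (\<integral>\<eta>. f \<eta> \<partial>Pi)\<bar> \<le> e" if "0 < e" for e
  proof -
    \<comment> \<open>The remainder enters twice, once in \<open>f\<close> and once in
      \<open>T f\<close>.\<close>
    have e2: "0 < e / 2" using that by simp
    obtain F where F: "finite F" "F \<subseteq> fin_subsets d"
       "\<And>\<eta>. \<bar>fun_of d a \<eta> - (\<Sum>G\<in>F. a G * Phi G \<eta>)\<bar> \<le> e / 2"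
      using fun_of_approx[OF M a(1) e2] by metis
    define g where "g \<eta> = (\<Sum>G\<in>F. a G * Phi G \<eta>)" for \<eta>
    define h where "h \<eta> = f \<eta> + (- 1) * g \<eta>" for \<eta>
    have "\<exists>B. HM_le B g" unfolding g_def[abs_def]
      using F HM_le_cmult HM_le_Phi by (intro HM_le_sum) blast+
    then obtain B' where g: "HM_le B' g" by blast
    have h: "HM_le (B + \<bar>- 1\<bar> * B') h" unfolding h_def[abs_def]
      by (intro HM_le_add assms HM_le_cmult g)
    obtain C where Th: "HM_le C (T h)" using HM_le_T[OF h] by blast
    obtain C' where Tg: "HM_le C' (T g)" using HM_le_T[OF g] by blast
    have hb: "\<bar>h \<eta>\<bar> \<le> e / 2" if "\<eta> \<in> space (OmegaM d)" for \<eta>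
      using F(3)[of \<eta>] a(2) that by (simp add: h_def g_def)
    have Thb: "\<bar>T h \<eta>\<bar> \<le> e / 2" for \<eta>
      by (rule Top_abs_le[OF HM_le_measurable[OF h] hb])
    have sp: "f = (\<lambda>\<eta>. g \<eta> + h \<eta>)" by (simp add: h_def)
    have "(\<integral>\<eta>. g \<eta> \<partial>Pi) = (\<Sum>G\<in>F. a G * (\<integral>\<eta>. Phi G \<eta> \<partial>Pi))"
      unfolding g_def using F HM_le_integrable[OF HM_le_Phi] by (subst Bochner_Integration.integral_sum) auto
    moreover have "(\<integral>\<eta>. T g \<eta> \<partial>Pi) = (\<Sum>G\<in>F. a G * (\<integral>\<eta>. Phi G \<eta> \<partial>Pi))"
    proof -
      have "T g \<eta> = (\<Sum>G\<in>F. a G * T (Phi G) \<eta>)" for \<eta>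
        unfolding g_def[abs_def]
        using F HM_le_bounded[OF HM_le_cmult[OF HM_le_Phi]]
        by (subst Top_sum) (auto simp: Top_cmult)
      moreover have "integrable Pi (T (Phi G))" if "G \<in> F" for G
        using HM_le_T[OF HM_le_Phi] HM_le_integrable F that by blast
      ultimately show ?thesis using F integral_T_Phi
        by (simp add: subset_iff)
    qed
    moreover have "(\<integral>\<eta>. f \<eta> \<partial>Pi) = (\<integral>\<eta>. g \<eta> \<partial>Pi) + (\<integral>\<eta>. h \<eta> \<partial>Pi)"
      unfolding sp using HM_le_integrable[OF g] HM_le_integrable[OF h] by (rule Bochner_Integration.integral_add)
    moreover have "(\<integral>\<eta>. T f \<eta> \<partial>Pi) = (\<integral>\<eta>. T g \<eta> \<partial>Pi) + (\<integral>\<eta>. T h \<eta> \<partial>Pi)"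
      unfolding sp Top_add[OF HM_le_bounded[OF g] HM_le_bounded[OF h]]
      using HM_le_integrable[OF Tg] HM_le_integrable[OF Th] by (rule Bochner_Integration.integral_add)
    ultimately show ?thesis
      using abs_integral_Pi_le[OF HM_le_integrable[OF h] hb] abs_integral_Pi_le[OF HM_le_integrable[OF Th] Thb] by linarith
  qed
  then have "\<bar>(\<integral>\<eta>. T f \<eta> \<partial>Pi) - (\<integral>\<eta>. f \<eta> \<partial>Pi)\<bar> \<le> 0" by (rule field_le_epsilon) simp
  then show ?thesis by simp
qed

text \<open>Conditional expectation of \<open>G\<close> of the first \<open>n\<close> observed
  spins, given that the chain starts at \<open>\<eta>\<close>, written as an explicit finite
  combination of values of \<open>W\<close>.\<close>

definition V :: "nat \<Rightarrow> (bool list \<Rightarrow> real) \<Rightarrow> (int list \<Rightarrow> bool) \<Rightarrow> real" where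
  "V n G \<eta> = (\<Sum>v | length v = n. G v * W T z0 (spin_word v) \<eta>)"

lemma W_HM: "\<exists>B. HM_le B (W T z0 (spin_word v))"
proof (induction v)
  case Nil
  have "W T z0 (spin_word []) = (\<lambda>_. 1)" by (simp add: spin_word_def fun_eq_iff)
  then show ?case using HM_le_const[of 1] by metis
next
  case (Cons b v)
  then obtain B where "HM_le B (T (W T z0 (spin_word v)))" using HM_le_T by blast
  from HM_le_indicator[OF this, of b] show ?case
    by (intro exI[of _ "(1 + M) / 2 * B"]) (simp add: spin_word_def)
qed

lemma V_HM: "\<exists>B. HM_le B (V n G)"
  unfolding V_def[abs_def] using W_HM HM_le_cmult by (intro HM_le_sum) (simp, blast)

lemma V_0: "V 0 G \<eta> = G []"
  by (simp add: V_def spin_word_def)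

lemma T_V: "T (V n G) \<eta> = (\<Sum>v | length v = n. G v * T (W T z0 (spin_word v)) \<eta>)"
proof -
  have "bounded_measurable d (\<lambda>\<eta>. G v * W T z0 (spin_word v) \<eta>)" for v
    using W_HM[of v] HM_le_bounded bounded_measurable_cmult by blast
  then show ?thesis unfolding V_def[abs_def] by (subst Top_sum) (auto simp: Top_cmult)
qed

text \<open>Markov property: the first letter is read off \<open>\<eta>\<close>, and one application
  of the operator leads to the remaining \<open>n\<close> letters.\<close>

lemma V_Suc: "V (Suc n) G \<eta> = T (V n (\<lambda>v. G (\<eta> z0 # v))) \<eta>"
proof -
  have "V (Suc n) G \<eta> = (\<Sum>b\<in>UNIV. \<Sum>v | length v = n.
      G (b # v) * ((if \<eta> z0 = b then 1 else 0) * T (W T z0 (spin_word v)) \<eta>))"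
    unfolding V_def sum_lists_Suc by (simp add: spin_word_def)
  also have "\<dots> = (\<Sum>v | length v = n. G (\<eta> z0 # v) * T (W T z0 (spin_word v)) \<eta>)"
    by (cases "\<eta> z0") (simp_all add: UNIV_bool)
  finally show ?thesis by (simp add: T_V)
qed

lemma V_const: "V n (\<lambda>_. k) \<eta> = k"
proof (induction n arbitrary: \<eta>)
  case (Suc n)
  then have "V n (\<lambda>_. k) = (\<lambda>_. k)" by (simp add: fun_eq_iff)
  then show ?case by (simp add: V_Suc Top_const)
qed (simp add: V_0)

lemma V_diff_const: "V n (\<lambda>v. G v - k) \<eta> = V n G \<eta> - k"
proof -
  have "V n (\<lambda>v. G v - k) \<eta> = V n G \<eta> - V n (\<lambda>_. k) \<eta>"
    by (simp add: V_def left_diff_distrib sum_subtractf)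
  then show ?thesis by (simp add: V_const)
qed

lemma integrable_prefix:
  fixes h :: "bool list \<Rightarrow> real"
  shows "integrable wp (\<lambda>w. h (wprefix n w))"
proof -
  have "finite (h ` {v. length v = n})" by simp
  from finite_imp_bounded[OF this] obtain B where B: "\<And>v. length v = n \<Longrightarrow> \<bar>h v\<bar> \<le> B"
    by (auto simp: bounded_iff)
  show ?thesis
  proof (rule wp.integrable_const_bound[where B = B])
    show "AE w in wp. norm (h (wprefix n w)) \<le> B" using B by simp
    show "(\<lambda>w. h (wprefix n w)) \<in> borel_measurable wp"
      using measurable_compose[OF measurable_wprefix, of h borel n]
      by (simp cong: measurable_cong_sets add: sets_wp)
  qed
qed

text \<open>\<open>law_wp\<close> gives the expectations of products of one-spin functions; word
  indicators are such products, and a function of a prefix is a combination of word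
  indicators.\<close>

lemma expectation_wp_eq: "wp.expectation (\<lambda>w. G (wprefix n w)) = (\<integral>\<eta>. V n G \<eta> \<partial>Pi)"
proof -
  define ind where "ind v w = (\<Prod>t<length v. (spin_word v ! t) (w t))" for v and w :: "nat \<Rightarrow> bool"
  have ind: "ind v w = (if wprefix (length v) w = v then 1 else 0)" for v w
  proof (cases "\<forall>t<length v. w t = v ! t")
    case True
    then show ?thesis by (simp add: wprefix_eq_iff ind_def spin_word_def)
  next
    case False
    then have "ind v w = 0" unfolding ind_def by (intro prod_zero) (auto simp: spin_word_def)
    then show ?thesis using False by (simp add: wprefix_eq_iff)
  qed
  have "wp.expectation (\<lambda>w. G (wprefix n w)) = wp.expectation (\<lambda>w. \<Sum>v | length v = n. G v * ind v w)"
  proof (rule Bochner_Integration.integral_cong)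
    fix w
    have "(\<Sum>v | length v = n. G v * ind v w) = (\<Sum>v | length v = n. if v = wprefix n w then G v else 0)"
      by (intro sum.cong) (auto simp: ind)
    then show "G (wprefix n w) = (\<Sum>v | length v = n. G v * ind v w)" by simp
  qed simp
  also have "\<dots> = (\<Sum>v | length v = n. G v * wp.expectation (ind v))"
  proof -
    have "integrable wp (ind v)" for v
      using integrable_prefix[of "\<lambda>u. if u = v then 1 else 0" "length v"] by (simp add: ind[abs_def])
    then show ?thesis by simp
  qed
  also have "\<dots> = (\<Sum>v | length v = n. G v * (\<integral>\<eta>. W T z0 (spin_word v) \<eta> \<partial>Pi))"
  proof -
    have "wp.expectation (ind v) = (\<integral>\<eta>. W T z0 (spin_word v) \<eta> \<partial>Pi)" for v
      using spec[OF law_wp, of "spin_word v"] by (simp add: ind_def[abs_def] spin_word_def)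
    then show ?thesis by simp
  qed
  also have "\<dots> = (\<integral>\<eta>. V n G \<eta> \<partial>Pi)"
  proof -
    have "integrable Pi (W T z0 (spin_word v))" for v using W_HM HM_le_integrable by blast
    then show ?thesis unfolding V_def by simp
  qed
  finally show ?thesis .
qed

text \<open>Read as an expectation under \<open>wp\<close>, the integral averages values of
  \<open>G\<close>, which gives a bound independent of \<open>n\<close>.\<close>

lemma abs_integral_V_le:
  assumes "\<And>v. \<bar>G v\<bar> \<le> 1" shows "\<bar>\<integral>\<eta>. V n G \<eta> \<partial>Pi\<bar> \<le> 1"
proof -
  have "\<bar>wp.expectation (\<lambda>w. G (wprefix n w))\<bar> \<le> wp.expectation (\<lambda>w. \<bar>G (wprefix n w)\<bar>)"
    by (rule integral_abs_bound)
  also have "\<dots> \<le> 1"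
    using assms by (intro wp.integral_le_const integrable_abs integrable_prefix) auto
  finally show ?thesis by (simp add: expectation_wp_eq)
qed

lemma centered:
  assumes "HM_le B f" "k = (\<integral>\<eta>. f \<eta> \<partial>Pi)"
  shows "HM_le (B + \<bar>k\<bar>) (\<lambda>\<eta>. f \<eta> - k)" "(\<integral>\<eta>. f \<eta> - k \<partial>Pi) = 0"
  using HM_le_add[OF assms(1) HM_le_const[of "- k"]] HM_le_integrable[OF assms(1)] assms(2)
  by (simp_all add: Pi.prob_space)

text \<open>Centering before each application of the transition operator makes the recursion in \<open>n\<close>
  contracting, so the bound does not depend on \<open>n\<close>.\<close>

lemma V_HM_le:
  assumes "\<And>v. \<bar>G v\<bar> \<le> 1" shows "HM_le (2 * M + 3) (V n G)"
  using assms
proof (induction n arbitrary: G)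
  case 0
  have "V 0 G = (\<lambda>_. G [])" by (simp add: V_0 fun_eq_iff)
  then show ?case using HM_le_mono[OF HM_le_const[of "G []"], of "2 * M + 3"] M 0[of "[]"] by simp
next
  case (Suc n)
  define f where "f b = V n (\<lambda>v. G (b # v))" for b
  have Tf: "HM_le (mubar * (2 * M + 4) + 1) (T (f b))" for b
  proof -
    have f: "HM_le (2 * M + 3) (f b)" unfolding f_def by (rule Suc)+
    define k where "k = (\<integral>\<eta>. f b \<eta> \<partial>Pi)"
    have k: "\<bar>k\<bar> \<le> 1" unfolding k_def f_def by (rule abs_integral_V_le) (rule Suc)
    have "HM_le (2 * M + 4) (\<lambda>\<eta>. f b \<eta> - k)"
      by (rule HM_le_mono[OF centered(1)[OF f k_def]]) (use k in simp)
    from HM_le_T_centered[OF this centered(2)[OF f k_def]]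
    have "HM_le (mubar * (2 * M + 4) + \<bar>k\<bar>) (\<lambda>\<eta>. T (\<lambda>\<eta>. f b \<eta> - k) \<eta> + k)"
      by (rule HM_le_add[OF _ HM_le_const])
    then have "HM_le (mubar * (2 * M + 4) + 1) (\<lambda>\<eta>. T (\<lambda>\<eta>. f b \<eta> - k) \<eta> + k)"
      by (rule HM_le_mono) (use k in simp)
    moreover have "T (\<lambda>\<eta>. f b \<eta> - k) \<eta> + k = T (f b) \<eta>" for \<eta>
      using Top_add_const[OF HM_le_bounded[OF f], of "- k"] by simp
    ultimately show ?thesis by simp
  qed
  have "HM_le ((1 + M) / 2 * (mubar * (2 * M + 4) + 1) + (1 + M) / 2 * (mubar * (2 * M + 4) + 1))
     (\<lambda>\<eta>. (if \<eta> z0 = True then 1 else 0) * T (f True) \<eta> + (if \<eta> z0 = False then 1 else 0) * T (f False) \<eta>)"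
    by (intro HM_le_add HM_le_indicator Tf)
  \<comment> \<open>This fixes the constant: as \<open>mubar * (1 + M) \<le> 1 / 2\<close>, the
    centered part contributes at most \<open>M + 2\<close> and the mean \<open>1 + M\<close>,
    together \<open>2 * M + 3\<close>.\<close>
  moreover have "(1 + M) / 2 * (mubar * (2 * M + 4) + 1) + (1 + M) / 2 * (mubar * (2 * M + 4) + 1) \<le> 2 * M + 3"
    using mult_right_mono[OF mubar(3), of "2 * M + 4"] M by (simp add: algebra_simps)
  ultimately have "HM_le (2 * M + 3)
     (\<lambda>\<eta>. (if \<eta> z0 = True then 1 else 0) * T (f True) \<eta> + (if \<eta> z0 = False then 1 else 0) * T (f False) \<eta>)"
    by (rule HM_le_mono)
  then show ?case
    by (rule HM_le_cong) (auto simp: V_Suc f_def)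
qed

text \<open>Ignoring one more initial spin amounts to one application of the operator. Invariance
  keeps the mean at zero, which each contraction step requires, so both claims are proved together.
  The constant is \<open>2 * M + 3\<close> plus 1 for the mean \<open>e\<close>.\<close>

lemma V_drop_decay:
  assumes G: "\<And>v. \<bar>G v\<bar> \<le> 1" and e: "e = (\<integral>\<eta>. V m G \<eta> \<partial>Pi)"
  shows "HM_le (mubar ^ k * (2 * M + 4)) (\<lambda>\<eta>. V (k + m) (\<lambda>v. G (drop k v)) \<eta> - e)
    \<and> (\<integral>\<eta>. V (k + m) (\<lambda>v. G (drop k v)) \<eta> - e \<partial>Pi) = 0"
proof (induction k)
  case 0
  have "\<bar>e\<bar> \<le> 1" unfolding e by (rule abs_integral_V_le[OF G])
  then show ?case
    using centered[OF V_HM_le[OF G] e] HM_le_mono[of _ "\<lambda>\<eta>. V m G \<eta> - e" "2 * M + 4"] by simp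
next
  case (Suc k)
  let ?f = "V (k + m) (\<lambda>v. G (drop k v))"
  obtain B where B: "HM_le B ?f" using V_HM by blast
  have eq: "V (Suc k + m) (\<lambda>v. G (drop (Suc k) v)) \<eta> - e = T (\<lambda>\<eta>. ?f \<eta> - e) \<eta>" for \<eta>
    using Top_add_const[OF HM_le_bounded[OF B], of "- e"] by (simp add: V_Suc)
  show ?case
    unfolding eq
    using HM_le_T_centered[OF conjunct1[OF Suc.IH] conjunct2[OF Suc.IH]]
      integral_T[OF conjunct1[OF Suc.IH]] conjunct2[OF Suc.IH]
    by (simp add: mult.assoc)
qed

text \<open>Multiplication by \<open>F\<close>, bounded by 1, and averaging by the operator both
  preserve a uniform bound, so the length \<open>n\<close> of the past costs nothing.\<close>

lemma V_take_le:
  assumes F: "\<And>v. \<bar>F v\<bar> \<le> 1" and B: "\<And>\<eta>. \<eta> \<in> space (OmegaM d) \<Longrightarrow> \<bar>V l G \<eta>\<bar> \<le> B"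
    and \<eta>: "\<eta> \<in> space (OmegaM d)"
  shows "\<bar>V (n + l) (\<lambda>v. F (take n v) * G (drop n v)) \<eta>\<bar> \<le> B"
  using F \<eta>
proof (induction n arbitrary: F \<eta>)
  case 0
  have "V l (\<lambda>v. F [] * G v) \<eta> = F [] * V l G \<eta>"
    by (simp add: V_def sum_distrib_left mult.assoc)
  moreover have "\<bar>F [] * V l G \<eta>\<bar> \<le> 1 * B"
    unfolding abs_mult using 0 B[of \<eta>] by (intro mult_mono) auto
  ultimately show ?case by simp
next
  case (Suc n)
  let ?f = "V (n + l) (\<lambda>v. F (\<eta> z0 # take n v) * G (drop n v))"
  have "\<bar>T ?f \<eta>\<bar> \<le> B"
  proof (rule Top_abs_le)
    show "?f \<in> borel_measurable (OmegaM d)" using V_HM HM_le_measurable by blast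
    show "\<bar>?f \<eta>'\<bar> \<le> B" if "\<eta>' \<in> space (OmegaM d)" for \<eta>'
      using Suc.prems that by (intro Suc.IH[of "\<lambda>v. F (\<eta> z0 # v)"]) auto
  qed
  then show ?case by (simp add: V_Suc)
qed

section \<open>Mixing and shift invariance of the law of the observed spins\<close>

lemma wprefix_shift: "wprefix m ((Sshift ^^ k) w) = drop k (wprefix (k + m) w)"
  by (simp add: wprefix_def Sshift_pow drop_map list_eq_iff_nth_eq)

lemma take_wprefix: "take n (wprefix (n + m) w) = wprefix n w"
  by (simp add: wprefix_def take_map)

text \<open>With the future centered, the covariance is the expectation of a single function
  \<open>H\<close> of a prefix: \<open>V_drop_decay\<close> makes its part after time
  \<open>n\<close> small, and \<open>V_take_le\<close> carries that bound through the past.\<close>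

lemma mixing_wp:
  fixes F G :: "bool list \<Rightarrow> real"
  assumes F: "\<And>v. \<bar>F v\<bar> \<le> 1" and G: "\<And>v. \<bar>G v\<bar> \<le> 1"
  shows "\<bar>wp.expectation (\<lambda>w. F (wprefix n w) * G (wprefix m ((Sshift ^^ (n + k)) w)))
      - wp.expectation (\<lambda>w. F (wprefix n w)) * wp.expectation (\<lambda>w. G (wprefix m w))\<bar>
    \<le> (2 * M + 4) * mubar ^ k"
proof -
  define e where "e = (\<integral>\<eta>. V m G \<eta> \<partial>Pi)"
  define H where "H v = F (take n v) * (G (drop k (drop n v)) - e)" for v
  have "\<bar>V (k + m) (\<lambda>v. G (drop k v) - e) \<eta>\<bar> \<le> mubar ^ k * (2 * M + 4)" if "\<eta> \<in> space (OmegaM d)" for \<eta>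
    using HM_le_abs[OF conjunct1[OF V_drop_decay[OF G e_def]] that] by (simp add: V_diff_const)
  from V_take_le[OF F this]
  have b: "\<bar>V (n + (k + m)) H \<eta>\<bar> \<le> mubar ^ k * (2 * M + 4)" if "\<eta> \<in> space (OmegaM d)" for \<eta>
    using that by (simp add: H_def[abs_def])
  have HH: "H (wprefix (n + (k + m)) w) = F (wprefix n w) * G (wprefix m ((Sshift ^^ (n + k)) w)) - e * F (wprefix n w)" for w
  proof -
    have "drop k (drop n (wprefix (n + (k + m)) w)) = wprefix m ((Sshift ^^ (n + k)) w)"
      using wprefix_shift[of m "n + k" w] by (simp add: ac_simps)
    then show ?thesis by (simp add: H_def take_wprefix right_diff_distrib mult.commute)
  qed
  have i: "integrable wp (\<lambda>w. F (wprefix n w) * G (wprefix m ((Sshift ^^ (n + k)) w)))"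
    using integrable_prefix[of "\<lambda>v. F (take n v) * G (drop (n + k) v)" "n + (k + m)"]
    by (simp add: take_wprefix wprefix_shift add.assoc)
  have "wp.expectation (\<lambda>w. F (wprefix n w) * G (wprefix m ((Sshift ^^ (n + k)) w))) - e * wp.expectation (\<lambda>w. F (wprefix n w))
      = wp.expectation (\<lambda>w. H (wprefix (n + (k + m)) w))"
    unfolding HH using i integrable_prefix by simp
  also have "\<dots> = (\<integral>\<eta>. V (n + (k + m)) H \<eta> \<partial>Pi)" by (rule expectation_wp_eq)
  also have "\<bar>\<dots>\<bar> \<le> mubar ^ k * (2 * M + 4)"
  proof -
    obtain B where B: "HM_le B (V (n + (k + m)) H)" using V_HM by blast
    show ?thesis by (rule abs_integral_Pi_le[OF HM_le_integrable[OF B] b])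
  qed
  finally show ?thesis by (simp add: e_def expectation_wp_eq mult.commute)
qed

text \<open>Discarding the first spin is one application of the operator, which leaves integrals
  against the invariant measure unchanged.\<close>

lemma expectation_prefix_shift:
  fixes G :: "bool list \<Rightarrow> real"
  shows "wp.expectation (\<lambda>w. G (wprefix n (Sshift w))) = wp.expectation (\<lambda>w. G (wprefix n w))"
proof -
  obtain B where B: "HM_le B (V n G)" using V_HM by blast
  have "wp.expectation (\<lambda>w. G (wprefix n (Sshift w))) = wp.expectation (\<lambda>w. G (tl (wprefix (Suc n) w)))"
    using wprefix_shift[of n 1] by (simp add: drop_Suc)
  also have "\<dots> = (\<integral>\<eta>. V (Suc n) (\<lambda>v. G (tl v)) \<eta> \<partial>Pi)" by (rule expectation_wp_eq)
  also have "\<dots> = (\<integral>\<eta>. T (V n G) \<eta> \<partial>Pi)" by (simp add: V_Suc)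
  also have "\<dots> = wp.expectation (\<lambda>w. G (wprefix n w))"
    by (simp add: integral_T[OF B] expectation_wp_eq)
  finally show ?thesis .
qed

end

text \<open>If no + spin occurs from time \<open>N\<close> on, none occurs at \<open>j\<close>
  sampled times either. With spacing \<open>k + 1\<close> the samples are nearly independent, so the
  probability is at most \<open>q ^ j\<close> plus \<open>j\<close> mixing errors; \<open>k\<close>
  tends to infinity for fixed \<open>j\<close>, and then \<open>j\<close> does.\<close>

lemma (in mixing_sequence) AE_not_eventually_False:
  assumes pos: "0 < expectation (\<lambda>w. if w 0 then 1 else 0 :: real)"
  shows "AE w in P. w \<in> Oreg"
proof -
  define h :: "(nat \<Rightarrow> bool) \<Rightarrow> real" where "h w = (if w 0 then 0 else 1)" for w
  have h: "cylindrical 1 h" "\<bar>h w\<bar> \<le> 1" for w by (auto simp: h_def cylindrical_def)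
  have [measurable]: "h \<in> borel_measurable P" by (rule cylindrical_measurable[OF h(1)])
  have hint: "integrable P h" using h by (intro integrable_const_bound[where B = 1]) auto
  define q where "q = expectation h"
  have "expectation (\<lambda>w. if w 0 then 1 else 0 :: real) = expectation (\<lambda>w. 1 - h w)"
    by (rule Bochner_Integration.integral_cong) (auto simp: h_def)
  also have "\<dots> = 1 - q" using hint prob_space by (simp add: q_def)
  finally have q1: "q < 1" using pos by linarith
  have q0: "0 \<le> q" unfolding q_def by (rule Bochner_Integration.integral_nonneg) (simp add: h_def)
  have null: "AE w in P. \<exists>t\<ge>N. w t" for N
  proof -
    \<comment> \<open>The first \<open>j\<close> samples use coordinates below
      \<open>N + j * Suc k\<close>, and the next sample comes \<open>k\<close> coordinates after
      that bound, which is the gap that mixing sees.\<close>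
    define A where "A k j w = (\<Prod>i<j. h ((Sshift ^^ (N + k + i * Suc k)) w))" for k j and w :: "nat \<Rightarrow> bool"
    have A01: "0 \<le> A k j w \<and> A k j w \<le> 1" for k j w
      unfolding A_def by (auto intro!: prod_nonneg prod_le_1 simp: h_def)
    have cA: "cylindrical (N + j * Suc k) (A k j)" for k j
      unfolding cylindrical_def A_def
    proof (intro allI impI prod.cong refl)
      fix w w' :: "nat \<Rightarrow> bool" and i assume *: "\<forall>t<N + j * Suc k. w t = w' t" "i \<in> {..<j}"
      then have "Suc i * Suc k \<le> j * Suc k" by (intro mult_le_mono1) auto
      then have "N + k + i * Suc k < N + j * Suc k" by simp
      then show "h ((Sshift ^^ (N + k + i * Suc k)) w) = h ((Sshift ^^ (N + k + i * Suc k)) w')"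
        using * by (simp add: h_def Sshift_pow del: mult_Suc_right)
    qed
    have [measurable]: "A k j \<in> borel_measurable P" for k j by (rule cylindrical_measurable[OF cA])
    have iA: "integrable P (A k j)" for k j
      using A01 by (intro integrable_const_bound[where B = 1]) auto
    have step: "expectation (A k j) \<le> q ^ j + real j * (C * \<theta> ^ k)" for k j
    proof (induction j)
      case (Suc j)
      have "A k (Suc j) = (\<lambda>w. A k j w * h ((Sshift ^^ (N + j * Suc k + k)) w))"
        by (simp add: A_def fun_eq_iff ac_simps del: mult_Suc_right)
      then have "\<bar>expectation (A k (Suc j)) - expectation (A k j) * q\<bar> \<le> C * \<theta> ^ k"
        using mixing_cylindrical[OF cA _ h(1) h(2), of k j k] A01 by (simp add: q_def del: mult_Suc_right)
      then have "expectation (A k (Suc j)) \<le> expectation (A k j) * q + C * \<theta> ^ k" by linarith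
      also have "\<dots> \<le> (q ^ j + real j * (C * \<theta> ^ k)) * q + C * \<theta> ^ k"
        using Suc q0 by (intro add_right_mono mult_right_mono)
      also have "\<dots> \<le> q ^ Suc j + real (Suc j) * (C * \<theta> ^ k)"
      proof -
        have "real j * (C * \<theta> ^ k) * q \<le> real j * (C * \<theta> ^ k)"
          using q1 q0 C_nonneg theta by (intro mult_left_le) auto
        then show ?thesis by (simp add: algebra_simps)
      qed
      finally show ?case .
    qed (use prob_space in \<open>simp add: A_def\<close>)
    define B where "B = {w. \<forall>t\<ge>N. \<not> w t}"
    have B: "B \<in> sets P"
    proof -
      have "{w \<in> space OmegaPlus. \<forall>t\<ge>N. \<not> w t} \<in> sets OmegaPlus"
        unfolding OmegaPlus_def by measurable
      then show ?thesis by (simp add: B_def sets_P OmegaPlus_def space_PiM)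
    qed
    have le: "prob B \<le> q ^ j + real j * (C * \<theta> ^ k)" for k j
    proof -
      have "prob B = expectation (indicator B)" using B by simp
      also have "\<dots> \<le> expectation (A k j)"
      proof (rule integral_mono)
        show "integrable P (indicat_real B)"
          using B by (intro integrable_const_bound[where B = 1]) auto
        show "indicator B w \<le> A k j w" for w
        proof (cases "w \<in> B")
          case True
          then have "A k j w = 1" by (simp add: A_def h_def B_def Sshift_pow)
          then show ?thesis using True by simp
        qed (use A01 in auto)
      qed (rule iA)
      also have "\<dots> \<le> q ^ j + real j * (C * \<theta> ^ k)" by (rule step)
      finally show ?thesis .
    qed
    have lej: "prob B \<le> q ^ j" for j
    proof (rule LIMSEQ_le_const)
      have "(\<lambda>k. q ^ j + real j * (C * \<theta> ^ k)) \<longlonglongrightarrow> q ^ j + real j * (C * 0)"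
        by (intro tendsto_intros) (use theta in auto)
      then show "(\<lambda>k. q ^ j + real j * (C * \<theta> ^ k)) \<longlonglongrightarrow> q ^ j" by simp
    qed (use le in auto)
    have "prob B \<le> 0"
      by (rule LIMSEQ_le_const[OF LIMSEQ_realpow_zero[OF q0 q1]]) (use lej in auto)
    then have "prob B = 0" using measure_nonneg[of P B] by linarith
    then have "AE w in P. w \<notin> B" using B by (simp add: prob_eq_0)
    then show ?thesis by (simp add: B_def)
  qed
  have "AE w in P. \<forall>N. \<exists>t\<ge>N. w t" using null by (simp add: AE_all_countable)
  then show ?thesis by (simp add: Oreg_def)
qed

section \<open>Stationarity of the observed spins and positivity of + spins\<close>

context rw_chain
begin

text \<open>Rectangles over finitely many times determine the measure, and the indicator of a
  rectangle is a function of a finite prefix, for which shift invariance is known.\<close>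

lemma stationary_wp: "distr wp wp Sshift = wp"
proof -
  have meas: "Sshift \<in> measurable wp wp"
    using measurable_Sshift by (simp cong: measurable_cong_sets add: sets_wp)
  show ?thesis
  proof (rule measure_eqI_PiM_infinite[where I = UNIV and M = "\<lambda>_. count_space UNIV"])
    show "finite_measure (distr wp wp Sshift)"
      by (intro prob_space.finite_measure wp.prob_space_distr meas)
    show "sets (distr wp wp Sshift) = sets (PiM UNIV (\<lambda>_. count_space UNIV))"
      by (simp add: sets_wp OmegaPlus_def)
    show "sets wp = sets (PiM UNIV (\<lambda>_. count_space UNIV))"
      by (simp add: sets_wp OmegaPlus_def)
    fix A :: "nat \<Rightarrow> bool set" and J :: "nat set"
    assume J: "finite J" "J \<subseteq> UNIV"
    define E where "E = prod_emb UNIV (\<lambda>_. count_space UNIV :: bool measure) J (Pi\<^sub>E J A)"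
    have E: "E = {w. \<forall>i\<in>J. w i \<in> A i}"
      by (auto simp: E_def prod_emb_def restrict_PiE_iff)
    have EP: "E \<in> sets wp" unfolding E_def sets_wp OmegaPlus_def
      using J by (intro sets_PiM_I) auto
    obtain n where n: "\<And>i. i \<in> J \<Longrightarrow> i < n"
      using J(1) by (metis finite_nat_iff_bounded lessThan_iff subsetD)
    define G :: "bool list \<Rightarrow> real" where "G v = (if \<forall>i\<in>J. v ! i \<in> A i then 1 else 0)" for v
    have ind: "indicator E w = G (wprefix n w)" for w
      using n by (auto simp: G_def E wprefix_def indicator_def)
    have "measure (distr wp wp Sshift) E = (\<integral>w. indicator E w \<partial>distr wp wp Sshift)"
      using EP by simp
    also have "\<dots> = wp.expectation (\<lambda>w. G (wprefix n (Sshift w)))"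
      using meas EP by (subst integral_distr) (auto simp: ind)
    also have "\<dots> = wp.expectation (indicator E)"
      by (simp add: expectation_prefix_shift ind[abs_def])
    also have "\<dots> = measure wp E" using EP by simp
    finally have "measure (distr wp wp Sshift) E = measure wp E" .
    moreover have "finite_measure (distr wp wp Sshift)"
      by (intro prob_space.finite_measure wp.prob_space_distr meas)
    ultimately show "emeasure (distr wp wp Sshift) (prod_emb UNIV (\<lambda>_. count_space UNIV) J (Pi\<^sub>E J A))
        = emeasure wp (prod_emb UNIV (\<lambda>_. count_space UNIV) J (Pi\<^sub>E J A))"
      by (simp add: E_def finite_measure.emeasure_eq_measure wp.emeasure_eq_measure)
  qed
qed

lemma mixing_sequence_wp: "mixing_sequence wp (2 * M + 4) mubar"
proof
  show "sets wp = sets OmegaPlus" by (rule sets_wp)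
  show "distr wp wp Sshift = wp" by (rule stationary_wp)
qed (use mubar mixing_wp in auto)

text \<open>Each jump has probability below 1, so some \<open>u\<close> other than the origin is
  reached with positive probability. The spin found there was refreshed by \<open>Q0\<close>, which
  gives \<open>True\<close> with positive probability; staying at the origin would involve
  \<open>Q1\<close> instead. Hence \<open>T g\<close> is strictly positive everywhere, and
  invariance transfers this to time 0.\<close>

lemma plus_spin_pos:
  assumes Q0: "\<And>a b. 0 \<le> Q0 a b" "\<And>a. Q0 a True + Q0 a False = 1" and pos: "\<And>a. 0 < Q0 a True"
  shows "0 < wp.expectation (\<lambda>w. if w 0 then 1 else 0 :: real)"
proof -
  define g :: "(int list \<Rightarrow> bool) \<Rightarrow> real" where "g \<eta> = (if \<eta> z0 then 1 else 0)" for \<eta>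
  define G :: "bool list \<Rightarrow> real" where "G v = (if hd v then 1 else 0)" for v
  have V1: "V 1 G = g"
  proof
    fix \<eta>
    have "V 0 (\<lambda>v. G (\<eta> z0 # v)) = (\<lambda>_. g \<eta>)" by (simp add: fun_eq_iff V_0 G_def g_def)
    then show "V 1 G \<eta> = g \<eta>" using V_Suc[of 0 G \<eta>] by (simp add: Top_const)
  qed
  obtain B where g: "HM_le B g" using V_HM[of 1 G] V1 by auto
  obtain B' where Tg: "HM_le B' (T g)" using HM_le_T[OF g] by blast
  have Tpos: "0 < T g \<eta>" for \<eta>
  proof -
    let ?E = "ENV d Q0 Q1 \<eta>"
    interpret E: prob_space ?E by (rule prob_space_ENV)
    have int0: "0 \<le> (\<integral>\<xi>. g (shift d u \<xi>) \<partial>?E)" for u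
      by (rule Bochner_Integration.integral_nonneg) (simp add: g_def)
    have "\<exists>u\<in>steps. u \<noteq> z0 \<and> 0 < jmp \<eta> u"
    proof (rule ccontr)
      assume "\<not> ?thesis"
      then have "jmp \<eta> u = 0" if "u \<in> steps - {z0}" for u
        using that jump_bounds[of u \<eta>] steps by force
      then have "(\<Sum>u\<in>steps. jmp \<eta> u) = (\<Sum>u\<in>steps \<inter> {z0}. jmp \<eta> u)"
        using steps by (intro sum.mono_neutral_right) auto
      also have "\<dots> < 1" using jump_bounds[of z0 \<eta>] by (cases "z0 \<in> steps") auto
      finally show False using sum_jump[of \<eta>] by simp
    qed
    then obtain u where u: "u \<in> steps" "u \<noteq> z0" "0 < jmp \<eta> u" by blast
    have us: "u \<in> sites d" using u steps by auto
    let ?M = "\<lambda>z. measure_pmf (qpmf (if z = z0 then Q1 else Q0) (\<eta> z))"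
    have "measure (?M u) {True} = Q0 (\<eta> u) True"
    proof -
      have "(\<integral>\<^sup>+b. ennreal (Q0 (\<eta> u) b) \<partial>count_space UNIV) = 1"
        using Q0 by (simp add: nn_integral_count_space_finite UNIV_bool flip: ennreal_plus)
          (metis add.commute ennreal_1)
      then have "pmf (embed_pmf (Q0 (\<eta> u))) True = Q0 (\<eta> u) True"
        using Q0 by (intro pmf_embed_pmf) auto
      then show ?thesis using u by (simp add: qpmf_def measure_pmf_single)
    qed
    moreover have "measure (?M u) {True} = measure (distr ?E (?M u) (\<lambda>\<xi>. \<xi> u)) {True}"
      unfolding ENV_def using us
      by (subst distr_PiM_component) (auto simp: measure_pmf.prob_space_axioms)
    moreover have "\<dots> = (\<integral>\<xi>. g (shift d u \<xi>) \<partial>?E)"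
    proof -
      have m: "(\<lambda>\<xi>. \<xi> u) \<in> measurable ?E (?M u)"
        unfolding ENV_def using us by (rule measurable_component_singleton)
      have "measure (distr ?E (?M u) (\<lambda>\<xi>. \<xi> u)) {True} = (\<integral>b. indicator {True} b \<partial>distr ?E (?M u) (\<lambda>\<xi>. \<xi> u))"
        by simp
      also have "\<dots> = (\<integral>\<xi>. indicator {True} (\<xi> u) \<partial>?E)"
        by (rule integral_distr[OF m]) simp
      also have "\<dots> = (\<integral>\<xi>. g (shift d u \<xi>) \<partial>?E)"
        using us by (intro Bochner_Integration.integral_cong) (auto simp: g_def shift_def vadd_zerov)
      finally show ?thesis .
    qed
    ultimately have "0 < (\<integral>\<xi>. g (shift d u \<xi>) \<partial>?E)" using pos by metis
    then have "0 < jmp \<eta> u * (\<integral>\<xi>. g (shift d u \<xi>) \<partial>?E)" using u by simp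
    also have "\<dots> \<le> T g \<eta>"
      unfolding Top_eq_sum using u steps int0 jump_bounds
      by (intro member_le_sum) (auto intro!: mult_nonneg_nonneg)
    finally show ?thesis .
  qed
  have "(\<integral>\<eta>. T g \<eta> \<partial>Pi) \<noteq> 0"
  proof
    assume "(\<integral>\<eta>. T g \<eta> \<partial>Pi) = 0"
    then have "AE \<eta> in Pi. T g \<eta> = 0"
      using integral_nonneg_eq_0_iff_AE[OF HM_le_integrable[OF Tg]] Tpos by (simp add: less_imp_le)
    then have "AE \<eta> in Pi. False" by eventually_elim (use Tpos in \<open>metis less_irrefl\<close>)
    then show False by simp
  qed
  moreover have "0 \<le> (\<integral>\<eta>. T g \<eta> \<partial>Pi)" using Tpos by (intro Bochner_Integration.integral_nonneg) (simp add: less_imp_le)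
  moreover have "(\<integral>\<eta>. T g \<eta> \<partial>Pi) = wp.expectation (\<lambda>w. if w 0 then 1 else 0)"
    using expectation_wp_eq[of G 1] by (simp add: integral_T[OF g] V1[simplified] G_def wprefix_def)
  ultimately show ?thesis by linarith
qed

end

text \<open>An eigenvector of a symmetric stochastic matrix for an eigenvalue other than 1 is
  orthogonal to the constants, hence a multiple of (1, -1). So \<open>mu\<close> is the difference
  of the two entries of a row, whose sum is 1, and they equal (1 + mu) / 2 and (1 - mu) / 2.\<close>

lemma sym_stoch_pos:
  assumes Q: "sym_stoch Q" and mu: "is_eigenvalue2 Q mu" "\<bar>mu\<bar> < 1"
  shows "0 < Q a b"
proof -
  obtain v :: "bool \<Rightarrow> real" where v: "v \<noteq> (\<lambda>_. 0)" "\<And>a. (\<Sum>b\<in>UNIV. Q a b * v b) = mu * v a"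
    using mu(1) unfolding is_eigenvalue2_def by blast
  have Q': "Q False True = Q True False" "Q True True + Q True False = 1" "Q False True + Q False False = 1"
     "0 \<le> Q True True" "0 \<le> Q True False"
    using Q unfolding sym_stoch_def by metis+
  then have Q'': "Q False False = Q True True" by linarith
  have 1: "Q True True * v True + Q True False * v False = mu * v True"
      "Q True False * v True + Q True True * v False = mu * v False"
    using v(2)[of True] v(2)[of False] by (simp_all add: UNIV_bool Q'(1) Q'' add.commute)
  have "(1 - mu) * (v True + v False) = 0"
  proof -
    have "(Q True True + Q True False) * (v True + v False) = mu * (v True + v False)"
      using 1 by (simp add: algebra_simps)
    then show ?thesis by (simp only: Q'(2) left_diff_distrib mult_1)
  qed
  then have 2: "v False = - v True" using mu(2) by auto
  then have vT: "v True \<noteq> 0" using v(1) by (auto simp: fun_eq_iff) (metis (full_types))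
  have "(Q True True - Q True False) * v True = mu * v True" using 1(1) 2 by (simp add: algebra_simps)
  then have "Q True True - Q True False = mu" using vT by simp
  then have "0 < Q True True" "0 < Q True False" using Q' mu(2) by linarith+
  then show ?thesis using Q'(1) Q'' by (cases a; cases b) auto
qed

section \<open>The torus map and Hoelder observables\<close>

definition digit :: "(nat \<Rightarrow> bool) \<Rightarrow> nat \<Rightarrow> real" where
  "digit w t = (if w t then 0 else 1) / 2 ^ (t + 1)"

lemma Fmap_eq: "Fmap w = (\<Sum>t. digit w t)"
  by (simp add: Fmap_def digit_def)

lemma half_sums: "(\<lambda>t. 1 / 2 ^ (t + 1) :: real) sums 1"
  using power_half_series by (simp add: power_one_over)

lemma summable_digit: "summable (digit w)"
  by (rule summable_comparison_test'[OF sums_summable[OF half_sums]]) (simp add: digit_def)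

lemma Fmap_nonneg: "0 \<le> Fmap w"
  unfolding Fmap_eq by (intro suminf_nonneg summable_digit) (simp add: digit_def)

lemma Fmap_le_1: "Fmap w \<le> 1"
proof -
  have "Fmap w \<le> (\<Sum>t. 1 / 2 ^ (t + 1))"
    unfolding Fmap_eq
    by (intro suminf_le summable_digit sums_summable[OF half_sums]) (simp add: digit_def)
  then show ?thesis using sums_unique[OF half_sums] by simp
qed

lemma Fmap_less_1:
  assumes "w \<in> Oreg" shows "Fmap w < 1"
proof -
  obtain t where t: "w t" using assms by (auto simp: Oreg_def)
  have "(\<lambda>t. 1 / 2 ^ (t + 1) - digit w t) sums (1 - Fmap w)"
    unfolding Fmap_eq by (intro sums_diff half_sums summable_sums summable_digit)
  moreover have "0 < (\<Sum>t. 1 / 2 ^ (t + 1) - digit w t)"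
    using calculation t by (intro suminf_pos2[where i = t]) (auto simp: digit_def dest: sums_summable)
  ultimately show ?thesis by (simp add: sums_iff)
qed

text \<open>Self-similarity of the binary expansion: the tail after \<open>n\<close> digits is the
  value of the shifted sequence at scale 2^-n.\<close>

lemma Fmap_split: "Fmap w = (\<Sum>t<n. digit w t) + Fmap ((Sshift ^^ n) w) / 2 ^ n"
proof -
  have "digit w (t + n) = digit ((Sshift ^^ n) w) t / 2 ^ n" for t
    by (simp add: digit_def Sshift_pow power_add add.commute)
  then have "(\<Sum>t. digit w (t + n)) = Fmap ((Sshift ^^ n) w) / 2 ^ n"
    unfolding Fmap_eq by (simp add: suminf_divide[OF summable_digit])
  then show ?thesis
    unfolding Fmap_eq[of w] by (subst suminf_split_initial_segment[OF summable_digit, of w n]) simp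
qed

lemma Fmap_close:
  assumes "\<And>i. i < n \<Longrightarrow> w i = w' i"
  shows "\<bar>Fmap w - Fmap w'\<bar> \<le> 1 / 2 ^ n"
proof -
  have "(\<Sum>t<n. digit w t) = (\<Sum>t<n. digit w' t)"
    using assms by (intro sum.cong) (auto simp: digit_def)
  then have "Fmap w - Fmap w' = (Fmap ((Sshift ^^ n) w) - Fmap ((Sshift ^^ n) w')) / 2 ^ n"
    using Fmap_split[of w n] Fmap_split[of w' n] by (simp add: diff_divide_distrib)
  moreover have "\<bar>Fmap ((Sshift ^^ n) w) - Fmap ((Sshift ^^ n) w')\<bar> \<le> 1"
    using Fmap_nonneg[of "(Sshift ^^ n) w"] Fmap_le_1[of "(Sshift ^^ n) w"]
      Fmap_nonneg[of "(Sshift ^^ n) w'"] Fmap_le_1[of "(Sshift ^^ n) w'"] by linarith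
  ultimately show ?thesis by (simp add: divide_right_mono)
qed

lemma Oreg_iff: "w \<in> Oreg \<longleftrightarrow> (\<forall>N. \<exists>t\<ge>N. w t)"
  by (simp add: Oreg_def)

lemma Oreg_shift:
  assumes "w \<in> Oreg" shows "(Sshift ^^ n) w \<in> Oreg"
  unfolding Oreg_iff
proof
  fix N
  obtain t where "n + N \<le> t" "w t" using assms unfolding Oreg_iff by blast
  then show "\<exists>t\<ge>N. (Sshift ^^ n) w t"
    by (intro exI[of _ "t - n"]) (simp add: Sshift_pow)
qed

text \<open>A + spin is the binary digit 0, so at the first difference \<open>w\<close> has the
  smaller digit. Its tail stays strictly below the maximal value because \<open>w\<close> is not
  eventually -1; this separates the two expansions of a dyadic point.\<close>

lemma Fmap_less:
  assumes w: "w \<in> Oreg" and eq: "\<And>i. i < n \<Longrightarrow> w i = w' i" and n: "w n" "\<not> w' n"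
  shows "Fmap w < Fmap w'"
proof -
  have s: "(\<Sum>t<n. digit w t) = (\<Sum>t<n. digit w' t)"
    using eq by (intro sum.cong) (auto simp: digit_def)
  have "Fmap w < (\<Sum>t<n. digit w t) + 1 / 2 ^ Suc n"
    using Fmap_split[of w "Suc n"] Fmap_less_1[OF Oreg_shift[OF w, of "Suc n"]] n
    by (simp add: digit_def divide_strict_right_mono del: funpow.simps)
  also have "\<dots> \<le> Fmap w'"
    using Fmap_split[of w' "Suc n"] Fmap_nonneg[of "(Sshift ^^ Suc n) w'"] n s
    by (simp add: digit_def del: funpow.simps)
  finally show ?thesis .
qed

lemma inj_on_Fmap: "inj_on Fmap Oreg"
proof (rule inj_onI, rule ccontr)
  fix w w' assume w: "w \<in> Oreg" "w' \<in> Oreg" and eq: "Fmap w = Fmap w'" and "w \<noteq> w'"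
  then obtain m where m: "w m \<noteq> w' m" by blast
  define n where "n = (LEAST n. w n \<noteq> w' n)"
  have n: "w n \<noteq> w' n" unfolding n_def using m by (rule LeastI)
  have lt: "w i = w' i" if "i < n" for i using not_less_Least[of i] that unfolding n_def by blast
  show False
    using Fmap_less[OF w(1) lt] Fmap_less[OF w(2) lt[symmetric]] n eq by (cases "w n") auto
qed

lemma tilde_Fmap: "w \<in> Oreg \<Longrightarrow> tilde f (Fmap w) = f w"
  by (simp add: tilde_def inv_into_f_f[OF inj_on_Fmap])

lemma wextend_Oreg: "wextend v \<in> Oreg"
  unfolding Oreg_iff
proof
  fix N show "\<exists>t\<ge>N. wextend v t"
    by (rule exI[of _ "max N (length v)"]) (simp add: wextend_def)
qed

lemma countable_not_Oreg: "countable (- Oreg)"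
proof (rule countable_subset)
  let ?h = "\<lambda>v i. if i < length v then v ! i else False"
  show "- Oreg \<subseteq> range ?h"
  proof
    fix w assume "w \<in> - Oreg"
    then obtain N where "\<forall>t\<ge>N. \<not> w t" by (auto simp: Oreg_def)
    then have "w = ?h (map w [0..<N])" by (auto simp: fun_eq_iff)
    then show "w \<in> range ?h" by blast
  qed
qed simp

lemma sets_OmegaPlus_singleton: "{w} \<in> sets OmegaPlus"
proof -
  have "{v \<in> space OmegaPlus. \<forall>i. v i = w i} \<in> sets OmegaPlus"
    unfolding OmegaPlus_def by measurable
  moreover have "{v \<in> space OmegaPlus. \<forall>i. v i = w i} = {w}"
    by (auto simp: OmegaPlus_def space_PiM fun_eq_iff)
  ultimately show ?thesis by simp
qed

text \<open>Sequences with \<open>n\<close> common digits have images at distance at most 2^-n on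
  the line, hence on the torus, and the Hoelder exponent turns this into a geometric rate.\<close>

lemma holder_observable:
  assumes h: "holder_T1 alpha (tilde f)" and alpha: "0 < alpha"
  obtains K L where "0 < K" "\<And>w. w \<in> Oreg \<Longrightarrow> \<bar>f w\<bar> \<le> K"
    "\<And>n w w'. w \<in> Oreg \<Longrightarrow> w' \<in> Oreg \<Longrightarrow> (\<And>i. i < n \<Longrightarrow> w i = w' i) \<Longrightarrow> \<bar>f w - f w'\<bar> \<le> L * (2 powr - alpha) ^ n"
proof -
  obtain K where K: "0 < K" "\<And>x. x \<in> {0..<1} \<Longrightarrow> \<bar>tilde f x\<bar> \<le> K"
    using h unfolding holder_T1_def bounded_pos by auto
  obtain L where L: "\<And>x y. x \<in> {0..<1} \<Longrightarrow> y \<in> {0..<1} \<Longrightarrow> \<bar>tilde f x - tilde f y\<bar> \<le> L * tdist x y powr alpha"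
    using h unfolding holder_T1_def by blast
  have F: "Fmap w \<in> {0..<1}" if "w \<in> Oreg" for w
    using Fmap_nonneg Fmap_less_1[OF that] by simp
  show ?thesis
  \<comment> \<open>The Hoelder constant may be any real number; its modulus makes the bound
    monotone in the distance.\<close>
  proof (rule that[of K "\<bar>L\<bar>"])
    show "\<bar>f w\<bar> \<le> K" if "w \<in> Oreg" for w using K(2)[OF F[OF that]] tilde_Fmap[OF that] by simp
    fix n w w' assume w: "w \<in> Oreg" "w' \<in> Oreg" and eq: "\<And>i. i < n \<Longrightarrow> w i = w' i"
    let ?d = "tdist (Fmap w) (Fmap w')"
    have "\<bar>f w - f w'\<bar> \<le> L * ?d powr alpha"
      using L[OF F[OF w(1)] F[OF w(2)]] tilde_Fmap[OF w(1)] tilde_Fmap[OF w(2)] by simp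
    also have "\<dots> \<le> \<bar>L\<bar> * ?d powr alpha" by (intro mult_right_mono) auto
    also have "?d powr alpha \<le> (1 / 2 ^ n) powr alpha"
      using Fmap_close[of n w w'] eq F[OF w(1)] F[OF w(2)] alpha
      by (intro powr_mono2) (auto simp: tdist_def)
    also have "(1 / 2 ^ n) powr alpha = (2 powr - alpha) ^ n"
    proof -
      have "(1 / 2 ^ n :: real) = 2 powr - real n" by (simp add: powr_minus powr_realpow divide_inverse)
      then have "(1 / 2 ^ n) powr alpha = 2 powr (- alpha * real n)" by (simp add: powr_powr mult.commute)
      then show ?thesis by (simp add: powr_powr flip: powr_realpow)
    qed
    finally show "\<bar>f w - f w'\<bar> \<le> \<bar>L\<bar> * (2 powr - alpha) ^ n" by (simp add: mult_left_mono)
  qed (rule K(1))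
qed

text \<open>Measurability of \<open>f\<close> has to be derived: on \<open>Oreg\<close> it is the
  pointwise limit of its values at padded prefixes, and off \<open>Oreg\<close> only countably many
  sequences remain. The same approximants supply the geometric rate.\<close>

lemma (in mixing_sequence) mixing_observable_holder:
  assumes h: "holder_T1 alpha (tilde f)" and alpha: "0 < alpha"
    and reg: "AE w in P. w \<in> Oreg" and mean: "expectation f = 0"
  shows "\<exists>K L. mixing_observable P C \<theta> f K L (2 powr - alpha)"
proof -
  let ?r = "2 powr - alpha"
  obtain K L where K: "0 < K" "\<And>w. w \<in> Oreg \<Longrightarrow> \<bar>f w\<bar> \<le> K"
    and L: "\<And>n w w'. w \<in> Oreg \<Longrightarrow> w' \<in> Oreg \<Longrightarrow> (\<And>i. i < n \<Longrightarrow> w i = w' i) \<Longrightarrow> \<bar>f w - f w'\<bar> \<le> L * ?r ^ n"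
    using holder_observable[OF h alpha] by metis
  have r: "0 < ?r" "?r < 1" using alpha by (auto simp: powr_less_one)
  define g where "g n w = f (wextend (wprefix n w))" for n w
  have g: "cylindrical n (g n)" "\<bar>g n w\<bar> \<le> K" for n w
  proof -
    show "cylindrical n (g n)"
      unfolding cylindrical_def g_def
    proof (intro allI impI)
      fix w w' :: "nat \<Rightarrow> bool" assume "\<forall>i<n. w i = w' i"
      then have "wprefix n w = wprefix n w'" by (simp add: wprefix_def)
      then show "f (wextend (wprefix n w)) = f (wextend (wprefix n w'))" by simp
    qed
    show "\<bar>g n w\<bar> \<le> K" unfolding g_def by (rule K(2)[OF wextend_Oreg])
  qed
  have close: "\<bar>f w - g n w\<bar> \<le> L * ?r ^ n" if "w \<in> Oreg" for n w
    unfolding g_def by (rule L[OF that wextend_Oreg]) (simp add: wextend_def wprefix_def)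
  have sing: "{w} \<in> sets P" for w using sets_OmegaPlus_singleton by (simp add: sets_P)
  have "- Oreg \<in> sets P"
    by (rule sets.countable[OF _ countable_not_Oreg]) (rule sing)
  then have [measurable]: "Oreg \<in> sets P" using sets.compl_sets[of "- Oreg" P] by (simp add: Compl_eq_Diff_UNIV[symmetric])
  have "(\<lambda>w. f w * indicator Oreg w) \<in> borel_measurable P"
  proof (rule borel_measurable_LIMSEQ_real)
    have [measurable]: "g n \<in> borel_measurable P" for n by (rule cylindrical_measurable[OF g(1)])
    show "(\<lambda>w. g n w * indicator Oreg w) \<in> borel_measurable P" for n by measurable
    fix w
    show "(\<lambda>n. g n w * indicator Oreg w) \<longlonglongrightarrow> f w * indicator Oreg w"
    proof (cases "w \<in> Oreg")
      case True
      have "(\<lambda>n. g n w - f w) \<longlonglongrightarrow> 0"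
      proof (rule Lim_null_comparison)
        show "(\<lambda>n. L * ?r ^ n) \<longlonglongrightarrow> 0"
          using r by (intro tendsto_mult_right_zero LIMSEQ_realpow_zero) auto
        show "\<forall>\<^sub>F n in sequentially. norm (g n w - f w) \<le> L * ?r ^ n"
        proof (rule always_eventually, rule allI)
          fix n show "norm (g n w - f w) \<le> L * ?r ^ n"
            using close[OF True, of n] by (simp add: abs_minus_commute[of "g n w"])
        qed
      qed
      then show ?thesis using True by (simp add: LIM_zero_iff)
    qed simp
  qed
  \<comment> \<open>Restoring the true values off \<open>Oreg\<close> changes the function on a
    countable set of measurable points.\<close>
  then have "f \<in> borel_measurable P"
    by (rule measurable_discrete_difference[where X = "- Oreg"]) (auto simp: countable_not_Oreg sing)
  then have "mixing_observable P C \<theta> f K L ?r"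
    using K r mean reg g close
    by unfold_locales (auto elim!: eventually_mono intro!: exI[of _ "g _"])
  then show ?thesis by blast
qed

section \<open>The limit statements and their application to the chain\<close>

lemma (in mixing_observable) statistics:
  defines "s \<equiv> (\<integral>w. (f w)\<^sup>2 \<partial>P) + 2 * (\<Sum>t. \<integral>w. f w * f ((Sshift ^^ Suc t) w) \<partial>P)"
  shows "summable (\<lambda>t. \<bar>\<integral>w. f w * f ((Sshift ^^ Suc t) w) \<partial>P\<bar>)" (is ?summable)
    and "s \<ge> 0" (is ?nonneg)
    and "(\<lambda>n. pvar P (\<lambda>w. Ssum f n w / sqrt (real n))) \<longlonglongrightarrow> s" (is ?variance)
    and "s > 0 \<longrightarrow> weak_conv_m (\<lambda>n. distr P borel (\<lambda>w. Ssum f n w / sqrt (real n)))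
           (density lborel (normal_density 0 (sqrt s)))" (is ?clt)
proof -
  have s: "s = sigma2" by (simp add: s_def sigma2_def cov_def power2_eq_square)
  have Ssum: "Ssum f n = (\<lambda>w. \<Sum>t<n. X t w)" for n by (simp add: Ssum_def fun_eq_iff)
  show ?summable using summable_abs_cov summable_Suc_iff[of "\<lambda>t. \<bar>cov t\<bar>"] by (simp add: cov_def)
  show ?nonneg using sigma2_nonneg by (simp add: s)
  have mean: "expectation (\<lambda>w. (\<Sum>t<n. X t w) / sqrt (real n)) = 0" for n
    using integrable_X expectation_X by simp
  have "pvar P (\<lambda>w. Ssum f n w / sqrt (real n)) = expectation (\<lambda>w. (\<Sum>t<n. X t w)\<^sup>2) / real n" for n
    unfolding pvar_def Ssum mean by (simp add: power_divide)
  then show ?variance using variance_tendsto by (simp add: s)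
  show ?clt using central_limit by (simp add: s Ssum)
qed

theorem theorem3:
  fixes alpha M :: real
  assumes alpha: "1/2 < alpha" "alpha < 1" and M: "M > 1"
  shows "\<exists>\<delta>>0. \<forall>(d::nat) (P0::int list \<Rightarrow> real) (c::int list \<Rightarrow> real) (eps::real)
           (Q0::bool \<Rightarrow> bool \<Rightarrow> real) (Q1::bool \<Rightarrow> bool \<Rightarrow> real)
           (Pi::(int list \<Rightarrow> bool) measure) (mubar::real) (wp::(nat \<Rightarrow> bool) measure)
           (f::(nat \<Rightarrow> bool) \<Rightarrow> real).
    (let T = Top d P0 c eps Q0 Q1 in
     d \<ge> 1 \<and> eps > 0
     \<comment> \<open>P_0: even, finite-range probability distribution, aperiodicity, 1/ptilde in Wiener algebra\<close>
     \<and> (\<forall>u\<in>sites d. 0 \<le> P0 u) \<and> finite {u\<in>sites d. P0 u \<noteq> 0}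
     \<and> (\<Sum>\<^sub>\<infinity>u\<in>sites d. P0 u) = 1
     \<and> (\<forall>u\<in>sites d. P0 (vneg u) = P0 u)
     \<and> (\<forall>lam\<in>torus_d d. cmod (ptilde d P0 lam) = 1 \<longleftrightarrow> lam = replicate d 0)
     \<and> (\<exists>b::int list \<Rightarrow> complex. (\<lambda>u. norm (b u)) summable_on sites d \<and>
          (\<forall>lam\<in>torus_d d. ptilde d P0 lam \<noteq> 0 \<and>
             inverse (ptilde d P0 lam) = (\<Sum>\<^sub>\<infinity>u\<in>sites d. b u * cis (ipr lam u))))
     \<comment> \<open>c: odd, finite range, P_0 +- eps c in [0,1)\<close>
     \<and> (\<forall>u\<in>sites d. c (vneg u) = - c u) \<and> finite {u\<in>sites d. c u \<noteq> 0}
     \<and> (\<forall>u\<in>sites d. 0 \<le> P0 u + eps * c u \<and> P0 u + eps * c u < 1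
                    \<and> 0 \<le> P0 u - eps * c u \<and> P0 u - eps * c u < 1)
     \<comment> \<open>Q_0, Q_1\<close>
     \<and> sym_stoch Q0 \<and> sym_stoch Q1
     \<and> (\<exists>mu. 0 < \<bar>mu\<bar> \<and> \<bar>mu\<bar> < 1 \<and> is_eigenvalue2 Q0 mu)
     \<comment> \<open>standing assumptions\<close>
     \<and> (\<forall>a\<in>HMc d M. \<exists>b\<in>HMc d M. \<forall>eta\<in>space (OmegaM d). T (fun_of d a) eta = fun_of d b eta)
     \<and> prob_space Pi \<and> sets Pi = sets (OmegaM d)
     \<and> (\<forall>A\<in>sets (OmegaM d). (\<integral>eta. T (indicator A) eta \<partial>Pi) = measure Pi A)
     \<and> (\<exists>rho C. rho \<in> borel_measurable (OmegaM d) \<and> (\<forall>eta. 0 \<le> rho eta \<and> rho eta \<le> C)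
                \<and> Pi = density (Pi0 d) (\<lambda>eta. ennreal (rho eta)))
     \<and> 0 < mubar \<and> mubar < 1
     \<and> (\<forall>a\<in>HMc d M. \<forall>b\<in>HMc d M. (\<integral>eta. fun_of d a eta \<partial>Pi) = 0 \<longrightarrow>
           (\<forall>eta\<in>space (OmegaM d). T (fun_of d a) eta = fun_of d b eta) \<longrightarrow>
           Mnorm d M b \<le> mubar * Mnorm d M a)
     \<comment> \<open>wp is the law of (eta_t(0))_t under the stationary chain started from Pi\<close>
     \<and> prob_space wp \<and> sets wp = sets OmegaPlus
     \<and> (\<forall>gs::(bool \<Rightarrow> real) list.
          (\<integral>w. (\<Prod>t<length gs. (gs ! t) (w t)) \<partial>wp) = (\<integral>eta. W T (zerov d) gs eta \<partial>Pi))
     \<comment> \<open>smallness and the observable f\<close>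
     \<and> mubar < \<delta>
     \<and> holder_T1 alpha (tilde f)
     \<and> (\<integral>w. f w \<partial>wp) = 0)
    \<longrightarrow>
    (let sigma2 = (\<integral>w. (f w)\<^sup>2 \<partial>wp) + 2 * (\<Sum>t. \<integral>w. f w * f ((Sshift ^^ Suc t) w) \<partial>wp) in
       summable (\<lambda>t. \<bar>\<integral>w. f w * f ((Sshift ^^ Suc t) w) \<partial>wp\<bar>)
     \<and> sigma2 \<ge> 0
     \<and> (\<lambda>n. pvar wp (\<lambda>w. Ssum f n w / sqrt (real n))) \<longlonglongrightarrow> sigma2
     \<and> (sigma2 > 0 \<longrightarrow>
          weak_conv_m (\<lambda>n. distr wp borel (\<lambda>w. Ssum f n w / sqrt (real n)))
                      (density lborel (normal_density 0 (sqrt sigma2)))))"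
\<comment> \<open>This threshold is the one for which \<open>mubar\<close> below it gives
  \<open>mubar * (1 + M) \<le> 1 / 2\<close>.\<close>
proof (rule exI[of _ "1 / (2 * (1 + M))"], intro conjI allI, goal_cases)
  case 1
  show ?case using M by simp
next
  case (2 d P0 c eps Q0 Q1 Pi mubar wp f)
  show ?case
  proof (unfold Let_def, rule impI, elim conjE, goal_cases)
    case A: 1
    interpret R: rw_chain d P0 c eps Q0 Q1 M mubar Pi wp
    proof (intro rw_chain.intro rw_chain_axioms.intro)
      show "env_walk d P0 c eps"
        by unfold_locales (use A(4,5,9,10,11) in blast)+
      show "mubar * (1 + M) \<le> 1 / 2" using A(26) M by (simp add: field_simps)
    qed (fact M A)+
    interpret P: mixing_sequence wp "2 * M + 4" mubar by (rule R.mixing_sequence_wp)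
    \<comment> \<open>An eigenvalue of modulus below 1 makes \<open>Q0\<close> strictly positive,
      which puts almost every sequence in \<open>Oreg\<close>, the set on which the Hoelder bound
      controls \<open>f\<close>.\<close>
    obtain mu where "\<bar>mu\<bar> < 1" "is_eigenvalue2 Q0 mu" using A(14) by blast
    then have "0 < Q0 a b" for a b using sym_stoch_pos A(12) by blast
    then have "0 < R.wp.expectation (\<lambda>w. if w 0 then 1 else 0 :: real)"
      using A(12) by (intro R.plus_spin_pos) (auto simp: sym_stoch_def less_imp_le)
    then have "AE w in wp. w \<in> Oreg" by (rule P.AE_not_eventually_False)
    from P.mixing_observable_holder[OF A(27) _ this A(28)] alpha
    obtain K L where "mixing_observable wp (2 * M + 4) mubar f K L (2 powr - alpha)" by auto
    then interpret F: mixing_observable wp "2 * M + 4" mubar f K L "2 powr - alpha" .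
    show ?case by (intro conjI F.statistics)
  qed
qed

end
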